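(* Let $A\in\mathbb{R}^{n\times n}$. The first canonical form of $A$ for real-congruence (a direct sum of blocks of Types (i)–(iv)) determines $\text{real-KCF}(A^\top,A)$ under strict real-equivalence uniquely up to permutation of its direct summands. Conversely, $\text{real-KCF}(A^\top,A)$ determines the first canonical form of $A$ for real-congruence uniquely up to permutation of summands, multiplication of any direct summand of type $\Gamma_k\otimes[\pm1]$ by $-1$, and multiplication of the parameter $a$ in any direct summand of type $\Gamma_k\otimes C(a,b)$ by $-1$. For any direct summand $B$ of Types (i), (ii), (iii), (iv), $\text{real-KCF}(B^\top,B)$ is as follows: 1. If $B=J_k(0)$: $(F_\ell,G_\ell)\oplus(F_\ell^\top,G_\ell^\top)$ if $k=2\ell+1$, and $(J_\ell(0),I_\ell)\oplus(I_\ell,J_\ell(0))$ if $k=2\ell$. 2. If $B=\Gamma_k\otimes(\pm1)$: $\left(I_k,J_k((-1)^{k+1})\right)$. 3. If $B=\Gamma_k\otimes C(a,b)$ with $a,b\in\mathbb{R}$, $a^2+b^2=1$, $b>0$: $\left(I_k,J_k((-1)^k)\right)\oplus\left(I_k,J_k((-1)^k)\right)$ if $a=0$, $b=1$, and $\left(I_{2k},C_{2k}\left((-1)^{k+1}(a^2-b^2),\,2|ab|\right)\right)$ if $a\ne0$. 4. If $B=H_{2k}(a)$ with $a\in\mathbb{R}$, $0<|a|<1$: $(I_k,J_k(a))\oplus(I_k,J_k(1/a))$. 5. If $B=\widehat H_{4k}(a,b)$ with $a,b\in\mathbb{R}$, $a^2+b^2<1$, $b>0$: $(I_{2k},C_{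2k}(a,b))\oplus\left(I_{2k},C_{2k}\left(\frac{a}{a^2+b^2},\frac{b}{a^2+b^2}\right)\right)$.
   Context: Two matrices $A,B\in\mathbb{R}^{n\times n}$ are real-congruent if $SAS^\top=B$ for some invertible $S\in\mathbb{R}^{n\times n}$. Two pairs $(A,B),(C,D)$ of real $m\times n$ matrices are strictly real-equivalent if $RAS=C$ and $RBS=D$ for some invertible real matrices $R,S$. Direct sum: $A\oplus B=\begin{bmatrix} A & 0 \\ 0 & B \end{bmatrix}$, $(A,B)\oplus(C,D)=(A\oplus C,B\oplus D)$; $\otimes$ is the Kronecker product. For integers $k\ge1$: $J_k(\mu)$ is the $k\times k$ upper triangular Jordan block with $\mu$ on the diagonal and $1$ on the superdiagonal. $\Gamma_k$ is the $k\times k$ matrix whose only nonzero entries are $(\Gamma_k)_{r,\,k+1-r}=(-1)^{k-r}$ for $1\le r\le k$ and $(\Gamma_k)_{r,\,k+2-r}=(-1)^{k-r}$ for $2\le r\le k$. So $\Gamma_1=1$, $\Gamma_2=\begin{bmatrix} 0 & -1 \\ 1 & 1 \end{bmatrix}$, $\Gamma_3=\begin{bmatrix} 0 & 0 & 1 \\ 0 & -1 & -1 \\ 1 & 1 & 0 \end{bmatrix}$. $H_{2k}(\mu)=\begin{bmatrix} 0 & I_k \\ J_k(\mu) & 0 \end{bmatrix}$. $C(a,b)=\begin{bmatrix} a & b \\ -b & a \end{bmatrix}$; $C_{2k}(a,b)$ is the $2k\times 2k$ block upper bidiagonal matrix with $k$ diagonal blocks equal to $C(a,b)$, blocks $I_2$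 on the block superdiagonal and zeros elsewhere; $\widehat H_{4k}(a,b)=\begin{bmatrix} 0 & I_{2k} \\ C_{2k}(a,b) & 0 \end{bmatrix}$. $F_k=[I_k\ \ 0]$ and $G_k=[0\ \ I_k]$ are $k\times(k+1)$ matrices, for $k\ge0$ ($F_0=G_0$ is the $0\times1$ matrix). First canonical form for real-congruence: each $A\in\mathbb{R}^{n\times n}$ is real-congruent to a direct sum, uniquely determined up to permutation of summands, of blocks of Type (i): $J_k(0)$; Type (ii): $\Gamma_k\otimes N$ with $N=\pm1$ or $N=C(a,b)$, $a,b\in\mathbb{R}$, $a^2+b^2=1$, $b>0$; Type (iii): $H_{2k}(a)$, $a\in\mathbb{R}$, $0<|a|<1$; Type (iv): $\widehat H_{4k}(a,b)$, $a,b\in\mathbb{R}$, $a^2+b^2<1$, $b>0$. Real Kronecker canonical form (known result): each real pair $(A,B)$ of $m\times n$ matrices is strictly real-equivalent to a direct sum, uniquely determined up to permutation of summands, of pairs of the types $(I_k,J_k(\mu))$ with $\mu\in\mathbb{R}$; $(J_k(0),I_k)$; $(I_{2k},C_{2k}(a,b))$ with $a,b\in\mathbb{R}$, $b>0$; $(F_k,G_k)$; $(F_k^\top,G_k^\top)$. This direct sum is denoted $\text{real-KCF}(A,B)$. *)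

theory Defs
  imports Jordan_Normal_Form.Jordan_Normal_Form "HOL-Library.Multiset"
begin

definition real_congruent :: "nat \<Rightarrow> real mat \<Rightarrow> real mat \<Rightarrow> bool" where
  "real_congruent n A B \<longleftrightarrow> A \<in> carrier_mat n n \<and> B \<in> carrier_mat n n \<and>
     (\<exists>S \<in> carrier_mat n n. invertible_mat S \<and> S * A * transpose_mat S = B)"

definition strictly_real_equivalent ::
    "nat \<Rightarrow> nat \<Rightarrow> real mat \<times> real mat \<Rightarrow> real mat \<times> real mat \<Rightarrow> bool" where
  "strictly_real_equivalent m n P Q \<longleftrightarrow>
     fst P \<in> carrier_mat m n \<and> snd P \<in> carrier_mat m n \<and>
     fst Q \<in> carrier_mat m n \<and> snd Q \<in> carrier_mat m n \<and>
     (\<exists>R \<in> carrier_mat m m. \<exists>S \<in> carrier_mat n n. invertible_mat R \<and> invertible_mat S \<and>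
        R * fst P * S = fst Q \<and> R * snd P * S = snd Q)"

text \<open>Direct sums of matrices are \<^const>\<open>diag_block_mat\<close>. Summands may have zero rows or
  zero columns; such a summand only contributes zero columns or zero rows.\<close>

definition pair_direct_sum :: "(real mat \<times> real mat) list \<Rightarrow> real mat \<times> real mat" where
  "pair_direct_sum Ps = (diag_block_mat (map fst Ps), diag_block_mat (map snd Ps))"

definition kronecker_product :: "real mat \<Rightarrow> real mat \<Rightarrow> real mat" where
  "kronecker_product A B = mat (dim_row A * dim_row B) (dim_col A * dim_col B)
     (\<lambda>(i, j). A $$ (i div dim_row B, j div dim_col B) * B $$ (i mod dim_row B, j mod dim_col B))"

text \<open>With indices starting at 0, the 1-based positions \<open>(r, k + 1 - r)\<close> and \<open>(r, k + 2 - r)\<close>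
  are those with \<open>i + j + 1 = k\<close> and \<open>i + j = k\<close>, where \<open>r = i + 1\<close>.\<close>

definition Gamma_mat :: "nat \<Rightarrow> real mat" where
  "Gamma_mat k = mat k k (\<lambda>(i, j). if i + j + 1 = k \<or> i + j = k then (- 1) ^ (k - (i + 1)) else 0)"

definition H_mat :: "nat \<Rightarrow> real \<Rightarrow> real mat" \<comment> \<open>\<open>H_mat k \<mu>\<close> is $H_{2k}(\mu)$\<close> where
  "H_mat k \<mu> = four_block_mat (0\<^sub>m k k) (1\<^sub>m k) (jordan_block k \<mu>) (0\<^sub>m k k)"

definition C_mat :: "real \<Rightarrow> real \<Rightarrow> real mat" where
  "C_mat a b = mat_of_rows_list 2 [[a, b], [- b, a]]"

definition C_block_mat :: "nat \<Rightarrow> real \<Rightarrow> real \<Rightarrow> real mat" \<comment> \<open>\<open>C_block_mat k a b\<close> is $C_{2k}(a,b)$\<close> where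
  "C_block_mat k a b = mat (2 * k) (2 * k) (\<lambda>(i, j).
     if j div 2 = i div 2 then C_mat a b $$ (i mod 2, j mod 2)
     else if j div 2 = i div 2 + 1 then 1\<^sub>m 2 $$ (i mod 2, j mod 2)
     else 0)"

definition H_hat_mat :: "nat \<Rightarrow> real \<Rightarrow> real \<Rightarrow> real mat" \<comment> \<open>\<open>H_hat_mat k a b\<close> is $\widehat H_{4k}(a,b)$\<close> where
  "H_hat_mat k a b =
     four_block_mat (0\<^sub>m (2 * k) (2 * k)) (1\<^sub>m (2 * k)) (C_block_mat k a b) (0\<^sub>m (2 * k) (2 * k))"

definition F_mat :: "nat \<Rightarrow> real mat" where
  "F_mat k = mat k (k + 1) (\<lambda>(i, j). if j = i then 1 else 0)"

definition G_mat :: "nat \<Rightarrow> real mat" where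
  "G_mat k = mat k (k + 1) (\<lambda>(i, j). if j = i + 1 then 1 else 0)"

definition scalar_mat :: "real \<Rightarrow> real mat" \<comment> \<open>the 1-by-1 matrix $[c]$\<close> where
  "scalar_mat c = mat 1 1 (\<lambda>_. c)"

inductive congruence_block :: "real mat \<Rightarrow> bool" where
  type_i: "k \<ge> 1 \<Longrightarrow> congruence_block (jordan_block k 0)"
| type_ii_real: "k \<ge> 1 \<Longrightarrow> \<epsilon> \<in> {1, - 1} \<Longrightarrow>
    congruence_block (kronecker_product (Gamma_mat k) (scalar_mat \<epsilon>))"
| type_ii_C: "k \<ge> 1 \<Longrightarrow> a\<^sup>2 + b\<^sup>2 = 1 \<Longrightarrow> b > 0 \<Longrightarrow>
    congruence_block (kronecker_product (Gamma_mat k) (C_mat a b))"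
| type_iii: "k \<ge> 1 \<Longrightarrow> 0 < \<bar>a\<bar> \<Longrightarrow> \<bar>a\<bar> < 1 \<Longrightarrow> congruence_block (H_mat k a)"
| type_iv: "k \<ge> 1 \<Longrightarrow> a\<^sup>2 + b\<^sup>2 < 1 \<Longrightarrow> b > 0 \<Longrightarrow> congruence_block (H_hat_mat k a b)"

inductive kronecker_block :: "real mat \<times> real mat \<Rightarrow> bool" where
  "k \<ge> 1 \<Longrightarrow> kronecker_block (1\<^sub>m k, jordan_block k \<mu>)"
| "k \<ge> 1 \<Longrightarrow> kronecker_block (jordan_block k 0, 1\<^sub>m k)"
| "k \<ge> 1 \<Longrightarrow> b > 0 \<Longrightarrow> kronecker_block (1\<^sub>m (2 * k), C_block_mat k a b)"
| "kronecker_block (F_mat k, G_mat k)"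
| "kronecker_block (transpose_mat (F_mat k), transpose_mat (G_mat k))"

text \<open>Both canonical forms are only unique up to permutation of summands, so they are relations
  between a matrix (a pair) and a list of summands.\<close>

definition is_first_canonical_form :: "nat \<Rightarrow> real mat \<Rightarrow> real mat list \<Rightarrow> bool" where
  "is_first_canonical_form n A Bs \<longleftrightarrow>
     (\<forall>B \<in> set Bs. congruence_block B) \<and> real_congruent n A (diag_block_mat Bs)"

definition is_real_KCF ::
    "nat \<Rightarrow> nat \<Rightarrow> real mat \<times> real mat \<Rightarrow> (real mat \<times> real mat) list \<Rightarrow> bool" where
  "is_real_KCF m n P Ps \<longleftrightarrow>
     (\<forall>Q \<in> set Ps. kronecker_block Q) \<and> strictly_real_equivalent m n P (pair_direct_sum Ps)"

inductive sign_change :: "real mat \<Rightarrow> real mat \<Rightarrow> bool" where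
  unchanged: "sign_change B B"
| negate_summand: "k \<ge> 1 \<Longrightarrow> \<epsilon> \<in> {1, - 1} \<Longrightarrow>
    sign_change (kronecker_product (Gamma_mat k) (scalar_mat \<epsilon>))
                (- kronecker_product (Gamma_mat k) (scalar_mat \<epsilon>))"
| negate_a: "k \<ge> 1 \<Longrightarrow> a\<^sup>2 + b\<^sup>2 = 1 \<Longrightarrow> b > 0 \<Longrightarrow>
    sign_change (kronecker_product (Gamma_mat k) (C_mat a b))
                (kronecker_product (Gamma_mat k) (C_mat (- a) b))"

definition equal_up_to_permutation_and_signs :: "real mat list \<Rightarrow> real mat list \<Rightarrow> bool" where
  "equal_up_to_permutation_and_signs Bs Bs' \<longleftrightarrow>
     (\<exists>Cs. mset Cs = mset Bs' \<and> list_all2 sign_change Bs Cs)"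

end

theory Submission
  imports Defs
begin

text \<open>
  Everything rests on the uniqueness of the real Kronecker canonical form, which follows from the
  Krull-Schmidt theorem for matrix pairs: every Kronecker block has a local endomorphism ring, local
  summands cancel by a Schur complement argument, and distinct blocks are told apart by their sizes and
  the determinants \<open>det (M + x I)\<close>. The Kronecker form of \<open>(A\<^sup>T, A)\<close> depends only on
  the congruence class of \<open>A\<close> and is additive over direct sums, so it suffices to know it for each
  congruence block. For types (ii)-(iv) it is read off an explicit Jordan chain over the complex numbers,
  with complex scalars replaced by real \<open>2 \<times> 2\<close> blocks; for type (i) it is a permutation of rows and columns.
  Conversely, a single summand of the Kronecker form of a block determines the block up to the allowed
  sign changes, and removing matching blocks one by one compares whole canonical forms.
\<close>

section \<open>Matrix preliminaries\<close>

text \<open>The sign ambiguity has a single source. Under \<open>realify\<close>, real transposition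
  is complex conjugate transposition, so \<open>Gamma_k\<close> tensored with z = a + ib, |z| = 1,
  yields the pencil (conj z Gamma_k^T, z Gamma_k). Its only eigenvalue is (-1)^(k+1) z / conj z =
  (-1)^(k+1) z^2. For z = 1 and z = -1 this is the same number, and replacing a by -a conjugates it,
  which a real Kronecker block cannot see. For z = i the eigenvalue is real, so the real block
  splits into two. All other data survive: type (i) gives a singular pencil or the eigenvalues 0 and
  infinity, type (ii) gives modulus 1, types (iii) and (iv) give one eigenvalue (up to conjugation)
  inside and one outside the unit circle. An eigenvalue 1 or -1 of size k belongs to a real scalar
  or to C(0,1) according to the parity of k. On the uniqueness side the obstacle is the variety of
  blocks: rectangular ones down to the 0 x 1 pair, and blocks with non-real eigenvalues. Treating
  pairs as objects of an additive category makes cancellation uniform and leaves only locality to be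
  checked family by family.\<close>

definition select_mat :: "nat \<Rightarrow> nat \<Rightarrow> (nat \<Rightarrow> nat) \<Rightarrow> 'a :: semiring_1 mat" where
  "select_mat m n \<rho> = mat m n (\<lambda>(i, j). if j = \<rho> i then 1 else 0)"

lemma select_mat_carrier [simp]: "select_mat m n \<rho> \<in> carrier_mat m n"
  by (simp add: select_mat_def)

lemma select_mat_dim [simp]: "dim_row (select_mat m n \<rho>) = m" "dim_col (select_mat m n \<rho>) = n"
  by (simp_all add: select_mat_def)

lemma select_mat_mult:
  assumes "A \<in> carrier_mat n c" "\<And>i. i < m \<Longrightarrow> \<rho> i < n"
  shows "select_mat m n \<rho> * A = mat m c (\<lambda>(i, j). A $$ (\<rho> i, j))"
  using assms by (intro eq_matI) (auto simp: select_mat_def scalar_prod_def if_distrib[of "\<lambda>x. x * _"] cong: if_cong)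

lemma mult_transpose_select_mat:
  fixes A :: "'a :: comm_semiring_1 mat"
  assumes "A \<in> carrier_mat r n" "\<And>i. i < m \<Longrightarrow> \<rho> i < n"
  shows "A * transpose_mat (select_mat m n \<rho>) = mat r m (\<lambda>(i, j). A $$ (i, \<rho> j))"
  using assms by (intro eq_matI) (auto simp: select_mat_def scalar_prod_def if_distrib[of "\<lambda>x. _ * x"] cong: if_cong)

text \<open>Shifted selections are the common form of the block projections (d = 0 or the size of
  the first block) and of \<open>F_mat\<close> and \<open>G_mat\<close> (d = 0 and d = 1).\<close>

lemma mult_select_mat_shift:
  assumes "A \<in> carrier_mat r m"
  shows "A * select_mat m n (\<lambda>i. i + d) = mat r n (\<lambda>(i, j). if d \<le> j \<and> j < m + d then A $$ (i, j - d) else 0)"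
proof (intro eq_matI)
  fix i j assume ij: "i < dim_row (mat r n (\<lambda>(i, j). if d \<le> j \<and> j < m + d then A $$ (i, j - d) else 0))"
    "j < dim_col (mat r n (\<lambda>(i, j). if d \<le> j \<and> j < m + d then A $$ (i, j - d) else 0))"
  \<comment> \<open>Solved for the summation index k, so that the sum collapses to one term; the
    guard is needed because subtraction on naturals truncates.\<close>
  have eq: "(j = k + d) = (d \<le> j \<and> k = j - d)" for k by auto
  show "(A * select_mat m n (\<lambda>i. i + d)) $$ (i, j) =
      mat r n (\<lambda>(i, j). if d \<le> j \<and> j < m + d then A $$ (i, j - d) else 0) $$ (i, j)"
    using ij assms
    by (cases "d \<le> j") (auto simp: select_mat_def scalar_prod_def eq if_distrib[of "\<lambda>x. _ * x"] cong: if_cong)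
qed (use assms in auto)

lemma transpose_select_mat_shift_mult:
  fixes A :: "'a :: comm_semiring_1 mat"
  assumes "A \<in> carrier_mat m c"
  shows "transpose_mat (select_mat m n (\<lambda>i. i + d)) * A =
    mat n c (\<lambda>(i, j). if d \<le> i \<and> i < m + d then A $$ (i - d, j) else 0)"
proof -
  have "transpose_mat (select_mat m n (\<lambda>i. i + d)) * A = transpose_mat (transpose_mat A * select_mat m n (\<lambda>i. i + d))"
    using assms by (subst transpose_mult[where nr=c and n=m and nc=n]) auto
  also have "\<dots> = mat n c (\<lambda>(i, j). if d \<le> i \<and> i < m + d then A $$ (i - d, j) else 0)"
    using assms by (subst mult_select_mat_shift[where r=c]) (auto intro!: eq_matI)
  finally show ?thesis .
qed

lemma mat_assoc:
  "dim_col A = dim_row B \<Longrightarrow> dim_col B = dim_row C \<Longrightarrow> (A * B) * C = A * (B * (C :: 'a :: semiring_0 mat))"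
  by (rule assoc_mult_mat[of A "dim_row A" "dim_row B" B "dim_col B" C "dim_col C"]) auto

lemma mat_distrib_right:
  "dim_col A = dim_row C \<Longrightarrow> dim_row A = dim_row B \<Longrightarrow> dim_col A = dim_col B \<Longrightarrow>
    (A + B) * C = A * C + B * (C :: 'a :: semiring_0 mat)"
  by (rule add_mult_distrib_mat[of A "dim_row A" "dim_col A" B C "dim_col C"]) auto

lemma mat_distrib_left:
  "dim_col A = dim_row B \<Longrightarrow> dim_row B = dim_row C \<Longrightarrow> dim_col B = dim_col C \<Longrightarrow>
    A * (B + C) = A * B + A * (C :: 'a :: semiring_0 mat)"
  by (rule mult_add_distrib_mat[of A "dim_row A" "dim_col A" B "dim_col B" C]) auto

text \<open>The relations are among those expressing that the block matrices with entries \<open>a, b, c, d\<close> and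
  \<open>a', b', c', d'\<close> are inverse to each other.\<close>

lemma schur_complement_inverse:
  fixes a b c d :: "real mat"
  assumes car: "a \<in> carrier_mat p p" "b \<in> carrier_mat p x" "c \<in> carrier_mat y p" "d \<in> carrier_mat y x"
      "b' \<in> carrier_mat p y" "c' \<in> carrier_mat x p" "d' \<in> carrier_mat x y" "e \<in> carrier_mat p p"
    and inv: "a * e = 1\<^sub>m p" "e * a = 1\<^sub>m p"
    and rel: "a * b' + b * d' = 0\<^sub>m p y" "c * b' + d * d' = 1\<^sub>m y"
      "c' * a + d' * c = 0\<^sub>m x p" "c' * b + d' * d = 1\<^sub>m x"
  shows "(d + - (c * e * b)) * d' = 1\<^sub>m y" "d' * (d + - (c * e * b)) = 1\<^sub>m x"
proof -
  have neg: "Y = - X" if "X + Y = 0\<^sub>m r s" "X \<in> carrier_mat r s" "Y \<in> carrier_mat r s" for X Y :: "real mat" and r s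
  proof (rule eq_matI)
    fix i j assume "i < dim_row (- X)" "j < dim_col (- X)"
    then have ij: "i < r" "j < s" using that by auto
    have "(X + Y) $$ (i, j) = 0\<^sub>m r s $$ (i, j)" unfolding that(1) ..
    then have "X $$ (i, j) + Y $$ (i, j) = 0" using ij that(2,3) by simp
    then show "Y $$ (i, j) = (- X) $$ (i, j)" using ij that(2,3) by (simp add: add_eq_0_iff)
  qed (use that in auto)
  have bd: "b * d' = - (a * b')" and dc: "d' * c = - (c' * a)"
    by (rule neg[of _ _ p y], use rel car in auto) (rule neg[of _ _ x p], use rel car in auto)
  have "c * e * b * d' = c * (e * (b * d'))" using car by (simp add: mat_assoc)
  also have "\<dots> = - (c * (e * (a * b')))" unfolding bd using car by simp
  also have "e * (a * b') = b'" using car inv by (simp flip: mat_assoc)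
  finally have 1: "c * e * b * d' = - (c * b')" .
  have "(d + - (c * e * b)) * d' = d * d' + c * b'"
    using car 1 by (simp add: mat_distrib_right)
  also have "\<dots> = 1\<^sub>m y" using rel(2) car by (simp add: comm_add_mat[of _ y y])
  finally show "(d + - (c * e * b)) * d' = 1\<^sub>m y" .
  have "d' * (c * e * b) = (d' * c) * (e * b)" using car by (simp add: mat_assoc)
  also have "\<dots> = - (c' * (a * (e * b)))" unfolding dc using car by (simp add: mat_assoc)
  also have "a * (e * b) = b" using car inv by (simp flip: mat_assoc)
  finally have 2: "d' * (c * e * b) = - (c' * b)" .
  have "d' * (d + - (c * e * b)) = d' * d + c' * b"
    using car 2 by (simp add: mat_distrib_left)
  also have "\<dots> = 1\<^sub>m x" using rel(4) car by (simp add: comm_add_mat[of _ x x])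
  finally show "d' * (d + - (c * e * b)) = 1\<^sub>m x" .
qed

lemma mat_inverse_exists:
  fixes A :: "'a :: field mat"
  assumes "A \<in> carrier_mat n n" "det A \<noteq> 0"
  obtains B where "B \<in> carrier_mat n n" "A * B = 1\<^sub>m n" "B * A = 1\<^sub>m n"
  using det_non_zero_imp_unit[OF assms, of "()"] unfolding Units_def by (auto simp: ring_mat_simps)

lemma det_nonzero_of_right_inverse:
  fixes A :: "'a :: field mat"
  assumes "A \<in> carrier_mat n n" "B \<in> carrier_mat n n" "A * B = 1\<^sub>m n"
  shows "det A \<noteq> 0"
  using det_mult[OF assms(1,2)] assms(3) by auto

lemma invertible_mat_iff_det:
  fixes A :: "'a :: field mat"
  assumes A: "A \<in> carrier_mat n n"
  shows "invertible_mat A \<longleftrightarrow> det A \<noteq> 0"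
proof
  assume "invertible_mat A"
  then obtain B where "A * B = 1\<^sub>m (dim_row A)" "B * A = 1\<^sub>m (dim_row B)" 
    unfolding invertible_mat_def inverts_mat_def by auto
  moreover from this have "B \<in> carrier_mat n n" using A
    by (metis carrier_matD(1) carrier_matI index_mult_mat(2,3) index_one_mat(2,3) carrier_matD(2))
  ultimately show "det A \<noteq> 0" using A det_nonzero_of_right_inverse by auto
next
  assume "det A \<noteq> 0"
  then obtain B where "B \<in> carrier_mat n n" "A * B = 1\<^sub>m n" "B * A = 1\<^sub>m n"
    using mat_inverse_exists[OF A] by metis
  then show "invertible_mat A" using A
    unfolding invertible_mat_def inverts_mat_def by (auto intro!: exI[of _ B])
qed

text \<open>Compare traces: tr(AB) = tr(BA) reads m = n over the reals.\<close>

lemma dims_eq_of_mutual_inverse: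
  fixes A B :: "real mat"
  assumes "A \<in> carrier_mat m n" "B \<in> carrier_mat n m" "A * B = 1\<^sub>m m" "B * A = 1\<^sub>m n"
  shows "m = n"
proof -
  have "real m = (\<Sum>i<m. (A * B) $$ (i, i))" using assms by simp
  also have "\<dots> = (\<Sum>i<m. \<Sum>j<n. A $$ (i, j) * B $$ (j, i))"
    using assms(1,2) by (intro sum.cong) (auto simp: scalar_prod_def atLeast0LessThan)
  also have "\<dots> = (\<Sum>j<n. \<Sum>i<m. B $$ (j, i) * A $$ (i, j))"
    by (subst sum.swap) (simp add: mult.commute)
  also have "\<dots> = (\<Sum>j<n. (B * A) $$ (j, j))"
    using assms(1,2) by (intro sum.cong) (auto simp: scalar_prod_def atLeast0LessThan)
  also have "\<dots> = real n" using assms by simp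
  finally show ?thesis by simp
qed

section \<open>Morphisms of matrix pencils\<close>

abbreviation nrows :: "real mat \<times> real mat \<Rightarrow> nat" where "nrows X \<equiv> dim_row (fst X)"
abbreviation ncols :: "real mat \<times> real mat \<Rightarrow> nat" where "ncols X \<equiv> dim_col (fst X)"

definition pencil :: "real mat \<times> real mat \<Rightarrow> bool" where
  "pencil X \<longleftrightarrow> snd X \<in> carrier_mat (nrows X) (ncols X)"

lemma pencil_dims [simp]:
  "pencil X \<Longrightarrow> dim_row (snd X) = nrows X" "pencil X \<Longrightarrow> dim_col (snd X) = ncols X"
  by (auto simp: pencil_def)

text \<open>An equivalence R X S = Y is rewritten as R X = Y S' with S' the inverse of S. In this
  form the pairs (R, S') also make sense when not invertible, and they can be added and
  composed.\<close>

definition phom :: "real mat \<times> real mat \<Rightarrow> real mat \<times> real mat \<Rightarrow> (real mat \<times> real mat) set" where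
  "phom X Y = {(R, S). R \<in> carrier_mat (nrows Y) (nrows X) \<and> S \<in> carrier_mat (ncols Y) (ncols X) \<and>
     R * fst X = fst Y * S \<and> R * snd X = snd Y * S}"

definition hcomp :: "real mat \<times> real mat \<Rightarrow> real mat \<times> real mat \<Rightarrow> real mat \<times> real mat" (infixl "\<star>" 70)
  where "f \<star> g = (fst f * fst g, snd f * snd g)"

definition hplus :: "real mat \<times> real mat \<Rightarrow> real mat \<times> real mat \<Rightarrow> real mat \<times> real mat" (infixl "\<boxplus>" 65)
  where "f \<boxplus> g = (fst f + fst g, snd f + snd g)"

definition hneg :: "real mat \<times> real mat \<Rightarrow> real mat \<times> real mat" where
  "hneg f = (- fst f, - snd f)"

definition hid :: "real mat \<times> real mat \<Rightarrow> real mat \<times> real mat" where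
  "hid X = (1\<^sub>m (nrows X), 1\<^sub>m (ncols X))"

definition hzero :: "real mat \<times> real mat \<Rightarrow> real mat \<times> real mat \<Rightarrow> real mat \<times> real mat" where
  "hzero X Y = (0\<^sub>m (nrows Y) (nrows X), 0\<^sub>m (ncols Y) (ncols X))"

text \<open>A determinant criterion, so only meaningful for morphisms between pencils of equal size.\<close>

definition hinv :: "real mat \<times> real mat \<Rightarrow> bool" where
  "hinv f \<longleftrightarrow> det (fst f) \<noteq> 0 \<and> det (snd f) \<noteq> 0"

lemmas phom_ops = hcomp_def hplus_def hneg_def hid_def hzero_def

lemma phomI:
  assumes "R \<in> carrier_mat (nrows Y) (nrows X)" "S \<in> carrier_mat (ncols Y) (ncols X)"
    "R * fst X = fst Y * S" "R * snd X = snd Y * S"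
  shows "(R, S) \<in> phom X Y"
  using assms by (simp add: phom_def)

lemma phom_carrier:
  assumes "f \<in> phom X Y"
  shows "fst f \<in> carrier_mat (nrows Y) (nrows X)" "snd f \<in> carrier_mat (ncols Y) (ncols X)"
  using assms by (auto simp: phom_def)

lemma phom_dims:
  assumes "f \<in> phom X Y"
  shows "dim_row (fst f) = nrows Y" "dim_col (fst f) = nrows X"
    "dim_row (snd f) = ncols Y" "dim_col (snd f) = ncols X"
  using phom_carrier[OF assms] by auto

lemma phom_eqs:
  assumes "f \<in> phom X Y"
  shows "fst f * fst X = fst Y * snd f" "fst f * snd X = snd Y * snd f"
  using assms by (auto simp: phom_def)

lemma phom_comp:
  assumes f: "f \<in> phom Y Z" and g: "g \<in> phom X Y" and [simp]: "pencil X" "pencil Y" "pencil Z"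
  shows "f \<star> g \<in> phom X Z"
proof -
  note [simp] = phom_dims[OF f] phom_dims[OF g]
  have "fst f * fst g * fst X = fst Z * (snd f * snd g)"
    by (simp add: mat_assoc phom_eqs[OF g]) (simp add: phom_eqs[OF f] flip: mat_assoc)
  moreover have "fst f * fst g * snd X = snd Z * (snd f * snd g)"
    by (simp add: mat_assoc phom_eqs[OF g]) (simp add: phom_eqs[OF f] flip: mat_assoc)
  ultimately show ?thesis unfolding hcomp_def by (intro phomI) auto
qed

lemma phom_plus:
  assumes f: "f \<in> phom X Y" and g: "g \<in> phom X Y" and [simp]: "pencil X" "pencil Y"
  shows "f \<boxplus> g \<in> phom X Y"
  using phom_eqs[OF f] phom_eqs[OF g] phom_dims[OF f] phom_dims[OF g] unfolding hplus_def
  by (intro phomI) (auto simp: mat_distrib_left mat_distrib_right)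

lemma phom_neg:
  assumes f: "f \<in> phom X Y" and [simp]: "pencil X" "pencil Y"
  shows "hneg f \<in> phom X Y"
  using phom_eqs[OF f] phom_dims[OF f] unfolding hneg_def
  by (intro phomI) auto

lemma phom_id: "pencil X \<Longrightarrow> hid X \<in> phom X X"
  unfolding hid_def by (intro phomI) (auto simp: pencil_def)

lemma hcomp_assoc:
  assumes "f \<in> phom Y Z" "g \<in> phom X Y" "h \<in> phom W X"
  shows "f \<star> g \<star> h = f \<star> (g \<star> h)"
  using phom_dims[OF assms(1)] phom_dims[OF assms(2)] phom_dims[OF assms(3)]
  by (simp add: hcomp_def mat_assoc)

lemma hcomp_id [simp]:
  assumes "f \<in> phom X Y"
  shows "f \<star> hid X = f" "hid Y \<star> f = f"
  using phom_carrier[OF assms] by (auto simp: hcomp_def hid_def intro!: prod_eqI)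

lemma hcomp_zero:
  assumes "f \<in> phom X Y"
  shows "f \<star> hzero W X = hzero W Y" "hzero Y Z \<star> f = hzero X Z"
  using phom_carrier[OF assms] by (auto simp: hcomp_def hzero_def)

lemma hinv_inverse:
  assumes f: "f \<in> phom X Y" and inv: "hinv f" and [simp]: "pencil X" "pencil Y"
    and dims: "nrows Y = nrows X" "ncols Y = ncols X"
  obtains g where "g \<in> phom Y X" "f \<star> g = hid Y" "g \<star> f = hid X"
proof -
  note [simp] = phom_dims[OF f] and car = phom_carrier[OF f, unfolded dims]
  from mat_inverse_exists[OF car(1)] inv obtain R where
    R: "R \<in> carrier_mat (nrows X) (nrows X)" "fst f * R = 1\<^sub>m (nrows X)" "R * fst f = 1\<^sub>m (nrows X)"
    by (auto simp: hinv_def)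
  from mat_inverse_exists[OF car(2)] inv obtain S where
    S: "S \<in> carrier_mat (ncols X) (ncols X)" "snd f * S = 1\<^sub>m (ncols X)" "S * snd f = 1\<^sub>m (ncols X)"
    by (auto simp: hinv_def)
  \<comment> \<open>An intertwining relation passes to the inverses by multiplying with them from
    both sides; it is used for each of the two matrices of the pencils.\<close>
  have *: "R * N = M * S"
    if M: "fst f * M = N * snd f" "M \<in> carrier_mat (nrows X) (ncols X)" "N \<in> carrier_mat (nrows X) (ncols X)" for M N
  proof -
    have "R * N = R * (N * snd f * S)" using M(3) S dims by (simp add: mat_assoc)
    also have "\<dots> = R * fst f * (M * S)" using M(2,3) R(1) S(1) dims by (simp add: mat_assoc flip: M(1))
    finally show ?thesis using R(1,3) M(2) S(1) by simp
  qed
  have "snd X \<in> carrier_mat (nrows X) (ncols X)" "snd Y \<in> carrier_mat (nrows X) (ncols X)"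
    using assms(3,4) dims unfolding pencil_def by simp_all
  moreover have "fst X \<in> carrier_mat (nrows X) (ncols X)" "fst Y \<in> carrier_mat (nrows X) (ncols X)"
    using dims by (intro carrier_matI; simp)+
  ultimately have "R * fst Y = fst X * S" "R * snd Y = snd X * S"
    using *[of "fst X" "fst Y"] *[of "snd X" "snd Y"] phom_eqs[OF f] by blast+
  then have "(R, S) \<in> phom Y X"
    using R(1) S(1) dims by (intro phomI) auto
  with R S show thesis by (intro that[of "(R, S)"]) (auto simp: hcomp_def hid_def dims)
qed

lemma hinv_comp:
  assumes "f \<in> phom Y X" "g \<in> phom X Y" "nrows X = nrows Y" "ncols X = ncols Y"
  shows "hinv (f \<star> g) \<longleftrightarrow> hinv f \<and> hinv g"
  using phom_carrier[OF assms(1)] phom_carrier[OF assms(2)] assms(3,4)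
  by (auto simp: hinv_def hcomp_def det_mult)

lemma hinv_id: "hinv (hid X)"
  by (simp add: hinv_def hid_def)

lemma hinv_neg:
  assumes "f \<in> phom X X"
  shows "hinv (hneg f) \<longleftrightarrow> hinv f"
  using det_0_negate[OF phom_carrier(1)[OF assms]] det_0_negate[OF phom_carrier(2)[OF assms]]
  by (simp add: hinv_def hneg_def)

text \<open>Two-sided inverses instead of determinants, so that the notion makes sense before
  equality of sizes is known; \<open>pencil_iso_dims\<close> derives that equality
  afterwards.\<close>

definition pencil_iso :: "real mat \<times> real mat \<Rightarrow> real mat \<times> real mat \<Rightarrow> bool" where
  "pencil_iso X Y \<longleftrightarrow> (\<exists>f \<in> phom X Y. \<exists>g \<in> phom Y X. g \<star> f = hid X \<and> f \<star> g = hid Y)"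

lemma pencil_iso_refl: "pencil X \<Longrightarrow> pencil_iso X X"
  unfolding pencil_iso_def by (meson hcomp_id(1) phom_id)

lemma pencil_iso_sym: "pencil_iso X Y \<Longrightarrow> pencil_iso Y X"
  unfolding pencil_iso_def by blast

lemma pencil_isoI:
  assumes "f \<in> phom X Y" "hinv f" "pencil X" "pencil Y" "nrows Y = nrows X" "ncols Y = ncols X"
  shows "pencil_iso X Y"
  using hinv_inverse[OF assms] assms(1) unfolding pencil_iso_def by metis

lemma pencil_iso_trans:
  assumes "pencil_iso X Y" "pencil_iso Y Z" and [simp]: "pencil X" "pencil Y" "pencil Z"
  shows "pencil_iso X Z"
proof -
  from assms(1) obtain f f' where f: "f \<in> phom X Y" "f' \<in> phom Y X" "f' \<star> f = hid X" "f \<star> f' = hid Y"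
    unfolding pencil_iso_def by blast
  from assms(2) obtain g g' where g: "g \<in> phom Y Z" "g' \<in> phom Z Y" "g' \<star> g = hid Y" "g \<star> g' = hid Z"
    unfolding pencil_iso_def by blast
  note gf = phom_comp[OF g(1) f(1)] and fg = phom_comp[OF f(2) g(2)]
  have "g' \<star> (g \<star> f) = f" "f \<star> (f' \<star> g') = g'"
    using hcomp_assoc[OF g(2) g(1) f(1)] hcomp_assoc[OF f(1) f(2) g(2)] f g by simp_all
  then have "f' \<star> g' \<star> (g \<star> f) = hid X" "g \<star> f \<star> (f' \<star> g') = hid Z"
    using hcomp_assoc[OF f(2) g(2) gf] hcomp_assoc[OF g(1) f(1) fg] f g by simp_all
  then show ?thesis unfolding pencil_iso_def
    using gf fg by auto
qed

lemma pencil_iso_dims: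
  assumes "pencil_iso X Y"
  shows "nrows X = nrows Y" "ncols X = ncols Y"
proof -
  obtain f g where f: "f \<in> phom X Y" "g \<in> phom Y X" "g \<star> f = hid X" "f \<star> g = hid Y"
    using assms unfolding pencil_iso_def by auto
  then show "nrows X = nrows Y" "ncols X = ncols Y"
    using dims_eq_of_mutual_inverse[of "fst g" "nrows X" "nrows Y" "fst f"]
      dims_eq_of_mutual_inverse[of "snd g" "ncols X" "ncols Y" "snd f"] phom_carrier[OF f(1)] phom_carrier[OF f(2)]
    by (auto simp: hcomp_def hid_def)
qed

section \<open>Direct sums of pencils as biproducts\<close>

definition dsum :: "real mat \<times> real mat \<Rightarrow> real mat \<times> real mat \<Rightarrow> real mat \<times> real mat" where
  "dsum X Y =
    (four_block_mat (fst X) (0\<^sub>m (nrows X) (ncols Y)) (0\<^sub>m (nrows Y) (ncols X)) (fst Y),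
     four_block_mat (snd X) (0\<^sub>m (nrows X) (ncols Y)) (0\<^sub>m (nrows Y) (ncols X)) (snd Y))"

lemma dsum_dims [simp]: "nrows (dsum X Y) = nrows X + nrows Y" "ncols (dsum X Y) = ncols X + ncols Y"
  by (auto simp: dsum_def)

lemma pencil_dsum [simp]: "pencil X \<Longrightarrow> pencil Y \<Longrightarrow> pencil (dsum X Y)"
  by (auto simp: dsum_def pencil_def)

definition "hproj1 X Y = (select_mat (nrows X) (nrows X + nrows Y) (\<lambda>i. i) :: real mat,
  select_mat (ncols X) (ncols X + ncols Y) (\<lambda>i. i) :: real mat)"
definition "hproj2 X Y = (select_mat (nrows Y) (nrows X + nrows Y) (\<lambda>i. i + nrows X) :: real mat,
  select_mat (ncols Y) (ncols X + ncols Y) (\<lambda>i. i + ncols X) :: real mat)"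
definition "hinj1 X Y = (transpose_mat (fst (hproj1 X Y)), transpose_mat (snd (hproj1 X Y)))"
definition "hinj2 X Y = (transpose_mat (fst (hproj2 X Y)), transpose_mat (snd (hproj2 X Y)))"

text \<open>Matrix form of the biproduct identities, with p and q the coordinate projections. The
  last two facts say that p and q intertwine a block diagonal matrix with its diagonal blocks, which
  makes the projections morphisms.\<close>

lemma select_mat_blocks:
  fixes a b :: nat
  defines "p \<equiv> select_mat a (a + b) (\<lambda>i. i) :: real mat"
    and "q \<equiv> select_mat b (a + b) (\<lambda>i. i + a) :: real mat"
  shows "p * transpose_mat p = 1\<^sub>m a" "q * transpose_mat q = 1\<^sub>m b"
    "p * transpose_mat q = 0\<^sub>m a b" "q * transpose_mat p = 0\<^sub>m b a"
    "transpose_mat p * p + transpose_mat q * q = 1\<^sub>m (a + b)"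
    "A \<in> carrier_mat a c \<Longrightarrow> D \<in> carrier_mat b d \<Longrightarrow>
      p * four_block_mat A (0\<^sub>m a d) (0\<^sub>m b c) D = A * select_mat c (c + d) (\<lambda>i. i)"
    "A \<in> carrier_mat a c \<Longrightarrow> D \<in> carrier_mat b d \<Longrightarrow>
      q * four_block_mat A (0\<^sub>m a d) (0\<^sub>m b c) D = D * select_mat d (c + d) (\<lambda>i. i + c)"
proof -
  have p: "p \<in> carrier_mat a (a + b)" and q: "q \<in> carrier_mat b (a + b)" by (simp_all add: p_def q_def)
  have "p * transpose_mat p = mat a a (\<lambda>(i, j). p $$ (i, j))"
    using mult_transpose_select_mat[OF p, of a "\<lambda>i. i"] by (simp add: p_def)
  then show "p * transpose_mat p = 1\<^sub>m a" by (auto simp: p_def select_mat_def)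
  have "p * transpose_mat q = mat a b (\<lambda>(i, j). p $$ (i, j + a))"
    using mult_transpose_select_mat[OF p, of b "\<lambda>i. i + a"] by (simp add: q_def)
  then show "p * transpose_mat q = 0\<^sub>m a b" by (auto simp: p_def select_mat_def)
  have "q * transpose_mat q = mat b b (\<lambda>(i, j). q $$ (i, j + a))"
    using mult_transpose_select_mat[OF q, of b "\<lambda>i. i + a"] by (simp add: q_def)
  then show "q * transpose_mat q = 1\<^sub>m b" by (auto simp: q_def select_mat_def)
  have "q * transpose_mat p = mat b a (\<lambda>(i, j). q $$ (i, j))"
    using mult_transpose_select_mat[OF q, of a "\<lambda>i. i"] by (simp add: p_def)
  then show "q * transpose_mat p = 0\<^sub>m b a" by (auto simp: q_def select_mat_def)
  have "transpose_mat p * p = mat (a + b) (a + b) (\<lambda>(i, j). if i < a \<and> i = j then 1 else 0)"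
    unfolding p_def using transpose_select_mat_shift_mult[of "select_mat a (a + b) (\<lambda>i. i) :: real mat" a "a + b" "a + b" 0]
    by (auto simp: select_mat_def)
  moreover have "transpose_mat q * q = mat (a + b) (a + b) (\<lambda>(i, j). if a \<le> i \<and> i = j then 1 else 0)"
    unfolding q_def by (subst transpose_select_mat_shift_mult) (auto simp: select_mat_def)
  ultimately show "transpose_mat p * p + transpose_mat q * q = 1\<^sub>m (a + b)" by auto
  show "A \<in> carrier_mat a c \<Longrightarrow> D \<in> carrier_mat b d \<Longrightarrow>
      p * four_block_mat A (0\<^sub>m a d) (0\<^sub>m b c) D = A * select_mat c (c + d) (\<lambda>i. i)"
    unfolding p_def using mult_select_mat_shift[of A a c "c + d" 0]
    by (subst select_mat_mult[of _ "a + b" "c + d"]) auto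
  show "A \<in> carrier_mat a c \<Longrightarrow> D \<in> carrier_mat b d \<Longrightarrow>
      q * four_block_mat A (0\<^sub>m a d) (0\<^sub>m b c) D = D * select_mat d (c + d) (\<lambda>i. i + c)"
    unfolding q_def by (subst select_mat_mult[of _ "a + b" "c + d"], auto, subst mult_select_mat_shift) auto
qed

lemma select_mat_blocks_transpose:
  fixes A D :: "real mat"
  assumes A: "A \<in> carrier_mat a c" and D: "D \<in> carrier_mat b d"
  shows "transpose_mat (select_mat a (a + b) (\<lambda>i. i)) * A =
      four_block_mat A (0\<^sub>m a d) (0\<^sub>m b c) D * transpose_mat (select_mat c (c + d) (\<lambda>i. i))"
    "transpose_mat (select_mat b (a + b) (\<lambda>i. i + a)) * D =
      four_block_mat A (0\<^sub>m a d) (0\<^sub>m b c) D * transpose_mat (select_mat d (c + d) (\<lambda>i. i + c))"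
proof -
  let ?B = "four_block_mat A (0\<^sub>m a d) (0\<^sub>m b c) D"
  have B: "?B \<in> carrier_mat (a + b) (c + d)" using A D by auto
  show "transpose_mat (select_mat a (a + b) (\<lambda>i. i)) * A = ?B * transpose_mat (select_mat c (c + d) (\<lambda>i. i))"
    using A D B transpose_select_mat_shift_mult[of A a c "a + b" 0]
      mult_transpose_select_mat[OF B, of c "\<lambda>i. i"] by auto
  show "transpose_mat (select_mat b (a + b) (\<lambda>i. i + a)) * D = ?B * transpose_mat (select_mat d (c + d) (\<lambda>i. i + c))"
    using A D B transpose_select_mat_shift_mult[of D b d "a + b" a]
      mult_transpose_select_mat[OF B, of d "\<lambda>i. i + c"] by auto
qed

lemma hproj_hom [simp]:
  assumes [simp]: "pencil X" "pencil Y"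
  shows "hproj1 X Y \<in> phom (dsum X Y) X" "hproj2 X Y \<in> phom (dsum X Y) Y"
proof -
  have c: "fst X \<in> carrier_mat (nrows X) (ncols X)" "snd X \<in> carrier_mat (nrows X) (ncols X)"
    "fst Y \<in> carrier_mat (nrows Y) (ncols Y)" "snd Y \<in> carrier_mat (nrows Y) (ncols Y)" by auto
  show "hproj1 X Y \<in> phom (dsum X Y) X" unfolding hproj1_def
    by (rule phomI) (use c in \<open>auto simp: dsum_def select_mat_blocks(6)\<close>)
  show "hproj2 X Y \<in> phom (dsum X Y) Y" unfolding hproj2_def
    by (rule phomI) (use c in \<open>auto simp: dsum_def select_mat_blocks(7)\<close>)
qed

lemma hinj_hom [simp]:
  assumes [simp]: "pencil X" "pencil Y"
  shows "hinj1 X Y \<in> phom X (dsum X Y)" "hinj2 X Y \<in> phom Y (dsum X Y)"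
proof -
  have c: "fst X \<in> carrier_mat (nrows X) (ncols X)" "snd X \<in> carrier_mat (nrows X) (ncols X)"
    "fst Y \<in> carrier_mat (nrows Y) (ncols Y)" "snd Y \<in> carrier_mat (nrows Y) (ncols Y)" by auto
  show "hinj1 X Y \<in> phom X (dsum X Y)" unfolding hinj1_def hproj1_def
    by (rule phomI) (simp, simp, (simp add: dsum_def, intro select_mat_blocks_transpose c)+)
  show "hinj2 X Y \<in> phom Y (dsum X Y)" unfolding hinj2_def hproj2_def
    by (rule phomI) (simp, simp, (simp add: dsum_def, intro select_mat_blocks_transpose c)+)
qed

lemma biproduct:
  "hproj1 X Y \<star> hinj1 X Y = hid X" "hproj2 X Y \<star> hinj2 X Y = hid Y"
  "hproj1 X Y \<star> hinj2 X Y = hzero Y X" "hproj2 X Y \<star> hinj1 X Y = hzero X Y"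
  "hinj1 X Y \<star> hproj1 X Y \<boxplus> hinj2 X Y \<star> hproj2 X Y = hid (dsum X Y)"
  by (simp_all add: phom_ops hinj1_def hinj2_def hproj1_def hproj2_def select_mat_blocks)

text \<open>Block matrix multiplication: the decomposition of the identity of
  \<open>dsum X Y\<close> from \<open>biproduct\<close> is inserted between u and v.\<close>

lemma hcomp_through_dsum:
  assumes u: "u \<in> phom (dsum X Y) Z" and v: "v \<in> phom W (dsum X Y)"
    and [simp]: "pencil X" "pencil Y" "pencil Z" "pencil W"
  shows "(u \<star> hinj1 X Y) \<star> (hproj1 X Y \<star> v) \<boxplus> (u \<star> hinj2 X Y) \<star> (hproj2 X Y \<star> v) = u \<star> v"
proof -
  have i: "hinj1 X Y \<in> phom X (dsum X Y)" "hinj2 X Y \<in> phom Y (dsum X Y)"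
    and p: "hproj1 X Y \<in> phom (dsum X Y) X" "hproj2 X Y \<in> phom (dsum X Y) Y" by simp_all
  note ip = phom_comp[OF i(1) p(1)] phom_comp[OF i(2) p(2)]
  have "(u \<star> hinj1 X Y) \<star> (hproj1 X Y \<star> v) = u \<star> (hinj1 X Y \<star> hproj1 X Y) \<star> v"
    using phom_comp[OF p(1) v] by (simp add: hcomp_assoc[OF u i(1)] hcomp_assoc[OF i(1) p(1) v] hcomp_assoc[OF u _ v, OF ip(1)])
  moreover have "(u \<star> hinj2 X Y) \<star> (hproj2 X Y \<star> v) = u \<star> (hinj2 X Y \<star> hproj2 X Y) \<star> v"
    using phom_comp[OF p(2) v] by (simp add: hcomp_assoc[OF u i(2)] hcomp_assoc[OF i(2) p(2) v] hcomp_assoc[OF u _ v, OF ip(2)])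
  moreover have "u \<star> (hinj1 X Y \<star> hproj1 X Y) \<star> v \<boxplus> u \<star> (hinj2 X Y \<star> hproj2 X Y) \<star> v =
      u \<star> (hinj1 X Y \<star> hproj1 X Y \<boxplus> hinj2 X Y \<star> hproj2 X Y) \<star> v"
    using phom_dims[OF u] phom_dims[OF v] phom_dims[OF i(1)] phom_dims[OF i(2)] phom_dims[OF p(1)] phom_dims[OF p(2)]
    by (simp add: hcomp_def hplus_def mat_distrib_left mat_distrib_right mat_assoc)
  ultimately show ?thesis using u by (simp add: biproduct)
qed

text \<open>With projections for u and injections for v, this produces the entry relations of
  \<open>\<phi> \<star> \<psi> = hid A\<close> used in the Schur complement argument.\<close>

lemma hcomp_through_inverse:
  assumes \<phi>: "\<phi> \<in> phom (dsum X Y) A" and \<psi>: "\<psi> \<in> phom A (dsum X Y)" and inv: "\<phi> \<star> \<psi> = hid A"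
    and u: "u \<in> phom A Z" and v: "v \<in> phom W A"
    and [simp]: "pencil X" "pencil Y" "pencil A" "pencil Z" "pencil W"
  shows "(u \<star> \<phi> \<star> hinj1 X Y) \<star> (hproj1 X Y \<star> \<psi> \<star> v) \<boxplus> (u \<star> \<phi> \<star> hinj2 X Y) \<star> (hproj2 X Y \<star> \<psi> \<star> v) = u \<star> v"
proof -
  have p: "hproj1 X Y \<in> phom (dsum X Y) X" "hproj2 X Y \<in> phom (dsum X Y) Y" by simp_all
  have "u \<star> \<phi> \<star> (\<psi> \<star> v) = u \<star> (\<phi> \<star> \<psi> \<star> v)"
    using phom_comp[OF \<psi> v] by (simp add: hcomp_assoc[OF u \<phi>] hcomp_assoc[OF \<phi> \<psi> v])
  then show ?thesis
    using hcomp_through_dsum[OF phom_comp[OF u \<phi>] phom_comp[OF \<psi> v]] v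
    by (simp add: hcomp_assoc[OF p(1) \<psi> v] hcomp_assoc[OF p(2) \<psi> v] inv)
qed

section \<open>Cancellation and the Krull-Schmidt property\<close>

text \<open>Locality of the endomorphism ring in the form that non-units are closed under addition.
  The zero pencil satisfies it trivially (determinants of empty matrices are 1), which is why a
  positive size is demanded separately below.\<close>

definition klocal :: "real mat \<times> real mat \<Rightarrow> bool" where
  "klocal X \<longleftrightarrow> (\<forall>f \<in> phom X X. \<forall>g \<in> phom X X. hinv (f \<boxplus> g) \<longrightarrow> hinv f \<or> hinv g)"

text \<open>The isomorphism is d - c e b with e the inverse of the corner a. Its inverse is the
  entry d' of \<open>\<psi>\<close>, so both composites follow from the entry relations
  alone.\<close>

lemma schur_complement_iso:
  assumes \<phi>: "\<phi> \<in> phom (dsum P X) (dsum P Y)" and \<psi>: "\<psi> \<in> phom (dsum P Y) (dsum P X)"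
    and inv: "\<psi> \<star> \<phi> = hid (dsum P X)" "\<phi> \<star> \<psi> = hid (dsum P Y)"
    and corner: "hinv (hproj1 P Y \<star> \<phi> \<star> hinj1 P X)"
    and [simp]: "pencil P" "pencil X" "pencil Y"
  shows "pencil_iso X Y"
proof -
  have i: "hinj1 P X \<in> phom P (dsum P X)" "hinj2 P X \<in> phom X (dsum P X)"
    "hinj1 P Y \<in> phom P (dsum P Y)" "hinj2 P Y \<in> phom Y (dsum P Y)"
    and p: "hproj1 P X \<in> phom (dsum P X) P" "hproj2 P X \<in> phom (dsum P X) X"
     "hproj1 P Y \<in> phom (dsum P Y) P" "hproj2 P Y \<in> phom (dsum P Y) Y" by simp_all
  note mid = hcomp_through_inverse[OF \<phi> \<psi> inv(2)] and mid' = hcomp_through_inverse[OF \<psi> \<phi> inv(1)]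
  define a where "a = hproj1 P Y \<star> \<phi> \<star> hinj1 P X"
  define b where "b = hproj1 P Y \<star> \<phi> \<star> hinj2 P X"
  define c where "c = hproj2 P Y \<star> \<phi> \<star> hinj1 P X"
  define d where "d = hproj2 P Y \<star> \<phi> \<star> hinj2 P X"
  define b' where "b' = hproj1 P X \<star> \<psi> \<star> hinj2 P Y"
  define c' where "c' = hproj2 P X \<star> \<psi> \<star> hinj1 P Y"
  define d' where "d' = hproj2 P X \<star> \<psi> \<star> hinj2 P Y"
  have a: "a \<in> phom P P" and b: "b \<in> phom X P" and c: "c \<in> phom P Y" and d: "d \<in> phom X Y"
    and b': "b' \<in> phom Y P" and c': "c' \<in> phom P X" and d': "d' \<in> phom Y X"
    unfolding a_def b_def c_def d_def b'_def c'_def d'_def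
    by (rule phom_comp[OF phom_comp[OF _ \<phi>]] phom_comp[OF phom_comp[OF _ \<psi>]]; (rule i p)?; simp)+
  have rel: "a \<star> b' \<boxplus> b \<star> d' = hzero Y P" "c \<star> b' \<boxplus> d \<star> d' = hid Y"
    unfolding a_def b_def c_def d_def b'_def d'_def
    using mid[of "hproj1 P Y" P "hinj2 P Y" Y] mid[of "hproj2 P Y" Y "hinj2 P Y" Y] by (simp_all add: biproduct)
  have rel': "c' \<star> a \<boxplus> d' \<star> c = hzero P X" "c' \<star> b \<boxplus> d' \<star> d = hid X"
    unfolding a_def b_def c_def d_def c'_def d'_def
    using mid'[of "hproj2 P X" X "hinj1 P X" P] mid'[of "hproj2 P X" X "hinj2 P X" X] by (simp_all add: biproduct)
  obtain e where e: "e \<in> phom P P" "a \<star> e = hid P" "e \<star> a = hid P"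
    using hinv_inverse[OF a] corner unfolding a_def by auto
  define s where "s = d \<boxplus> hneg (c \<star> e \<star> b)"
  have s: "s \<in> phom X Y" unfolding s_def
    by (intro phom_plus d phom_neg phom_comp[OF _ b] phom_comp[OF c e(1)]) simp_all
  note cars = a b c d b' c' d' e(1)
  have "s \<star> d' = hid Y" "d' \<star> s = hid X"
    using schur_complement_inverse[OF cars[THEN phom_carrier(1)]] schur_complement_inverse[OF cars[THEN phom_carrier(2)]]
      e rel rel' unfolding s_def by (auto simp: phom_ops)
  then show ?thesis unfolding pencil_iso_def using s d' by auto
qed

lemma pencil_carrier:
  "pencil X \<Longrightarrow> fst X \<in> carrier_mat (nrows X) (ncols X) \<and> snd X \<in> carrier_mat (nrows X) (ncols X)"
  unfolding pencil_def by (intro conjI carrier_matI) auto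

lemma hplus_hneg_cancel:
  assumes "f \<in> phom X Y" "g \<in> phom X Y"
  shows "f \<boxplus> g \<boxplus> hneg f = g"
  using phom_carrier[OF assms(1)] phom_carrier[OF assms(2)]
  by (intro prod_eqI; intro eq_matI) (auto simp: hplus_def hneg_def)

lemma hcomp_distrib_left:
  assumes "f \<in> phom Y Z" "g \<in> phom X Y" "h \<in> phom X Y"
  shows "f \<star> (g \<boxplus> h) = f \<star> g \<boxplus> f \<star> h"
  using assms[THEN phom_dims(1)] assms[THEN phom_dims(2)] assms[THEN phom_dims(3)] assms[THEN phom_dims(4)]
  by (simp add: hcomp_def hplus_def mat_distrib_left)

lemma hcomp_distrib_right:
  assumes "f \<in> phom Y Z" "g \<in> phom Y Z" "h \<in> phom X Y"
  shows "(f \<boxplus> g) \<star> h = f \<star> h \<boxplus> g \<star> h"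
  using assms[THEN phom_dims(1)] assms[THEN phom_dims(2)] assms[THEN phom_dims(3)] assms[THEN phom_dims(4)]
  by (simp add: hcomp_def hplus_def mat_distrib_right)

lemma mat_square_zero_unipotent:
  fixes N :: "'a :: comm_ring_1 mat"
  assumes "N \<in> carrier_mat n n" "N * N = 0\<^sub>m n n"
  shows "(1\<^sub>m n + N) * (1\<^sub>m n + - N) = 1\<^sub>m n" "(1\<^sub>m n + - N) * (1\<^sub>m n + N) = 1\<^sub>m n"
proof -
  have "- 0\<^sub>m n n = (0\<^sub>m n n :: 'a mat)" by auto
  then show "(1\<^sub>m n + N) * (1\<^sub>m n + - N) = 1\<^sub>m n" "(1\<^sub>m n + - N) * (1\<^sub>m n + N) = 1\<^sub>m n"
    using assms by (simp_all add: mat_distrib_left mat_distrib_right) (auto intro!: eq_matI)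
qed

lemma hid_plus_square_zero:
  assumes "n \<in> phom X X" "n \<star> n = hzero X X"
  shows "(hid X \<boxplus> n) \<star> (hid X \<boxplus> hneg n) = hid X" "(hid X \<boxplus> hneg n) \<star> (hid X \<boxplus> n) = hid X"
  using mat_square_zero_unipotent[OF phom_carrier(1)[OF assms(1)]] mat_square_zero_unipotent[OF phom_carrier(2)[OF assms(1)]] assms(2)
  by (simp_all add: phom_ops)

lemma hinv_endo_inverse:
  assumes "f \<in> phom X X" "hinv f" "pencil X"
  shows "\<exists>g \<in> phom X X. f \<star> g = hid X \<and> g \<star> f = hid X"
  using hinv_inverse[OF assms(1,2,3,3) refl refl] by metis

text \<open>Let \<open>\<psi> = \<phi>\<^sup>-\<^sup>1\<close> have entries \<open>a', b', c', d'\<close>. If the corner \<open>a\<close> of \<open>\<phi>\<close> is not invertible, then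
  \<open>b' c\<close> is, because \<open>a' a + b' c = 1\<close>. Adding \<open>b'\<close> times the second row of \<open>\<phi>\<close> to the first
  makes the corner \<open>a + b' c\<close>, which is invertible by locality, and the Schur complement applies.\<close>

lemma klocal_cancel:
  assumes loc: "klocal P" and iso: "pencil_iso (dsum P X) (dsum P Y)"
    and [simp]: "pencil P" "pencil X" "pencil Y"
  shows "pencil_iso X Y"
proof -
  obtain \<phi> \<psi> where \<phi>: "\<phi> \<in> phom (dsum P X) (dsum P Y)" and \<psi>: "\<psi> \<in> phom (dsum P Y) (dsum P X)"
    and inv: "\<psi> \<star> \<phi> = hid (dsum P X)" "\<phi> \<star> \<psi> = hid (dsum P Y)"
    using iso unfolding pencil_iso_def by auto
  have i: "hinj1 P X \<in> phom P (dsum P X)" "hinj2 P X \<in> phom X (dsum P X)"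
    "hinj1 P Y \<in> phom P (dsum P Y)" "hinj2 P Y \<in> phom Y (dsum P Y)"
    and p: "hproj1 P X \<in> phom (dsum P X) P" "hproj2 P X \<in> phom (dsum P X) X"
     "hproj1 P Y \<in> phom (dsum P Y) P" "hproj2 P Y \<in> phom (dsum P Y) Y" by simp_all
  define a where "a = hproj1 P Y \<star> \<phi> \<star> hinj1 P X"
  define c where "c = hproj2 P Y \<star> \<phi> \<star> hinj1 P X"
  define a' where "a' = hproj1 P X \<star> \<psi> \<star> hinj1 P Y"
  define b' where "b' = hproj1 P X \<star> \<psi> \<star> hinj2 P Y"
  have a: "a \<in> phom P P" and c: "c \<in> phom P Y" and a': "a' \<in> phom P P" and b': "b' \<in> phom Y P"
    unfolding a_def c_def a'_def b'_def
    by (rule phom_comp[OF phom_comp[OF _ \<phi>]] phom_comp[OF phom_comp[OF _ \<psi>]]; (rule i p)?; simp)+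
  have bc: "b' \<star> c \<in> phom P P" using phom_comp[OF b' c] by simp
  have "a' \<star> a \<boxplus> b' \<star> c = hid P"
    using hcomp_through_inverse[OF \<psi> \<phi> inv(1) p(1) i(1)]
    unfolding a_def c_def a'_def b'_def by (simp add: biproduct)
  then have "hinv (a' \<star> a) \<or> hinv (b' \<star> c)"
    using loc phom_comp[OF a' a] bc hinv_id[of P] unfolding klocal_def by auto
  then consider "hinv a" | "hinv (a \<boxplus> b' \<star> c)"
  proof
    assume "hinv (a' \<star> a)"
    then show ?thesis using hinv_comp[OF a' a] that by auto
  next
    assume "hinv (b' \<star> c)"
    \<comment> \<open>Locality is applied to the invertible sum b' c = (a + b' c) + (-a).\<close>
    moreover have "a \<boxplus> b' \<star> c \<boxplus> hneg a = b' \<star> c" by (rule hplus_hneg_cancel[OF a bc])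
    ultimately have "hinv (a \<boxplus> b' \<star> c) \<or> hinv (hneg a)"
      using loc phom_plus[OF a bc] phom_neg[OF a] unfolding klocal_def by simp
    then show ?thesis using hinv_neg[OF a] that by auto
  qed
  then show ?thesis
  proof cases
    case 1
    then show ?thesis using schur_complement_iso[OF \<phi> \<psi> inv] unfolding a_def by simp
  next
    case 2
    \<comment> \<open>The row operation that adds b' times the second row to the first is
      \<open>hid + n\<close>. As n ends in the first summand and starts from the second, it squares
      to zero, so \<open>hid - n\<close> is the inverse.\<close>
    define n where "n = hinj1 P Y \<star> (b' \<star> hproj2 P Y)"
    define U where "U = hid (dsum P Y) \<boxplus> n"
    define U' where "U' = hid (dsum P Y) \<boxplus> hneg n"
    have bp: "b' \<star> hproj2 P Y \<in> phom (dsum P Y) P" using phom_comp[OF b' p(4)] by simp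
    have n: "n \<in> phom (dsum P Y) (dsum P Y)" unfolding n_def using phom_comp[OF i(3) bp] by simp
    have UH: "U \<in> phom (dsum P Y) (dsum P Y)" "U' \<in> phom (dsum P Y) (dsum P Y)"
      unfolding U_def U'_def using n by (simp_all add: phom_plus phom_neg phom_id)
    have "hproj2 P Y \<star> n = hzero (dsum P Y) Y"
      unfolding n_def using hcomp_assoc[OF p(4) i(3) bp] hcomp_zero[OF bp] by (simp add: biproduct)
    then have "b' \<star> hproj2 P Y \<star> n = hzero (dsum P Y) P"
      using hcomp_assoc[OF b' p(4) n] hcomp_zero[OF b'] by simp
    then have "n \<star> n = hzero (dsum P Y) (dsum P Y)"
      using hcomp_assoc[OF i(3) bp n] hcomp_zero[OF i(3)] by (simp flip: n_def)
    note UU = hid_plus_square_zero[OF n this, folded U_def U'_def]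
    have U\<phi>: "U \<star> \<phi> \<in> phom (dsum P X) (dsum P Y)" and \<psi>U: "\<psi> \<star> U' \<in> phom (dsum P Y) (dsum P X)"
      using phom_comp[OF UH(1) \<phi>] phom_comp[OF \<psi> UH(2)] by simp_all
    have "\<psi> \<star> U' \<star> (U \<star> \<phi>) = \<psi> \<star> (U' \<star> U \<star> \<phi>)"
      using hcomp_assoc[OF \<psi> UH(2) U\<phi>] hcomp_assoc[OF UH(2,1) \<phi>] by simp
    then have 1: "\<psi> \<star> U' \<star> (U \<star> \<phi>) = hid (dsum P X)" using UU \<phi> inv by simp
    have "U \<star> \<phi> \<star> (\<psi> \<star> U') = U \<star> (\<phi> \<star> \<psi> \<star> U')"
      using hcomp_assoc[OF UH(1) \<phi> \<psi>U] hcomp_assoc[OF \<phi> \<psi> UH(2)] by simp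
    then have 2: "U \<star> \<phi> \<star> (\<psi> \<star> U') = hid (dsum P Y)" using UU UH inv by simp
    have \<phi>i: "\<phi> \<star> hinj1 P X \<in> phom P (dsum P Y)" using phom_comp[OF \<phi> i(1)] by simp
    have "hproj1 P Y \<star> n = b' \<star> hproj2 P Y"
      unfolding n_def using hcomp_assoc[OF p(3) i(3) bp] bp by (simp add: biproduct)
    then have "hproj1 P Y \<star> U = hproj1 P Y \<boxplus> b' \<star> hproj2 P Y"
      unfolding U_def using hcomp_distrib_left[OF p(3) phom_id n] p(3) by simp
    then have "hproj1 P Y \<star> U \<star> (\<phi> \<star> hinj1 P X) = a \<boxplus> b' \<star> c"
      using hcomp_distrib_right[OF p(3) bp \<phi>i] hcomp_assoc[OF b' p(4) \<phi>i] hcomp_assoc[OF p(3) \<phi> i(1)]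
        hcomp_assoc[OF p(4) \<phi> i(1)] by (simp add: a_def c_def)
    moreover have "hproj1 P Y \<star> U \<star> (\<phi> \<star> hinj1 P X) = hproj1 P Y \<star> (U \<star> \<phi>) \<star> hinj1 P X"
      using hcomp_assoc[OF p(3) UH(1) \<phi>i] hcomp_assoc[OF UH(1) \<phi> i(1)] hcomp_assoc[OF p(3) U\<phi> i(1)] by simp
    ultimately show ?thesis
      using schur_complement_iso[OF U\<phi> \<psi>U 1 2] \<open>hinv (a \<boxplus> b' \<star> c)\<close> by simp
  qed
qed

text \<open>After correcting g to a left inverse g' of f, k = f g' is idempotent in a local ring. If
  k is invertible, it is the identity and f is an isomorphism. If 1 - k is invertible, it kills f,
  hence f = 0 and P would be zero.\<close>

lemma klocal_retract:
  assumes loc: "klocal Q" and f: "f \<in> phom P Q" and g: "g \<in> phom Q P" and gf: "hinv (g \<star> f)"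
    and nz: "0 < nrows P + ncols P" and [simp]: "pencil P" "pencil Q"
  shows "pencil_iso P Q"
proof -
  have gfP: "g \<star> f \<in> phom P P" using phom_comp[OF g f] by simp
  obtain h where h: "h \<in> phom P P" "h \<star> (g \<star> f) = hid P"
    using hinv_endo_inverse[OF gfP gf] by auto
  define g' where "g' = h \<star> g"
  have g': "g' \<in> phom Q P" unfolding g'_def using phom_comp[OF h(1) g] by simp
  have g'f: "g' \<star> f = hid P" unfolding g'_def using hcomp_assoc[OF h(1) g f] h(2) by simp
  define k where "k = f \<star> g'"
  have k: "k \<in> phom Q Q" unfolding k_def using phom_comp[OF f g'] by simp
  have kf: "k \<star> f = f" unfolding k_def using hcomp_assoc[OF f g' f] g'f f by simp
  have kk: "k \<star> k = k" using hcomp_assoc[OF k f g'] kf by (simp flip: k_def)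
  define m where "m = hid Q \<boxplus> hneg k"
  have m: "m \<in> phom Q Q" unfolding m_def by (intro phom_plus phom_neg phom_id k) simp_all
  have "k \<boxplus> m = hid Q"
    unfolding m_def using phom_carrier[OF k] by (intro prod_eqI; intro eq_matI) (auto simp: phom_ops)
  then have "hinv k \<or> hinv m" using loc k m hinv_id[of Q] unfolding klocal_def by auto
  then show ?thesis
  proof
    assume "hinv k"
    then obtain k' where k': "k' \<in> phom Q Q" "k \<star> k' = hid Q"
      using hinv_endo_inverse[OF k] by auto
    have "k = hid Q" using hcomp_assoc[OF k k k'(1)] kk k'(2) k by simp
    then show ?thesis unfolding pencil_iso_def using f g' g'f by (auto simp: k_def)
  next
    assume "hinv m"
    then obtain m' where m': "m' \<in> phom Q Q" "m' \<star> m = hid Q"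
      using hinv_endo_inverse[OF m] by auto
    have "hneg k \<star> f = hneg (k \<star> f)"
      using phom_dims[OF f] phom_dims[OF k] by (simp add: hneg_def hcomp_def)
    then have "m \<star> f = f \<boxplus> hneg f"
      unfolding m_def using hcomp_distrib_right[OF phom_id phom_neg[OF k] f] f kf by simp
    also have "\<dots> = hzero P Q" using phom_carrier[OF f] by (auto simp: phom_ops)
    finally have "f = hzero P Q" using hcomp_assoc[OF m' (1) m f] m' f hcomp_zero[OF m'(1)] by simp
    then have "hid P = hzero P P" using g'f hcomp_zero[OF g'] by simp
    \<comment> \<open>Identity equal to zero contradicts the positive size: some component has an
      entry at (0, 0).\<close>
    then have "1\<^sub>m (nrows P) = (0\<^sub>m (nrows P) (nrows P) :: real mat)" "1\<^sub>m (ncols P) = (0\<^sub>m (ncols P) (ncols P) :: real mat)"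
      by (auto simp: hid_def hzero_def)
    from arg_cong[OF this(1), of "\<lambda>M. M $$ (0, 0)"] arg_cong[OF this(2), of "\<lambda>M. M $$ (0, 0)"] nz
    show ?thesis by (cases "nrows P = 0") auto
  qed
qed

section \<open>Finite direct sums and exchange of summands\<close>

lemma pair_direct_sum_Nil: "pair_direct_sum [] = (0\<^sub>m 0 0, 0\<^sub>m 0 0)"
  by (simp add: pair_direct_sum_def)

lemma pencil_pair_direct_sum [simp]:
  assumes "\<forall>P \<in> set Ps. pencil P"
  shows "pencil (pair_direct_sum Ps)"
  using assms
proof (induction Ps)
  case (Cons P Ps)
  then show ?case by (auto simp: pair_direct_sum_def pencil_def Let_def)
qed (simp add: pair_direct_sum_def pencil_def)

lemma pair_direct_sum_Cons:
  assumes "pencil P" "\<forall>Q \<in> set Ps. pencil Q"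
  shows "pair_direct_sum (P # Ps) = dsum P (pair_direct_sum Ps)"
  using pencil_pair_direct_sum[OF assms(2)] assms(1)
  by (simp add: pair_direct_sum_def dsum_def Let_def pencil_def)

definition dmap :: "real mat \<times> real mat \<Rightarrow> real mat \<times> real mat \<Rightarrow> real mat \<times> real mat" where
  "dmap f g = (four_block_mat (fst f) (0\<^sub>m (nrows f) (ncols g)) (0\<^sub>m (nrows g) (ncols f)) (fst g),
    four_block_mat (snd f) (0\<^sub>m (dim_row (snd f)) (dim_col (snd g))) (0\<^sub>m (dim_row (snd g)) (dim_col (snd f))) (snd g))"

lemma mult_diag_four_block_mat:
  fixes A B C D :: "real mat"
  assumes "A \<in> carrier_mat a b" "B \<in> carrier_mat b c" "C \<in> carrier_mat a' b'" "D \<in> carrier_mat b' c'"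
  shows "four_block_mat A (0\<^sub>m a b') (0\<^sub>m a' b) C * four_block_mat B (0\<^sub>m b c') (0\<^sub>m b' c) D =
    four_block_mat (A * B) (0\<^sub>m a c') (0\<^sub>m a' c) (C * D)"
  using assms by (subst mult_four_block_mat[of _ a b _ b' _ a' _ _ c _ c']) auto

lemma dmap_hom:
  assumes f: "f \<in> phom X X'" and g: "g \<in> phom Y Y'" and [simp]: "pencil X" "pencil X'" "pencil Y" "pencil Y'"
  shows "dmap f g \<in> phom (dsum X Y) (dsum X' Y')"
proof -
  note c = phom_carrier[OF f] phom_carrier[OF g] pencil_carrier[of X] pencil_carrier[of Y] pencil_carrier[of X'] pencil_carrier[of Y']
  note d = phom_dims[OF f] phom_dims[OF g]
  show ?thesis unfolding dmap_def
    by (rule phomI)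
      (use c in \<open>auto simp: dsum_def d mult_diag_four_block_mat phom_eqs[OF f] phom_eqs[OF g]\<close>)
qed

lemma dmap_hcomp:
  assumes "f \<in> phom Y Z" "g \<in> phom X Y" "f' \<in> phom Y' Z'" "g' \<in> phom X' Y'"
  shows "dmap f f' \<star> dmap g g' = dmap (f \<star> g) (f' \<star> g')"
  using assms[THEN phom_carrier(1)] assms[THEN phom_carrier(2)]
  by (auto simp: dmap_def hcomp_def mult_diag_four_block_mat)

lemma dmap_id: "dmap (hid X) (hid Y) = hid (dsum X Y)"
  by (simp add: dmap_def hid_def)

lemma pencil_iso_dsum:
  assumes "pencil_iso X X'" "pencil_iso Y Y'" and [simp]: "pencil X" "pencil X'" "pencil Y" "pencil Y'"
  shows "pencil_iso (dsum X Y) (dsum X' Y')"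
proof -
  obtain f f' where f: "f \<in> phom X X'" "f' \<in> phom X' X" "f' \<star> f = hid X" "f \<star> f' = hid X'"
    using assms(1) unfolding pencil_iso_def by auto
  obtain g g' where g: "g \<in> phom Y Y'" "g' \<in> phom Y' Y" "g' \<star> g = hid Y" "g \<star> g' = hid Y'"
    using assms(2) unfolding pencil_iso_def by auto
  show ?thesis unfolding pencil_iso_def
    using dmap_hom[OF f(1) g(1)] dmap_hom[OF f(2) g(2)] dmap_hcomp[OF f(2,1) g(2,1)] dmap_hcomp[OF f(1,2) g(1,2)]
      f(3,4) g(3,4) by (auto simp: dmap_id)
qed

lemma dsum_assoc:
  assumes "pencil X" "pencil Y" "pencil Z"
  shows "dsum (dsum X Y) Z = dsum X (dsum Y Z)"
  using assoc_four_block_mat[of "fst X" "fst Y" "fst Z"] assoc_four_block_mat[of "snd X" "snd Y" "snd Z"] assms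
  by (simp add: dsum_def)

lemma pencil_iso_dsum_commute:
  assumes [simp]: "pencil X" "pencil Y"
  shows "pencil_iso (dsum X Y) (dsum Y X)"
proof -
  \<comment> \<open>The permutation matrix exchanging two blocks; one copy acts on rows and one on
    columns, and \<open>nat\<close> shows that they intertwine the two direct sums.\<close>
  define swap :: "nat \<Rightarrow> nat \<Rightarrow> real mat" where
    "swap = (\<lambda>a b. four_block_mat (0\<^sub>m b a) (1\<^sub>m b) (1\<^sub>m a) (0\<^sub>m a b))"
  have car: "swap a b \<in> carrier_mat (b + a) (a + b)" for a b by (simp add: swap_def)
  have inv: "swap b a * swap a b = 1\<^sub>m (a + b)" for a b
    unfolding swap_def by (subst mult_four_block_mat[of _ a b _ a _ b _ _ a _ b]) auto
  have nat: "swap a b * four_block_mat A (0\<^sub>m a d) (0\<^sub>m b c) D = four_block_mat D (0\<^sub>m b c) (0\<^sub>m a d) A * swap c d"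
    if "A \<in> carrier_mat a c" "D \<in> carrier_mat b d" for a b c d A D
    unfolding swap_def using that
    by (subst mult_four_block_mat[of _ b a _ b _ a _ _ c _ d], simp_all,
        subst mult_four_block_mat[of _ b d _ c _ a _ _ c _ d], simp_all)
  have hom: "(swap (nrows X) (nrows Y), swap (ncols X) (ncols Y)) \<in> phom (dsum X Y) (dsum Y X)"
    if "pencil X" "pencil Y" for X Y
    using pencil_carrier[OF that(1)] pencil_carrier[OF that(2)] car
    by (intro phomI) (auto simp: dsum_def nat)
  show ?thesis unfolding pencil_iso_def
    using hom[of X Y] hom[of Y X] inv by (intro bexI[OF _ hom[of X Y]] bexI[OF _ hom[of Y X]]) (auto simp: hcomp_def hid_def add.commute)
qed

lemma pencil_iso_move_front:
  assumes "\<forall>Q \<in> set (Q1 @ P # Q2). pencil Q"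
  shows "pencil_iso (pair_direct_sum (Q1 @ P # Q2)) (dsum P (pair_direct_sum (Q1 @ Q2)))"
  using assms
proof (induction Q1)
  case Nil
  then show ?case by (simp add: pair_direct_sum_Cons pencil_iso_refl)
next
  case (Cons Q Q1)
  let ?L = "pair_direct_sum (Q1 @ Q2)"
  have [simp]: "pencil Q" "pencil P" "pencil ?L" "pencil (pair_direct_sum (Q1 @ P # Q2))"
    using Cons.prems by auto
  have "pencil_iso (dsum Q (pair_direct_sum (Q1 @ P # Q2))) (dsum Q (dsum P ?L))"
    using Cons by (intro pencil_iso_dsum pencil_iso_refl) auto
  moreover have "pencil_iso (dsum Q (dsum P ?L)) (dsum P (dsum Q ?L))"
    using pencil_iso_dsum[OF pencil_iso_dsum_commute[of Q P] pencil_iso_refl[of ?L]] by (simp add: dsum_assoc)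
  ultimately have "pencil_iso (dsum Q (pair_direct_sum (Q1 @ P # Q2))) (dsum P (dsum Q ?L))"
    by (rule pencil_iso_trans) simp_all
  then show ?case using Cons.prems by (simp add: pair_direct_sum_Cons)
qed

text \<open>The composite through the direct sum is the sum of the composites through its members,
  so locality of P makes one of them invertible and \<open>klocal_retract\<close> applies.
  Invertibility of \<open>g \<star> f\<close>, rather than being the identity, is what the tail
  inherits in the induction.\<close>

lemma klocal_summand:
  assumes "klocal P" "f \<in> phom P (pair_direct_sum Qs)" "g \<in> phom (pair_direct_sum Qs) P" "hinv (g \<star> f)"
    and "\<forall>Q \<in> set Qs. pencil Q \<and> klocal Q" and nz: "0 < nrows P + ncols P" and [simp]: "pencil P"
  shows "\<exists>Q \<in> set Qs. pencil_iso P Q"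
  using assms(2-5)
proof (induction Qs arbitrary: f g)
  case Nil
  then have c: "fst g \<in> carrier_mat (nrows P) 0" "fst f \<in> carrier_mat 0 (nrows P)"
    "snd g \<in> carrier_mat (ncols P) 0" "snd f \<in> carrier_mat 0 (ncols P)"
    using phom_carrier[OF Nil(1)] phom_carrier[OF Nil(2)] by (auto simp: pair_direct_sum_def)
  have "fst g * fst f = 0\<^sub>m (nrows P) (nrows P)" "snd g * snd f = 0\<^sub>m (ncols P) (ncols P)"
    using c by (auto intro!: eq_matI simp: scalar_prod_def)
  then have False using Nil(3) nz by (auto simp: hinv_def hcomp_def)
  then show ?case ..
next
  case (Cons Q Qs)
  let ?S = "pair_direct_sum Qs"
  have [simp]: "pencil Q" "pencil ?S" using Cons.prems by auto
  have S: "pair_direct_sum (Q # Qs) = dsum Q ?S" using Cons.prems by (simp add: pair_direct_sum_Cons)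
  have f: "f \<in> phom P (dsum Q ?S)" and g: "g \<in> phom (dsum Q ?S) P" using Cons.prems by (simp_all add: S)
  have h: "hproj1 Q ?S \<star> f \<in> phom P Q" "hproj2 Q ?S \<star> f \<in> phom P ?S"
    "g \<star> hinj1 Q ?S \<in> phom Q P" "g \<star> hinj2 Q ?S \<in> phom ?S P"
    using phom_comp[OF _ f] phom_comp[OF g] by auto
  have "hinv ((g \<star> hinj1 Q ?S) \<star> (hproj1 Q ?S \<star> f)) \<or> hinv ((g \<star> hinj2 Q ?S) \<star> (hproj2 Q ?S \<star> f))"
    using hcomp_through_dsum[OF g f] Cons.prems(3) assms(1) phom_comp[OF h(3) h(1)] phom_comp[OF h(4) h(2)]
    unfolding klocal_def by auto
  then show ?case
  proof
    assume "hinv ((g \<star> hinj1 Q ?S) \<star> (hproj1 Q ?S \<star> f))"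
    from klocal_retract[OF _ h(1) h(3) this nz] Cons.prems(4) show ?thesis by auto
  next
    assume "hinv ((g \<star> hinj2 Q ?S) \<star> (hproj2 Q ?S \<star> f))"
    from Cons.IH[OF h(2) h(4) this] Cons.prems(4) show ?thesis by auto
  qed
qed

text \<open>The identity of the first summand P factors through the sum of \<open>Qs\<close>, so
  some member is isomorphic to P and by the last hypothesis equal to it. Moved to the front, it is
  cancelled against P. Positive sizes rule out leftover zero pencils at the end.\<close>

theorem krull_schmidt:
  assumes "pencil_iso (pair_direct_sum Ps) (pair_direct_sum Qs)"
    and "\<forall>P \<in> set Ps \<union> set Qs. pencil P \<and> klocal P \<and> 0 < nrows P + ncols P"
    and "\<forall>P \<in> set Ps. \<forall>Q \<in> set Qs. pencil_iso P Q \<longrightarrow> P = Q"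
  shows "mset Ps = mset Qs"
  using assms
proof (induction Ps arbitrary: Qs)
  case Nil
  show ?case
  proof (cases Qs)
    case (Cons Q Qs')
    then have "pencil Q" "\<forall>Q \<in> set Qs'. pencil Q" "0 < nrows Q + ncols Q" using Nil by auto
    then show ?thesis using pencil_iso_dims[OF Nil(1)] Cons
      by (simp add: pair_direct_sum_Cons pair_direct_sum_Nil)
  qed simp
next
  case (Cons P Ps)
  let ?S = "pair_direct_sum Ps"
  have [simp]: "pencil P" "pencil ?S" "pencil (pair_direct_sum Qs)" using Cons.prems by auto
  have eq: "pair_direct_sum (P # Ps) = dsum P ?S" using Cons.prems by (simp add: pair_direct_sum_Cons)
  obtain f g where fg: "f \<in> phom (dsum P ?S) (pair_direct_sum Qs)" "g \<in> phom (pair_direct_sum Qs) (dsum P ?S)"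
    "g \<star> f = hid (dsum P ?S)"
    using Cons.prems(1) unfolding eq pencil_iso_def by auto
  have i: "hinj1 P ?S \<in> phom P (dsum P ?S)" and p: "hproj1 P ?S \<in> phom (dsum P ?S) P" by simp_all
  have fi: "f \<star> hinj1 P ?S \<in> phom P (pair_direct_sum Qs)" and pg: "hproj1 P ?S \<star> g \<in> phom (pair_direct_sum Qs) P"
    using phom_comp[OF fg(1) i] phom_comp[OF p fg(2)] by simp_all
  have "(hproj1 P ?S \<star> g) \<star> (f \<star> hinj1 P ?S) = hid P"
    using hcomp_assoc[OF p fg(2) fi] hcomp_assoc[OF fg(2,1) i] fg(3) i by (simp add: biproduct)
  then have "hinv ((hproj1 P ?S \<star> g) \<star> (f \<star> hinj1 P ?S))" by (simp add: hinv_id)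
  from klocal_summand[OF _ fi pg this] Cons.prems(2) obtain Q where "Q \<in> set Qs" "pencil_iso P Q" by auto
  with Cons.prems(3) have "P \<in> set Qs" by auto
  then obtain Q1 Q2 where Qs: "Qs = Q1 @ P # Q2" by (meson split_list)
  have [simp]: "pencil (pair_direct_sum (Q1 @ Q2))" using Cons.prems Qs by auto
  have "pencil_iso (dsum P ?S) (dsum P (pair_direct_sum (Q1 @ Q2)))"
    using pencil_iso_trans[OF Cons.prems(1)[unfolded eq] pencil_iso_move_front[of Q1 P Q2, folded Qs]] Cons.prems
    by simp
  then have "pencil_iso ?S (pair_direct_sum (Q1 @ Q2))"
    using klocal_cancel[of P ?S "pair_direct_sum (Q1 @ Q2)"] Cons.prems(2) by simp
  then have "mset Ps = mset (Q1 @ Q2)"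
    using Cons.prems(2,3) unfolding Qs by (intro Cons.IH) auto
  then show ?case unfolding Qs by simp
qed

section \<open>Kronecker blocks have local endomorphism rings\<close>

text \<open>The kernel of an endomorphism, viewed as a set of finitely supported sequences, is invariant under
  \<open>M - a\<close>. If every nonzero invariant subspace contains a fixed \<open>e \<noteq> 0\<close>, all singular
  endomorphisms kill \<open>e\<close>, so a sum of two of them is again singular.\<close>

lemma klocal_oneI:
  assumes M: "M \<in> carrier_mat n n"
    and T: "\<And>f. \<forall>i\<ge>n. f i = 0 \<Longrightarrow> M *\<^sub>v vec n f = vec n (\<lambda>i. a * f i + T f i) \<and> (\<forall>i\<ge>n. T f i = 0)"
    and e: "\<exists>i<n. e i \<noteq> 0"
    and inv: "\<And>K f. (\<And>f g c d. f \<in> K \<Longrightarrow> g \<in> K \<Longrightarrow> (\<lambda>i. c * f i + d * g i) \<in> K) \<Longrightarrow>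
      (\<And>f. f \<in> K \<Longrightarrow> T f \<in> K) \<Longrightarrow> (\<And>f. f \<in> K \<Longrightarrow> \<forall>i\<ge>n. f i = 0) \<Longrightarrow>
      f \<in> K \<Longrightarrow> \<exists>i<n. f i \<noteq> 0 \<Longrightarrow> e \<in> K"
  shows "klocal (1\<^sub>m n, M)"
proof -
  have kernel: "R *\<^sub>v vec n e = 0\<^sub>v n"
    if R: "R \<in> carrier_mat n n" and comm: "R * M = M * R" and det: "det R = 0" for R :: "real mat"
  proof -
    obtain v where v: "v \<in> carrier_vec n" "v \<noteq> 0\<^sub>v n" "R *\<^sub>v v = 0\<^sub>v n"
      using det_0_iff_vec_prod_zero_field[OF R] det by auto
    define K where "K = {f. (\<forall>i\<ge>n. f i = 0) \<and> R *\<^sub>v vec n f = 0\<^sub>v n}"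
    define f where "f = (\<lambda>i. if i < n then v $ i else 0)"
    have fv: "vec n f = v" using v(1) by (auto simp: f_def)
    have lin: "vec n (\<lambda>i. c * f i + d * g i) = c \<cdot>\<^sub>v vec n f + d \<cdot>\<^sub>v vec n g" for f g and c d :: real by auto
    have lin_closed: "(\<lambda>i. c * f i + d * g i) \<in> K" if "f \<in> K" "g \<in> K" for f g c d
      using that R unfolding K_def
      by (auto simp: lin mult_add_distrib_mat_vec[OF R] mult_mat_vec[OF R])
    have T_closed: "T f \<in> K" if f: "f \<in> K" for f
    proof -
      have f0: "\<forall>i\<ge>n. f i = 0" and Rf: "R *\<^sub>v vec n f = 0\<^sub>v n" using f by (auto simp: K_def)
      have eq: "vec n (T f) = M *\<^sub>v vec n f + (- a) \<cdot>\<^sub>v vec n f"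
        using T[OF f0] by auto
      have "R *\<^sub>v (M *\<^sub>v vec n f) = M *\<^sub>v (R *\<^sub>v vec n f)"
        using R M comm assoc_mult_mat_vec[of R n n M n "vec n f"] assoc_mult_mat_vec[of M n n R n "vec n f"] by simp
      then have "R *\<^sub>v (M *\<^sub>v vec n f) = 0\<^sub>v n" using Rf M by (auto intro!: eq_vecI)
      then have "R *\<^sub>v vec n (T f) = 0\<^sub>v n"
        unfolding eq using M Rf by (simp add: mult_add_distrib_mat_vec[OF R] mult_mat_vec[OF R]) (auto intro!: eq_vecI)
      then show ?thesis using T[OF f0] by (simp add: K_def)
    qed
    have "f \<in> K" using v fv by (auto simp: K_def f_def)
    moreover have "\<exists>i<n. f i \<noteq> 0" 
    proof (rule ccontr)
      assume "\<not> (\<exists>i<n. f i \<noteq> 0)"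
      then have "vec n f = 0\<^sub>v n" by auto
      then show False using v(2) fv by simp
    qed
    ultimately have "e \<in> K" by (intro inv[of K f] lin_closed T_closed) (auto simp: K_def)
    then show ?thesis by (simp add: K_def)
  qed
  show ?thesis unfolding klocal_def
  proof (intro ballI impI, rule ccontr)
    fix f g assume f: "f \<in> phom (1\<^sub>m n, M) (1\<^sub>m n, M)" and g: "g \<in> phom (1\<^sub>m n, M) (1\<^sub>m n, M)"
      and fg: "hinv (f \<boxplus> g)" and not: "\<not> (hinv f \<or> hinv g)"
    have *: "fst h *\<^sub>v vec n e = 0\<^sub>v n" if h: "h \<in> phom (1\<^sub>m n, M) (1\<^sub>m n, M)" "\<not> hinv h" for h
    proof -
      have c: "fst h \<in> carrier_mat n n" "snd h \<in> carrier_mat n n" using phom_carrier[OF h(1)] by auto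
      \<comment> \<open>The first matrix of the pencil is the identity, so an endomorphism is one
        matrix commuting with M.\<close>
      then have "fst h = snd h" "fst h * M = M * fst h" using phom_eqs[OF h(1)] by auto
      then show ?thesis using kernel[OF c(1)] h(2) by (auto simp: hinv_def)
    qed
    have c: "fst f \<in> carrier_mat n n" "fst g \<in> carrier_mat n n" using phom_carrier[OF f] phom_carrier[OF g] by auto
    have "(fst f + fst g) *\<^sub>v vec n e = 0\<^sub>v n"
      using *[OF f] *[OF g] not c by (simp add: add_mult_distrib_mat_vec[of _ n n])
    moreover have "vec n e \<noteq> 0\<^sub>v n" using e by (metis index_vec index_zero_vec(1))
    moreover have "fst f + fst g \<in> carrier_mat n n" using c by simp
    ultimately have "det (fst f + fst g) = 0"
      using det_0_iff_vec_prod_zero_field[of "fst f + fst g" n] vec_carrier[of n e] by blast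
    then show False using fg by (simp add: hinv_def hplus_def)
  qed
qed

lemma jordan_block_mult_vec:
  fixes \<mu> :: real
  assumes "\<forall>i\<ge>n. f i = 0"
  shows "jordan_block n \<mu> *\<^sub>v vec n f = vec n (\<lambda>i. \<mu> * f i + f (Suc i))"
proof (rule eq_vecI)
  fix i assume "i < dim_vec (vec n (\<lambda>i. \<mu> * f i + f (Suc i)))"
  then have i: "i < n" by simp
  have "(jordan_block n \<mu> *\<^sub>v vec n f) $ i = (\<Sum>j<n. (if j = i then \<mu> * f j else 0) + (if j = Suc i then f j else 0))"
    using i by (auto simp: scalar_prod_def atLeast0LessThan jordan_block_def intro!: sum.cong)
  also have "\<dots> = \<mu> * f i + f (Suc i)"
    using i assms by (simp add: sum.distrib)
  finally show "(jordan_block n \<mu> *\<^sub>v vec n f) $ i = vec n (\<lambda>i. \<mu> * f i + f (Suc i)) $ i" using i by simp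
qed simp

text \<open>\<open>M - \<mu>\<close> is the left shift. Shifting a nonzero sequence until only its
  last nonzero entry is left, at index 0, yields a multiple of the first unit vector.\<close>

lemma klocal_jordan:
  assumes "k \<ge> 1"
  shows "klocal (1\<^sub>m k, jordan_block k \<mu>)"
proof (rule klocal_oneI[where T = "\<lambda>f i. f (Suc i)" and a = \<mu> and e = "\<lambda>i. if i = 0 then 1 else 0"])
  fix f :: "nat \<Rightarrow> real" assume "\<forall>i\<ge>k. f i = 0"
  then show "jordan_block k \<mu> *\<^sub>v vec k f = vec k (\<lambda>i. \<mu> * f i + f (Suc i)) \<and> (\<forall>i\<ge>k. f (Suc i) = 0)"
    using jordan_block_mult_vec by auto
next
  fix K :: "(nat \<Rightarrow> real) set" and f
  assume lin: "\<And>f g c d. f \<in> K \<Longrightarrow> g \<in> K \<Longrightarrow> (\<lambda>i. c * f i + d * g i) \<in> K"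
    and T: "\<And>f. f \<in> K \<Longrightarrow> (\<lambda>i. f (Suc i)) \<in> K" and supp: "\<And>f. f \<in> K \<Longrightarrow> \<forall>i\<ge>k. f i = 0"
  have *: "(\<lambda>i. if i = 0 then 1 else 0) \<in> K" if "f \<in> K" "f p \<noteq> 0" "\<forall>i>p. f i = 0" for f p
    using that
  proof (induction p arbitrary: f)
    case 0
    have "(\<lambda>i. inverse (f 0) * f i + 0 * f i) = (\<lambda>i. if i = 0 then 1 else 0)" using 0 by auto
    then show ?case using lin[OF 0(1) 0(1), of "inverse (f 0)" 0] by simp
  next
    case (Suc p)
    show ?case using Suc.prems by (intro Suc.IH[OF T[OF Suc.prems(1)]]) auto
  qed
  assume f: "f \<in> K" "\<exists>i<k. f i \<noteq> 0"
  define p where "p = (GREATEST i. f i \<noteq> 0)"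
  have bnd: "\<forall>i. f i \<noteq> 0 \<longrightarrow> i \<le> k" using supp[OF f(1)] by (metis nat_le_linear)
  obtain i where "f i \<noteq> 0" using f by auto
  then have "f p \<noteq> 0" unfolding p_def using GreatestI_nat[of "\<lambda>i. f i \<noteq> 0" i k] bnd by simp
  moreover have "\<forall>i>p. f i = 0"
    unfolding p_def using Greatest_le_nat[of "\<lambda>i. f i \<noteq> 0" _ k] bnd by (metis not_less)
  ultimately show "(\<lambda>i. if i = 0 then 1 else 0) \<in> K" using *[OF f(1)] by simp
qed (use assms in \<open>auto intro!: exI[of _ 0]\<close>)

lemma C_mat_index:
  "C_mat a b \<in> carrier_mat 2 2" "C_mat a b $$ (0, 0) = a" "C_mat a b $$ (0, Suc 0) = b"
  "C_mat a b $$ (Suc 0, 0) = - b" "C_mat a b $$ (Suc 0, Suc 0) = a"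
  by (auto simp: C_mat_def mat_of_rows_list_def)

lemma C_block_mat_carrier [simp]: "C_block_mat k a b \<in> carrier_mat (2 * k) (2 * k)"
  by (simp add: C_block_mat_def)

lemma C_block_mat_dim [simp]: "dim_row (C_block_mat k a b) = 2 * k" "dim_col (C_block_mat k a b) = 2 * k"
  by (simp_all add: C_block_mat_def)

lemma C_block_mat_index:
  assumes "i < 2 * k" "j < 2 * k"
  shows "C_block_mat k a b $$ (i, j) = (if j = i then a else 0) +
    (if j = (if even i then Suc i else i - 1) then (if even i then b else - b) else 0) +
    (if j = Suc (Suc i) then 1 else 0)"
proof -
  consider (ee) p q where "i = 2 * p" "j = 2 * q" | (eo) p q where "i = 2 * p" "j = Suc (2 * q)"
    | (oe) p q where "i = Suc (2 * p)" "j = 2 * q" | (oo) p q where "i = Suc (2 * p)" "j = Suc (2 * q)"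
    by (metis evenE oddE Suc_eq_plus1)
  then show ?thesis
    using assms by cases (auto simp: C_block_mat_def C_mat_index)
qed

lemma C_block_mat_mult_vec:
  assumes "\<forall>i\<ge>2 * k. f i = 0"
  shows "C_block_mat k a b *\<^sub>v vec (2 * k) f =
    vec (2 * k) (\<lambda>i. a * f i + ((if even i then b * f (Suc i) else - b * f (i - 1)) + f (Suc (Suc i))))" (is "_ = vec _ ?g")
proof (rule eq_vecI)
  fix i assume "i < dim_vec (vec (2 * k) ?g)"
  then have i: "i < 2 * k" by simp
  define i' where "i' = (if even i then Suc i else i - 1)"
  have i': "i' < 2 * k" using i unfolding i'_def by (auto elim!: evenE)
  have "(C_block_mat k a b *\<^sub>v vec (2 * k) f) $ i = (\<Sum>j<2 * k. C_block_mat k a b $$ (i, j) * f j)"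
    using i by (simp add: scalar_prod_def atLeast0LessThan)
  also have "\<dots> = (\<Sum>j<2 * k. (if j = i then a * f j else 0) + (if j = i' then (if even i then b else - b) * f j else 0) +
      (if j = Suc (Suc i) then f j else 0))"
    using i by (intro sum.cong) (auto simp: C_block_mat_index i'_def algebra_simps)
  also have "\<dots> = ?g i"
    using i i' assms by (simp add: sum.distrib) (simp add: i'_def)
  finally show "(C_block_mat k a b *\<^sub>v vec (2 * k) f) $ i = vec (2 * k) ?g $ i" using i by simp
qed simp

text \<open>Writing \<open>M = C_block_mat k a b\<close>, the operator \<open>(M - a)\<^sup>2 + b\<^sup>2\<close> lowers the index of the
  last nonzero \<open>2\<close>-block by exactly one.\<close>

lemma klocal_C:
  assumes k: "k \<ge> 1" and b: "b > 0"
  shows "klocal (1\<^sub>m (2 * k), C_block_mat k a b)"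
proof -
  define T :: "(nat \<Rightarrow> real) \<Rightarrow> nat \<Rightarrow> real" where
    "T = (\<lambda>f i. (if even i then b * f (Suc i) else - b * f (i - 1)) + f (Suc (Suc i)))"
  define e :: "nat \<Rightarrow> real" where "e = (\<lambda>i. if i = 0 then 1 else 0)"
  show ?thesis
  proof (rule klocal_oneI[where T = T and a = a and e = e])
    fix f :: "nat \<Rightarrow> real" assume f: "\<forall>i\<ge>2 * k. f i = 0"
    have "T f i = 0" if "i \<ge> 2 * k" for i
    proof -
      have "odd i \<Longrightarrow> i - 1 \<ge> 2 * k" using that by (auto elim!: oddE)
      then show ?thesis using f that by (auto simp: T_def)
    qed
    then show "C_block_mat k a b *\<^sub>v vec (2 * k) f = vec (2 * k) (\<lambda>i. a * f i + T f i) \<and> (\<forall>i\<ge>2 * k. T f i = 0)"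
      using C_block_mat_mult_vec[OF f] by (simp add: T_def)
  next
    fix K :: "(nat \<Rightarrow> real) set" and f
    assume lin: "\<And>f g c d. f \<in> K \<Longrightarrow> g \<in> K \<Longrightarrow> (\<lambda>i. c * f i + d * g i) \<in> K"
      and T: "\<And>f. f \<in> K \<Longrightarrow> T f \<in> K" and supp: "\<And>f. f \<in> K \<Longrightarrow> \<forall>i\<ge>2 * k. f i = 0"
    have *: "e \<in> K" if "f \<in> K" "f (2 * p) \<noteq> 0 \<or> f (Suc (2 * p)) \<noteq> 0" "\<forall>i>Suc (2 * p). f i = 0" for f p
      using that
    proof (induction p arbitrary: f)
      case 0
      define x where "x = f 0"
      define y where "y = f 1"
      define d where "d = x\<^sup>2 + y\<^sup>2"
      have d: "d > 0" using 0(2) unfolding d_def x_def y_def by (auto simp: add_pos_nonneg add_nonneg_pos)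
      \<comment> \<open>On the first 2-block T maps (x, y) to (b y, -b x). These two vectors are
        orthogonal, and the coefficients are those expanding the unit vector (1, 0) in them.\<close>
      have "(\<lambda>i. (x / d) * f i + (y / (b * d)) * T f i) = e"
      proof
        fix i :: nat
        consider "i = 0" | "i = 1" | "i > 1" by linarith
        then show "(x / d) * f i + (y / (b * d)) * T f i = e i"
        proof cases
          case 1
          have "f (Suc (Suc 0)) = 0" using 0(3) by simp
          then have "(x / d) * f i + (y / (b * d)) * T f i = (x * x + y * y) / d"
            using 1 b d by (simp add: T_def x_def y_def add_divide_distrib)
          also have "x * x + y * y = d" by (simp add: d_def power2_eq_square)
          finally show ?thesis using 1 d by (simp add: e_def)
        next
          case 2
          have "f (Suc (Suc 1)) = 0" using 0(3) by simp
          then show ?thesis using 2 b d by (simp add: T_def x_def y_def e_def)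
        next
          case 3
          have "odd i \<Longrightarrow> i - 1 > 1" using 3 by (auto elim!: oddE)
          then show ?thesis using 0(3) 3 by (auto simp: T_def e_def)
        qed
      qed
      then show ?case using lin[OF 0(1) T[OF 0(1)]] by metis
    next
      case (Suc p)
      define g where "g = (\<lambda>i. 1 * T (T f) i + b\<^sup>2 * f i)"
      have gK: "g \<in> K" unfolding g_def by (intro lin T Suc.prems)
      \<comment> \<open>The rotation part of T squares to -b^2 and cancels. Block p of g is
        therefore 2b times the rotated block p + 1, plus block p + 2, so it is nonzero when block p
        + 1 is the last nonzero one.\<close>
      have g: "g i = (if even i then 2 * b * f (Suc (Suc (Suc i))) else - 2 * b * f (Suc i)) + f (Suc (Suc (Suc (Suc i))))" for i
        by (cases i) (auto simp: g_def T_def power2_eq_square algebra_simps)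
      show ?case
      proof (rule Suc.IH[OF gK])
        show "g (2 * p) \<noteq> 0 \<or> g (Suc (2 * p)) \<noteq> 0"
          using Suc.prems(2,3) b by (auto simp: g)
        have "Suc i > Suc (2 * Suc p)" if "odd i" "i > Suc (2 * p)" for i
          using that by presburger
        then show "\<forall>i>Suc (2 * p). g i = 0"
          using Suc.prems(3) by (auto simp: g)
      qed
    qed
    assume f: "f \<in> K" "\<exists>i<2 * k. f i \<noteq> 0"
    let ?P = "\<lambda>p. f (2 * p) \<noteq> 0 \<or> f (Suc (2 * p)) \<noteq> 0"
    define p where "p = (GREATEST p. ?P p)"
    have bnd: "\<forall>p. ?P p \<longrightarrow> p \<le> k" using supp[OF f(1)] by (metis le_SucI mult_le_mono2 nat_le_linear)
    obtain i where i: "f i \<noteq> 0" using f by auto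
    have P: "f i \<noteq> 0 \<Longrightarrow> ?P (i div 2)" for i
      by (cases "even i") (auto elim!: evenE oddE)
    have "?P p" unfolding p_def using GreatestI_nat[of ?P "i div 2" k] bnd P[OF i] by blast
    moreover have "\<forall>i>Suc (2 * p). f i = 0"
    proof (intro allI impI, rule ccontr)
      fix i assume "i > Suc (2 * p)" "f i \<noteq> 0"
      then show False using Greatest_le_nat[of ?P "i div 2" k] bnd P[of i] unfolding p_def[symmetric] by auto
    qed
    ultimately show "e \<in> K" using *[OF f(1)] by blast
  qed (use k in \<open>auto simp: e_def intro!: exI[of _ 0]\<close>)
qed

section \<open>Rectangular blocks and the dual families\<close>

lemma klocal_scalarI:
  assumes scalar: "\<And>f. f \<in> phom X X \<Longrightarrow> \<exists>s. f = (s \<cdot>\<^sub>m 1\<^sub>m (nrows X), s \<cdot>\<^sub>m 1\<^sub>m (ncols X))"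
    and nz: "0 < nrows X + ncols X"
  shows "klocal X"
  unfolding klocal_def
proof (intro ballI impI)
  fix f g assume f: "f \<in> phom X X" and g: "g \<in> phom X X" and fg: "hinv (f \<boxplus> g)"
  obtain s t where st: "f = (s \<cdot>\<^sub>m 1\<^sub>m (nrows X), s \<cdot>\<^sub>m 1\<^sub>m (ncols X))" "g = (t \<cdot>\<^sub>m 1\<^sub>m (nrows X), t \<cdot>\<^sub>m 1\<^sub>m (ncols X))"
    using scalar[OF f] scalar[OF g] by blast
  have "s \<cdot>\<^sub>m 1\<^sub>m n + t \<cdot>\<^sub>m 1\<^sub>m n = (s + t) \<cdot>\<^sub>m 1\<^sub>m n" for n by (auto simp: algebra_simps)
  then have "(s + t) ^ nrows X \<noteq> 0" "(s + t) ^ ncols X \<noteq> 0"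
    using fg by (simp_all add: st hinv_def hplus_def)
  then have "s \<noteq> 0 \<or> t \<noteq> 0" using nz by (cases "nrows X = 0") auto
  then show "hinv f \<or> hinv g" by (auto simp: st hinv_def)
qed

lemma F_mat_select: "F_mat k = select_mat k (Suc k) (\<lambda>i. i)"
  by (auto simp: F_mat_def select_mat_def)

lemma G_mat_select: "G_mat k = select_mat k (Suc k) Suc"
  by (auto simp: G_mat_def select_mat_def)

lemma FG_dim [simp]:
  "dim_row (F_mat k) = k" "dim_col (F_mat k) = Suc k" "dim_row (G_mat k) = k" "dim_col (G_mat k) = Suc k"
  by (simp_all add: F_mat_def G_mat_def)

text \<open>All endomorphisms are scalars. Comparing the two relations entrywise shows that S is
  constant along diagonals. Diagonals below the main one start in the first column, where the
  \<open>G_mat\<close> relation gives 0; those above end in the last column, where the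
  \<open>F_mat\<close> relation gives 0.\<close>

lemma klocal_F: "klocal (F_mat k, G_mat k)"
proof (rule klocal_scalarI)
  fix f assume f: "f \<in> phom (F_mat k, G_mat k) (F_mat k, G_mat k)"
  define R where "R = fst f"
  define S where "S = snd f"
  have R: "R \<in> carrier_mat k k" and S: "S \<in> carrier_mat (Suc k) (Suc k)"
    using phom_carrier[OF f] by (simp_all add: R_def S_def)
  have FF: "R * F_mat k = F_mat k * S" and GG: "R * G_mat k = G_mat k * S"
    using phom_eqs[OF f] by (simp_all add: R_def S_def)
  have F: "S $$ (i, j) = (if j < k then R $$ (i, j) else 0)" if "i < k" "j \<le> k" for i j
  proof -
    have "(R * F_mat k) $$ (i, j) = (if j < k then R $$ (i, j) else 0)"
      using mult_select_mat_shift[OF R, of "Suc k" 0] that unfolding F_mat_select by simp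
    moreover have "(F_mat k * S) $$ (i, j) = S $$ (i, j)"
      using select_mat_mult[OF S, of k "\<lambda>i. i"] that unfolding F_mat_select by simp
    ultimately show ?thesis using FF by simp
  qed
  have G: "S $$ (Suc i, j) = (if j = 0 then 0 else R $$ (i, j - 1))" if "i < k" "j \<le> k" for i j
  proof -
    have "(R * G_mat k) $$ (i, j) = (if j = 0 then 0 else R $$ (i, j - 1))"
      using mult_select_mat_shift[OF R, of "Suc k" 1] that unfolding G_mat_select by simp
    moreover have "(G_mat k * S) $$ (i, j) = S $$ (Suc i, j)"
      using select_mat_mult[OF S, of k Suc] that unfolding G_mat_select by simp
    ultimately show ?thesis using GG by simp
  qed
  have step: "S $$ (Suc i, Suc j) = S $$ (i, j)" if "i < k" "j < k" for i j
    using F[of i j] G[of i "Suc j"] that by simp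
  have lower: "S $$ (i, j) = 0" if "j < i" "i \<le> k" for i j
    using that
  proof (induction j arbitrary: i)
    case 0
    then show ?case using G[of "i - 1" 0] by simp
  next
    case (Suc j)
    then show ?case using step[of "i - 1" j] Suc.IH[of "i - 1"] by simp
  qed
  have upper: "S $$ (i, j) = 0" if "i < j" "j \<le> k" for i j
    using that
  proof (induction "k - j" arbitrary: i j)
    case 0
    then show ?case using F[of i k] by simp
  next
    case (Suc d)
    then have "S $$ (Suc i, Suc j) = 0" by (intro Suc.hyps(1)) auto
    then show ?case using step[of i j] Suc by simp
  qed
  have diag: "S $$ (i, i) = S $$ (0, 0)" if "i \<le> k" for i
    using that by (induction i) (simp_all add: step)
  define s where "s = S $$ (0, 0)"
  have Sij: "S $$ (i, j) = (if i = j then s else 0)" if "i \<le> k" "j \<le> k" for i j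
    using lower[of j i] upper[of i j] diag[of i] that by (cases i j rule: linorder_cases) (auto simp: s_def)
  have "S = s \<cdot>\<^sub>m 1\<^sub>m (Suc k)"
    using S Sij by (intro eq_matI) auto
  moreover have "R = s \<cdot>\<^sub>m 1\<^sub>m k"
  proof (rule eq_matI)
    fix i j assume "i < dim_row (s \<cdot>\<^sub>m 1\<^sub>m k)" "j < dim_col (s \<cdot>\<^sub>m 1\<^sub>m k)"
    then show "R $$ (i, j) = (s \<cdot>\<^sub>m 1\<^sub>m k) $$ (i, j)" using F[of i j] Sij[of i j] by auto
  qed (use R in auto)
  ultimately show "\<exists>s. f = (s \<cdot>\<^sub>m 1\<^sub>m (nrows (F_mat k, G_mat k)), s \<cdot>\<^sub>m 1\<^sub>m (ncols (F_mat k, G_mat k)))"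
    by (intro exI[of _ s] prod_eqI) (simp_all add: R_def S_def)
qed simp

text \<open>Transposing and exchanging the components sends endomorphisms of the transposed pencil
  to endomorphisms of X. Composition is reversed, but locality only involves sums and
  invertibility.\<close>

lemma klocal_transpose:
  assumes loc: "klocal X" and X: "pencil X"
  shows "klocal (transpose_mat (fst X), transpose_mat (snd X))"
  unfolding klocal_def
proof (intro ballI impI)
  let ?X = "(transpose_mat (fst X), transpose_mat (snd X))"
  let ?t = "\<lambda>f. (transpose_mat (snd f), transpose_mat (fst f)) :: real mat \<times> real mat"
  note c = pencil_carrier[OF X]
  have t: "?t f \<in> phom X X" "hinv (?t f) \<longleftrightarrow> hinv f" if f: "f \<in> phom ?X ?X" for f
  proof -
    have cf: "fst f \<in> carrier_mat (ncols X) (ncols X)" "snd f \<in> carrier_mat (nrows X) (nrows X)"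
      using phom_carrier[OF f] by auto
    have "transpose_mat (snd f) * M = M * transpose_mat (fst f)"
      if M: "fst f * transpose_mat M = transpose_mat M * snd f" "M \<in> carrier_mat (nrows X) (ncols X)" for M
      using arg_cong[OF M(1), of transpose_mat] M(2) cf by (simp add: transpose_mult[of _ "ncols X" "ncols X"] transpose_mult[of _ "ncols X" "nrows X"])
    then show "?t f \<in> phom X X"
      using cf phom_eqs[OF f] c by (intro phomI) auto
    show "hinv (?t f) \<longleftrightarrow> hinv f" using cf by (auto simp: hinv_def det_transpose)
  qed
  fix f g assume f: "f \<in> phom ?X ?X" and g: "g \<in> phom ?X ?X" and fg: "hinv (f \<boxplus> g)"
  have pX: "pencil ?X" using c by (simp add: pencil_def)
  have "?t (f \<boxplus> g) = ?t f \<boxplus> ?t g"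
    using phom_carrier[OF f] phom_carrier[OF g] by (auto simp: hplus_def transpose_add)
  then have "hinv (?t f \<boxplus> ?t g)" using t(2)[OF phom_plus[OF f g pX pX]] fg by simp
  then show "hinv f \<or> hinv g" using loc t[OF f] t[OF g] unfolding klocal_def by blast
qed

lemma klocal_swap:
  assumes loc: "klocal X" and X: "pencil X"
  shows "klocal (snd X, fst X)"
proof -
  have "phom (snd X, fst X) (snd X, fst X) = phom X X"
    using X by (auto simp: phom_def pencil_def)
  then show ?thesis using loc by (simp add: klocal_def)
qed

lemma det_jordan_block: "det (jordan_block k (\<mu> :: real)) = \<mu> ^ k"
  by (subst det_upper_triangular[of _ k]) (auto simp: prod_list_diag_prod)

lemma C_block_mat_Suc:
  "C_block_mat (Suc k) a b =
    four_block_mat (C_mat a b) (mat 2 (2 * k) (\<lambda>(i, j). if i = j then 1 else 0)) (0\<^sub>m (2 * k) 2) (C_block_mat k a b)"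
    (is "_ = ?R")
proof (rule eq_matI)
  fix i j assume "i < dim_row ?R" "j < dim_col ?R"
  then have ij: "i < 2 + 2 * k" "j < 2 + 2 * k" using C_mat_index(1)[of a b] by auto
  have C: "dim_row (C_mat a b) = 2" "dim_col (C_mat a b) = 2" using C_mat_index(1)[of a b] by auto
  consider "i < 2" "j < 2" | j' where "i < 2" "j = Suc (Suc j')" | i' where "i = Suc (Suc i')" "j < 2"
    | i' j' where "i = Suc (Suc i')" "j = Suc (Suc j')"
    by (metis One_nat_def Suc_1 less_Suc_eq not0_implies_Suc less_2_cases_iff)
  then show "C_block_mat (Suc k) a b $$ (i, j) = ?R $$ (i, j)"
  proof cases
    case 1
    then show ?thesis using ij C by (auto simp: C_block_mat_def)
  next
    case 2
    then have "i = 0 \<or> i = 1" by auto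
    then show ?thesis using ij C 2 by (auto simp: C_block_mat_index)
  next
    case 3
    then have "j = 0 \<or> j = 1" by auto
    then show ?thesis using ij C 3 by (auto simp: C_block_mat_def)
  next
    case 4
    then show ?thesis using ij C by (simp add: C_block_mat_def)
  qed
qed (use C_mat_index(1)[of a b] in auto)

lemma det_C_block_mat: "det (C_block_mat k a b) = (a\<^sup>2 + b\<^sup>2) ^ k"
proof (induction k)
  case 0
  then show ?case using det_dim_zero C_block_mat_carrier[of 0 a b] by simp
next
  case (Suc k)
  \<comment> \<open>The 2 x 2 determinant is evaluated as a block determinant with 1 x 1
    blocks.\<close>
  define s :: "real \<Rightarrow> real mat" where "s = (\<lambda>x. mat 1 1 (\<lambda>_. x))"
  have s: "s x \<in> carrier_mat 1 1" "s x * s y = s (x * y)" "s x - s y = s (x - y)" "det (s x) = x" for x y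
    using det_single[of "s x"] by (auto simp: s_def scalar_prod_def)
  have "C_mat a b = four_block_mat (s a) (s b) (s (- b)) (s a)" unfolding s_def
    using C_mat_index(1)[of a b] by (intro eq_matI) (auto simp: less_Suc_eq numeral_2_eq_2 C_mat_index)
  then have "det (C_mat a b) = a\<^sup>2 + b\<^sup>2"
    using det_four_block_mat[OF s(1)[of a] s(1)[of b] s(1)[of "- b"] s(1)[of a]]
    by (simp add: s power2_eq_square mult.commute)
  then show ?case unfolding C_block_mat_Suc
    by (subst det_four_block_mat_lower_left_zero[of _ 2 _ "2 * k"]) (auto simp: Suc C_mat_index)
qed

section \<open>Kronecker blocks are pairwise non-isomorphic\<close>

text \<open>Parameters of Kronecker blocks as data, so that families and parameters are compared by
  constructors; \<open>kblock\<close> turns out to be injective on valid codes.\<close>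

datatype kcode = KJ nat real | KInf nat | KC nat real real | KF nat | KFT nat

fun valid_code :: "kcode \<Rightarrow> bool" where
  "valid_code (KJ k \<mu>) \<longleftrightarrow> k \<ge> 1"
| "valid_code (KInf k) \<longleftrightarrow> k \<ge> 1"
| "valid_code (KC k a b) \<longleftrightarrow> k \<ge> 1 \<and> b > 0"
| "valid_code (KF k) \<longleftrightarrow> True"
| "valid_code (KFT k) \<longleftrightarrow> True"

fun kblock :: "kcode \<Rightarrow> real mat \<times> real mat" where
  "kblock (KJ k \<mu>) = (1\<^sub>m k, jordan_block k \<mu>)"
| "kblock (KInf k) = (jordan_block k 0, 1\<^sub>m k)"
| "kblock (KC k a b) = (1\<^sub>m (2 * k), C_block_mat k a b)"
| "kblock (KF k) = (F_mat k, G_mat k)"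
| "kblock (KFT k) = (transpose_mat (F_mat k), transpose_mat (G_mat k))"

lemma kronecker_block_iff: "kronecker_block Q \<longleftrightarrow> (\<exists>c. valid_code c \<and> Q = kblock c)"
proof
  assume "kronecker_block Q"
  then show "\<exists>c. valid_code c \<and> Q = kblock c"
  proof cases
    case (1 k \<mu>) then show ?thesis by (intro exI[of _ "KJ k \<mu>"]) simp
  next
    case (2 k) then show ?thesis by (intro exI[of _ "KInf k"]) simp
  next
    case (3 k b a) then show ?thesis by (intro exI[of _ "KC k a b"]) simp
  next
    case (4 k) then show ?thesis by (intro exI[of _ "KF k"]) simp
  next
    case (5 k) then show ?thesis by (intro exI[of _ "KFT k"]) simp
  qed
next
  assume "\<exists>c. valid_code c \<and> Q = kblock c"
  then obtain c where "valid_code c" "Q = kblock c" by blast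
  then show "kronecker_block Q" by (cases c) (simp_all add: kronecker_block.intros)
qed

lemma pencil_kblock [simp]: "pencil (kblock c)"
  by (cases c) (auto simp: pencil_def)

lemma kblock_nonzero: "valid_code c \<Longrightarrow> 0 < nrows (kblock c) + ncols (kblock c)"
  by (cases c) auto

lemma klocal_kblock:
  assumes "valid_code c"
  shows "klocal (kblock c)"
proof (cases c)
  case (KInf k)
  then show ?thesis using assms klocal_swap[OF klocal_jordan[of k 0]] pencil_kblock[of "KJ k 0"] by simp
next
  case (KFT k)
  then show ?thesis using klocal_transpose[OF klocal_F[of k]] pencil_kblock[of "KF k"] by simp
qed (use assms in \<open>simp_all add: klocal_jordan klocal_C klocal_F\<close>)

lemma pencil_iso_invertible:
  assumes "pencil_iso X Y" "pencil X" "nrows X = n" "ncols X = m"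
  shows "\<exists>R S. R \<in> carrier_mat n n \<and> S \<in> carrier_mat m m \<and> det R \<noteq> 0 \<and> det S \<noteq> 0 \<and>
    R * fst X = fst Y * S \<and> R * snd X = snd Y * S"
proof -
  obtain f g where f: "f \<in> phom X Y" "g \<in> phom Y X" "g \<star> f = hid X" "f \<star> g = hid Y"
    using assms(1) unfolding pencil_iso_def by auto
  have d: "nrows Y = n" "ncols Y = m" using pencil_iso_dims[OF assms(1)] assms by auto
  have c: "fst f \<in> carrier_mat n n" "snd f \<in> carrier_mat m m" "fst g \<in> carrier_mat n n" "snd g \<in> carrier_mat m m"
    using phom_carrier[OF f(1)] phom_carrier[OF f(2)] d assms by simp_all
  have "fst f * fst g = 1\<^sub>m n" "snd f * snd g = 1\<^sub>m m"
    using f(4) d by (auto simp: hcomp_def hid_def)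
  then have "det (fst f) \<noteq> 0" "det (snd f) \<noteq> 0"
    using det_nonzero_of_right_inverse[OF c(1,3)] det_nonzero_of_right_inverse[OF c(2,4)] by auto
  then show ?thesis using c phom_eqs[OF f(1)] by blast
qed

text \<open>With identity first components the isomorphism forces R = S, so M and N are similar and
  share their characteristic polynomial.\<close>

lemma pencil_iso_one_det:
  assumes iso: "pencil_iso (1\<^sub>m n, M) (1\<^sub>m n, N)" and M: "M \<in> carrier_mat n n" and N: "N \<in> carrier_mat n n"
  shows "det (M + x \<cdot>\<^sub>m 1\<^sub>m n) = det (N + x \<cdot>\<^sub>m 1\<^sub>m n)"
proof -
  obtain R S where R: "R \<in> carrier_mat n n" "S \<in> carrier_mat n n" "det R \<noteq> 0"
    "R * 1\<^sub>m n = 1\<^sub>m n * S" "R * M = N * S"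
    using pencil_iso_invertible[OF iso, of n n] M by (auto simp: pencil_def)
  have "R = S" using R by simp
  have "R * (M + x \<cdot>\<^sub>m 1\<^sub>m n) = (N + x \<cdot>\<^sub>m 1\<^sub>m n) * R"
    using R M N \<open>R = S\<close> mult_smult_distrib[of S n n "1\<^sub>m n" n x] mult_smult_assoc_mat[of "1\<^sub>m n" n n S n x]
    by (simp add: mat_distrib_left mat_distrib_right)
  then have "det R * det (M + x \<cdot>\<^sub>m 1\<^sub>m n) = det (N + x \<cdot>\<^sub>m 1\<^sub>m n) * det R"
    using det_mult[of R n "M + x \<cdot>\<^sub>m 1\<^sub>m n"] det_mult[of "N + x \<cdot>\<^sub>m 1\<^sub>m n" n R] R M N by simp
  then show ?thesis using R(3) by simp
qed

lemma jordan_block_plus_scalar: "jordan_block k \<mu> + x \<cdot>\<^sub>m 1\<^sub>m k = jordan_block k (\<mu> + (x :: real))"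
  by (intro eq_matI) auto

lemma C_block_mat_plus_scalar: "C_block_mat k a b + x \<cdot>\<^sub>m 1\<^sub>m (2 * k) = C_block_mat k (a + x) b"
  by (intro eq_matI) (auto simp: C_block_mat_index)

text \<open>Sizes isolate the rectangular families. Among square ones, the family at infinity has a
  singular first matrix; a real Jordan block makes det(M + x I) vanish at x = -\<mu>, while for a
  block with b > 0 it is a power of (a + x)^2 + b^2 and never vanishes.\<close>

lemma pencil_iso_kblock_eq:
  assumes iso: "pencil_iso (kblock c) (kblock c')" and valid: "valid_code c" "valid_code c'"
  shows "c = c'"
proof -
  have JJ: "\<mu> = \<nu>" if "pencil_iso (1\<^sub>m k, jordan_block k \<mu>) (1\<^sub>m k, jordan_block k \<nu>)" "k \<ge> 1" for k \<mu> \<nu>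
    using pencil_iso_one_det[OF that(1), of "- \<mu>"] that(2) by (simp add: jordan_block_plus_scalar det_jordan_block zero_power)
  have JC: False if "pencil_iso (1\<^sub>m (2 * k), jordan_block (2 * k) \<mu>) (1\<^sub>m (2 * k), C_block_mat k a b)" "k \<ge> 1" "b > 0" for k \<mu> a b
    using pencil_iso_one_det[OF that(1), of "- \<mu>"] that(2,3)
    by (simp add: jordan_block_plus_scalar det_jordan_block C_block_mat_plus_scalar det_C_block_mat sum_power2_eq_zero_iff zero_power)
  have CC: "a = a' \<and> b = b'"
    if iso: "pencil_iso (1\<^sub>m (2 * k), C_block_mat k a b) (1\<^sub>m (2 * k), C_block_mat k a' b')"
      and "k \<ge> 1" "b > 0" "b' > 0" for k a b a' b'
  proof -
    \<comment> \<open>The determinants are k-th powers of these nonnegative numbers, and k is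
      positive, so the bases agree; x = 0 and x = 1 then determine a and b.\<close>
    have *: "(a + x)\<^sup>2 + b\<^sup>2 = (a' + x)\<^sup>2 + b'\<^sup>2" for x
    proof (rule power_eq_imp_eq_base)
      show "((a + x)\<^sup>2 + b\<^sup>2) ^ k = ((a' + x)\<^sup>2 + b'\<^sup>2) ^ k"
        using pencil_iso_one_det[OF iso, of x] by (simp add: C_block_mat_plus_scalar det_C_block_mat)
    qed (use \<open>k \<ge> 1\<close> in auto)
    have "a = a'" using *[of 0] *[of 1] by (simp add: power2_eq_square algebra_simps)
    moreover have "b = b'" using *[of 0] \<open>a = a'\<close> that by simp
    ultimately show ?thesis ..
  qed
  have one_inf: False
    if iso: "pencil_iso (1\<^sub>m n, M) (jordan_block n 0, 1\<^sub>m n)" and M: "M \<in> carrier_mat n n" and n: "n \<ge> 1" for n M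
  proof -
    obtain R S :: "real mat" where R: "R \<in> carrier_mat n n" "S \<in> carrier_mat n n" "det R \<noteq> 0" "R * 1\<^sub>m n = jordan_block n 0 * S"
      using pencil_iso_invertible[OF iso, of n n] M by (auto simp: pencil_def)
    then have "R = jordan_block n 0 * S" by simp
    then have "det R = det (jordan_block n 0 :: real mat) * det S"
      using det_mult[of "jordan_block n 0 :: real mat" n S] R by simp
    then show False using R(3) n by (simp add: det_jordan_block)
  qed
  have inf_one: False if "pencil_iso (jordan_block n 0, 1\<^sub>m n) (1\<^sub>m n, M)" "M \<in> carrier_mat n n" "n \<ge> 1" for n M
    using one_inf[OF pencil_iso_sym[OF that(1)] that(2,3)] .
  note d = pencil_iso_dims[OF iso]
  show ?thesis
  proof (cases c)
    case (KJ k \<mu>)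
    then show ?thesis using iso d valid
      by (cases c') (auto dest: JJ JC one_inf[OF _ jordan_block_carrier])
  next
    case (KInf k)
    then show ?thesis using iso d valid
      by (cases c') (auto dest: inf_one[OF _ jordan_block_carrier] inf_one[OF _ C_block_mat_carrier])
  next
    case (KC k a b)
    then show ?thesis using iso d valid
      by (cases c') (auto dest: CC one_inf[OF _ C_block_mat_carrier] JC[OF pencil_iso_sym])
  next
    case (KF k)
    then show ?thesis using d by (cases c') auto
  next
    case (KFT k)
    then show ?thesis using d by (cases c') auto
  qed
qed

section \<open>Strict equivalences for the congruence blocks\<close>

lemma invertible_mat_inverse:
  fixes A :: "'a :: field mat"
  assumes "A \<in> carrier_mat n n" "invertible_mat A"
  obtains B where "B \<in> carrier_mat n n" "A * B = 1\<^sub>m n" "B * A = 1\<^sub>m n" "det B \<noteq> 0"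
proof -
  obtain B where B: "B \<in> carrier_mat n n" "A * B = 1\<^sub>m n" "B * A = 1\<^sub>m n"
    using mat_inverse_exists[OF assms(1)] invertible_mat_iff_det[OF assms(1)] assms(2) by metis
  then show thesis using that det_nonzero_of_right_inverse[OF B(1) assms(1)] by blast
qed

text \<open>Bridge to the categorical language: the column matrix of the equivalence is the inverse
  of the column component of the isomorphism.\<close>

lemma strictly_real_equivalent_iff:
  "strictly_real_equivalent m n X Y \<longleftrightarrow>
    fst X \<in> carrier_mat m n \<and> snd X \<in> carrier_mat m n \<and> pencil Y \<and> pencil_iso X Y"
proof
  assume sre: "strictly_real_equivalent m n X Y"
  then obtain R S where c: "fst X \<in> carrier_mat m n" "snd X \<in> carrier_mat m n" "fst Y \<in> carrier_mat m n" "snd Y \<in> carrier_mat m n"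
    and RS: "R \<in> carrier_mat m m" "S \<in> carrier_mat n n" "invertible_mat R" "invertible_mat S"
    "R * fst X * S = fst Y" "R * snd X * S = snd Y"
    unfolding strictly_real_equivalent_def by blast
  obtain T where T: "T \<in> carrier_mat n n" "S * T = 1\<^sub>m n" "det T \<noteq> 0"
    using invertible_mat_inverse[OF RS(2,4)] by metis
  have "R * M = R * M * S * T" if "M \<in> carrier_mat m n" for M
    using that RS(1,2) T(1,2) by (simp add: mat_assoc)
  then have "R * fst X = fst Y * T" "R * snd X = snd Y * T" using c RS by metis+
  then have "(R, T) \<in> phom X Y" using c RS(1) T by (intro phomI) auto
  moreover have "hinv (R, T)" using T RS invertible_mat_iff_det by (auto simp: hinv_def)
  ultimately have "pencil_iso X Y" using c by (intro pencil_isoI) (auto simp: pencil_def)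
  then show "fst X \<in> carrier_mat m n \<and> snd X \<in> carrier_mat m n \<and> pencil Y \<and> pencil_iso X Y"
    using c by (auto simp: pencil_def)
next
  assume asm: "fst X \<in> carrier_mat m n \<and> snd X \<in> carrier_mat m n \<and> pencil Y \<and> pencil_iso X Y"
  then have X: "pencil X" "nrows X = m" "ncols X = n" by (auto simp: pencil_def)
  then have Y: "fst Y \<in> carrier_mat m n" "snd Y \<in> carrier_mat m n"
    using asm pencil_iso_dims[of X Y] pencil_carrier[of Y] by auto
  obtain R S where RS: "R \<in> carrier_mat m m" "S \<in> carrier_mat n n" "det R \<noteq> 0" "det S \<noteq> 0"
    "R * fst X = fst Y * S" "R * snd X = snd Y * S"
    using pencil_iso_invertible[of X Y m n] asm X by blast
  obtain T where T: "T \<in> carrier_mat n n" "S * T = 1\<^sub>m n" "T * S = 1\<^sub>m n"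
    using mat_inverse_exists[OF RS(2,4)] by metis
  have "R * fst X * T = fst Y" "R * snd X * T = snd Y"
    using RS(1,2,5,6) T(1,2) Y asm by (simp_all add: mat_assoc)
  moreover have "invertible_mat R" "invertible_mat T"
    using RS invertible_mat_iff_det T det_nonzero_of_right_inverse[OF T(1) RS(2) T(3)] by auto
  ultimately show "strictly_real_equivalent m n X Y"
    unfolding strictly_real_equivalent_def using asm Y RS(1) T(1) by blast
qed

section \<open>Permutations of rows and columns: type (i)\<close>

lemma select_mat_bij:
  assumes inj: "inj_on \<rho> {..<n}" and range: "\<And>i. i < n \<Longrightarrow> \<rho> i < n"
  shows "select_mat n n \<rho> * transpose_mat (select_mat n n \<rho>) = (1\<^sub>m n :: 'a :: field mat)"
    "transpose_mat (select_mat n n \<rho>) * select_mat n n \<rho> = (1\<^sub>m n :: 'a :: field mat)"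
    "det (select_mat n n \<rho> :: 'a :: field mat) \<noteq> 0"
proof -
  let ?S = "select_mat n n \<rho> :: 'a mat"
  have "?S * transpose_mat ?S = mat n n (\<lambda>(i, j). ?S $$ (i, \<rho> j))"
    by (rule mult_transpose_select_mat) (auto simp: range)
  also have "\<dots> = 1\<^sub>m n"
    using inj range by (intro eq_matI) (auto simp: select_mat_def inj_on_def)
  finally show 1: "?S * transpose_mat ?S = 1\<^sub>m n" .
  show "transpose_mat ?S * ?S = 1\<^sub>m n"
    by (rule mat_mult_left_right_inverse[OF _ _ 1]) auto
  show "det ?S \<noteq> 0" using det_nonzero_of_right_inverse[OF _ _ 1] by simp
qed

lemma pencil_iso_select:
  assumes "pencil X" and dims: "nrows X = m" "ncols X = n"
    and \<rho>: "inj_on \<rho> {..<m}" "\<And>i. i < m \<Longrightarrow> \<rho> i < m"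
    and \<sigma>: "inj_on \<sigma> {..<n}" "\<And>i. i < n \<Longrightarrow> \<sigma> i < n"
    and Y: "fst Y = mat m n (\<lambda>(i, j). fst X $$ (\<rho> i, \<sigma> j))" "snd Y = mat m n (\<lambda>(i, j). snd X $$ (\<rho> i, \<sigma> j))"
  shows "pencil_iso X Y"
proof -
  let ?R = "select_mat m m \<rho> :: real mat" and ?S = "select_mat n n \<sigma> :: real mat"
  have *: "?R * M = mat m n (\<lambda>(i, j). M $$ (\<rho> i, \<sigma> j)) * ?S" if M: "M \<in> carrier_mat m n" for M
  proof -
    have RM: "?R * M \<in> carrier_mat m n" using M by auto
    have "?R * M * transpose_mat ?S = mat m n (\<lambda>(i, j). (?R * M) $$ (i, \<sigma> j))"
      by (rule mult_transpose_select_mat[OF RM]) (auto simp: \<sigma>)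
    also have "\<dots> = mat m n (\<lambda>(i, j). M $$ (\<rho> i, \<sigma> j))"
      using \<sigma> by (subst select_mat_mult[OF M \<rho>(2)]) (auto intro!: eq_matI)
    finally have "?R * M * transpose_mat ?S * ?S = mat m n (\<lambda>(i, j). M $$ (\<rho> i, \<sigma> j)) * ?S" by simp
    moreover have "?R * M * transpose_mat ?S * ?S = ?R * M"
      using M select_mat_bij(2)[OF \<sigma>, where 'a = real] by (simp add: mat_assoc)
    ultimately show ?thesis by simp
  qed
  have "(?R, ?S) \<in> phom X Y"
    using *[of "fst X"] *[of "snd X"] pencil_carrier[OF assms(1)] dims Y by (intro phomI) auto
  moreover have "hinv (?R, ?S)"
    using select_mat_bij(3)[OF \<rho>] select_mat_bij(3)[OF \<sigma>] by (auto simp: hinv_def)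
  ultimately show ?thesis using assms by (intro pencil_isoI) (auto simp: pencil_def)
qed

lemma jordan_odd_iso:
  fixes l :: nat
  defines "B \<equiv> jordan_block (2 * l + 1) (0 :: real)"
  shows "pencil_iso (transpose_mat B, B) (dsum (F_mat l, G_mat l) (transpose_mat (F_mat l), transpose_mat (G_mat l)))"
proof -
  \<comment> \<open>In both \<open>B\<close> and its transpose, row i meets only columns i - 1 and i
    + 1, so parities separate: the l odd rows with the l + 1 even columns give the F-G pair. The
    even rows with the odd columns give the transposed pair, listed in descending order so that the
    transpose of \<open>B\<close> becomes the transpose of \<open>F_mat\<close> rather than of
    \<open>G_mat\<close>.\<close>
  let ?\<rho> = "\<lambda>i. if i < l then 2 * i + 1 else 2 * (2 * l - i)"
  let ?\<sigma> = "\<lambda>j. if j < l + 1 then 2 * j else 2 * (2 * l - j) + 1"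
  have \<rho>: "inj_on ?\<rho> {..<2 * l + 1}" "\<And>i. i < 2 * l + 1 \<Longrightarrow> ?\<rho> i < 2 * l + 1"
    by (rule inj_onI, simp split: if_splits; presburger) auto
  have \<sigma>: "inj_on ?\<sigma> {..<2 * l + 1}" "\<And>i. i < 2 * l + 1 \<Longrightarrow> ?\<sigma> i < 2 * l + 1"
    by (rule inj_onI, simp split: if_splits; presburger) auto
  have entry: "transpose_mat B $$ (?\<rho> i, ?\<sigma> j) = (if Suc (?\<sigma> j) = ?\<rho> i then 1 else 0)"
    "B $$ (?\<rho> i, ?\<sigma> j) = (if Suc (?\<rho> i) = ?\<sigma> j then 1 else 0)" if "i < 2 * l + 1" "j < 2 * l + 1" for i j
    using \<rho>(2)[OF that(1)] \<sigma>(2)[OF that(2)] unfolding B_def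
    by (simp_all only: jordan_block_index index_transpose_mat) (simp_all split: if_split)
  have "fst (dsum (F_mat l, G_mat l) (transpose_mat (F_mat l), transpose_mat (G_mat l))) $$ (i, j) = (if Suc (?\<sigma> j) = ?\<rho> i then 1 else 0) \<and>
    snd (dsum (F_mat l, G_mat l) (transpose_mat (F_mat l), transpose_mat (G_mat l))) $$ (i, j) = (if Suc (?\<rho> i) = ?\<sigma> j then 1 else 0)" if "i < 2 * l + 1" "j < 2 * l + 1" for i j
    using that by (cases "i < l"; cases "j < l + 1"; auto simp: dsum_def F_mat_def G_mat_def Suc_double_not_eq_double double_not_eq_Suc_double)
  then have "fst (dsum (F_mat l, G_mat l) (transpose_mat (F_mat l), transpose_mat (G_mat l))) = mat (2 * l + 1) (2 * l + 1) (\<lambda>(i, j). fst (transpose_mat B, B) $$ (?\<rho> i, ?\<sigma> j))"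
    "snd (dsum (F_mat l, G_mat l) (transpose_mat (F_mat l), transpose_mat (G_mat l))) = mat (2 * l + 1) (2 * l + 1) (\<lambda>(i, j). snd (transpose_mat B, B) $$ (?\<rho> i, ?\<sigma> j))"
    using entry by (intro eq_matI; simp add: dsum_def)+
  then show ?thesis
    by (intro pencil_iso_select[OF _ _ _ \<rho> \<sigma>]) (auto simp: B_def pencil_def)
qed

lemma jordan_even_iso:
  fixes l :: nat
  defines "B \<equiv> jordan_block (2 * l) (0 :: real)"
  shows "pencil_iso (transpose_mat B, B) (dsum (jordan_block l 0, 1\<^sub>m l) (1\<^sub>m l, jordan_block l 0))"
proof -
  \<comment> \<open>Again parities separate, now into two square parts. Even rows with odd columns
    are listed in descending order, so that \<open>B\<close> gives the identity and its transpose
    the superdiagonal; the other part is ascending, with the roles exchanged.\<close>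
  let ?\<rho> = "\<lambda>i. if i < l then 2 * (l - Suc i) else 2 * (i - l) + 1"
  let ?\<sigma> = "\<lambda>j. if j < l then 2 * (l - Suc j) + 1 else 2 * (j - l)"
  have \<rho>: "inj_on ?\<rho> {..<2 * l}" "\<And>i. i < 2 * l \<Longrightarrow> ?\<rho> i < 2 * l"
    by (rule inj_onI, simp split: if_splits; presburger) auto
  have \<sigma>: "inj_on ?\<sigma> {..<2 * l}" "\<And>i. i < 2 * l \<Longrightarrow> ?\<sigma> i < 2 * l"
    by (rule inj_onI, simp split: if_splits; presburger) auto
  have entry: "transpose_mat B $$ (?\<rho> i, ?\<sigma> j) = (if Suc (?\<sigma> j) = ?\<rho> i then 1 else 0)"
    "B $$ (?\<rho> i, ?\<sigma> j) = (if Suc (?\<rho> i) = ?\<sigma> j then 1 else 0)" if "i < 2 * l" "j < 2 * l" for i j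
    using \<rho>(2)[OF that(1)] \<sigma>(2)[OF that(2)] unfolding B_def
    by (simp_all only: jordan_block_index index_transpose_mat) (simp_all split: if_split)
  have "fst (dsum (jordan_block l 0, 1\<^sub>m l) (1\<^sub>m l, jordan_block l 0)) $$ (i, j) = (if Suc (?\<sigma> j) = ?\<rho> i then 1 else 0) \<and>
    snd (dsum (jordan_block l 0, 1\<^sub>m l) (1\<^sub>m l, jordan_block l 0)) $$ (i, j) = (if Suc (?\<rho> i) = ?\<sigma> j then 1 else 0)" if "i < 2 * l" "j < 2 * l" for i j
    using that by (cases "i < l"; cases "j < l"; auto simp: dsum_def Suc_double_not_eq_double double_not_eq_Suc_double)
  then have "fst (dsum (jordan_block l 0, 1\<^sub>m l) (1\<^sub>m l, jordan_block l 0)) = mat (2 * l) (2 * l) (\<lambda>(i, j). fst (transpose_mat B, B) $$ (?\<rho> i, ?\<sigma> j))"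
    "snd (dsum (jordan_block l 0, 1\<^sub>m l) (1\<^sub>m l, jordan_block l 0)) = mat (2 * l) (2 * l) (\<lambda>(i, j). snd (transpose_mat B, B) $$ (?\<rho> i, ?\<sigma> j))"
    using entry by (intro eq_matI; simp add: dsum_def)+
  then show ?thesis
    by (intro pencil_iso_select[OF _ _ _ \<rho> \<sigma>]) (auto simp: B_def pencil_def)
qed

text \<open>\<open>chain \<alpha> \<beta> n p\<close> is entry \<open>p\<close> of the \<open>n\<close>-th vector of a Jordan chain starting with the first unit
  vector. Both pencils below lead to this recursion, with different \<open>\<alpha>\<close> and \<open>\<beta>\<close>.\<close>

fun chain :: "'a :: comm_ring_1 \<Rightarrow> 'a \<Rightarrow> nat \<Rightarrow> nat \<Rightarrow> 'a" where
  "chain \<alpha> \<beta> 0 p = (if p = 0 then 1 else 0)"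
| "chain \<alpha> \<beta> (Suc n) 0 = 0"
| "chain \<alpha> \<beta> (Suc n) (Suc p) = \<alpha> * chain \<alpha> \<beta> n p + \<beta> * chain \<alpha> \<beta> n (Suc p)"

lemma chain_eq_0: "n < p \<Longrightarrow> chain \<alpha> \<beta> n p = 0"
  by (induction \<alpha> \<beta> n p rule: chain.induct) auto

lemma chain_diag: "chain \<alpha> \<beta> n n = \<alpha> ^ n"
  by (induction n) (auto simp: chain_eq_0)

definition chain_mat :: "nat \<Rightarrow> 'a :: comm_ring_1 \<Rightarrow> 'a \<Rightarrow> 'a mat" where
  "chain_mat k \<alpha> \<beta> = mat k k (\<lambda>(p, n). chain \<alpha> \<beta> n p)"

lemma chain_mat_carrier [simp]: "chain_mat k \<alpha> \<beta> \<in> carrier_mat k k"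
  by (simp add: chain_mat_def)

lemma chain_mat_dim [simp]: "dim_row (chain_mat k \<alpha> \<beta>) = k" "dim_col (chain_mat k \<alpha> \<beta>) = k"
  by (simp_all add: chain_mat_def)

text \<open>The n-th chain vector ends at position n with entry \<alpha>^n, so the matrix is upper
  triangular with nonzero diagonal.\<close>

lemma det_chain_mat:
  fixes \<alpha> \<beta> :: "'a :: field"
  assumes "\<alpha> \<noteq> 0"
  shows "det (chain_mat k \<alpha> \<beta>) \<noteq> 0"
  using upper_triangular_imp_det_eq_0_iff[of "chain_mat k \<alpha> \<beta>" k] assms
  by (auto simp: upper_triangular_def chain_mat_def chain_eq_0 diag_mat_def chain_diag)

lemma jordan_block_mult_index:
  fixes A :: "'a :: comm_ring_1 mat"
  assumes "A \<in> carrier_mat k c" "i < k" "j < c"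
  shows "(jordan_block k \<mu> * A) $$ (i, j) = \<mu> * A $$ (i, j) + (if Suc i < k then A $$ (Suc i, j) else 0)"
proof -
  have "(jordan_block k \<mu> * A) $$ (i, j) = (\<Sum>l<k. (if l = i then \<mu> * A $$ (l, j) else 0) + (if l = Suc i then A $$ (l, j) else 0))"
    using assms by (auto simp: scalar_prod_def atLeast0LessThan intro!: sum.cong)
  then show ?thesis using assms by (simp add: sum.distrib)
qed

lemma mult_jordan_block_index:
  fixes A :: "'a :: comm_ring_1 mat"
  assumes "A \<in> carrier_mat r k" "i < r" "j < k"
  shows "(A * jordan_block k \<mu>) $$ (i, j) = \<mu> * A $$ (i, j) + (if j = 0 then 0 else A $$ (i, j - 1))"
proof -
  have "(A * jordan_block k \<mu>) $$ (i, j) =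
      (\<Sum>l<k. (if l = j then \<mu> * A $$ (i, l) else 0) + (if l = j - 1 then (if j = 0 then 0 else A $$ (i, l)) else 0))"
    using assms by (auto simp: scalar_prod_def atLeast0LessThan intro!: sum.cong)
  then show ?thesis using assms by (simp add: sum.distrib)
qed

text \<open>The columns of S form a Jordan chain for the inverse of \<open>jordan_block k a\<close>
  at 1/a. The parameters come from solving J(a) (s_n / a + s_(n-1)) = s_n for s_n(p + 1), which
  gives -a^2 s_(n-1)(p) - a s_(n-1)(p + 1).\<close>

lemma chain_mat_jordan_inverse:
  fixes a :: "'a :: field" and k :: nat
  assumes a: "a \<noteq> 0"
  defines "S \<equiv> chain_mat k (- a\<^sup>2) (- a)"
  shows "jordan_block k a * (S * jordan_block k (1 / a)) = S"
proof (rule eq_matI)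
  fix p n assume "p < dim_row S" "n < dim_col S"
  then have pn: "p < k" "n < k" by (simp_all add: S_def)
  define M where "M = S * jordan_block k (1 / a)"
  have M: "M \<in> carrier_mat k k"
    unfolding M_def S_def by (rule mult_carrier_mat[of _ k k]) simp_all
  define s where "s = chain (- a\<^sup>2) (- a)"
  have t: "M $$ (q, n) = s n q / a + (if n = 0 then 0 else s (n - 1) q)" if "q < k" for q
    unfolding M_def using pn that by (subst mult_jordan_block_index[of _ k]) (auto simp: S_def chain_mat_def s_def)
  have "(jordan_block k a * M) $$ (p, n) =
      a * (s n p / a + (if n = 0 then 0 else s (n - 1) p)) + (s n (Suc p) / a + (if n = 0 then 0 else s (n - 1) (Suc p)))"
    using pn t unfolding jordan_block_mult_index[OF M pn]
    by (cases "Suc p < k") (auto simp: s_def chain_eq_0)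
  also have "\<dots> = s n p"
    using a by (cases n) (auto simp: s_def field_simps power2_eq_square)
  finally show "(jordan_block k a * (S * jordan_block k (1 / a))) $$ (p, n) = S $$ (p, n)"
    unfolding M_def using pn by (simp add: S_def chain_mat_def s_def)
qed (auto simp: S_def)

text \<open>\<open>Gamma_mat\<close> over an arbitrary ring, since the chain is also needed over the
  complex numbers.\<close>

definition gamma :: "nat \<Rightarrow> 'a :: comm_ring_1 mat" where
  "gamma k = mat k k (\<lambda>(i, j). if i + j + 1 = k \<or> i + j = k then (- 1) ^ (k - (i + 1)) else 0)"

lemma gamma_carrier [simp]: "gamma k \<in> carrier_mat k k"
  by (simp add: gamma_def)

lemma gamma_dim [simp]: "dim_row (gamma k) = k" "dim_col (gamma k) = k"
  by (simp_all add: gamma_def)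

lemma Gamma_mat_eq: "Gamma_mat k = gamma k"
  by (simp add: Gamma_mat_def gamma_def)

lemma gamma_mult_index:
  fixes A :: "'a :: comm_ring_1 mat"
  assumes "A \<in> carrier_mat k c" "i < k" "j < c"
  shows "(gamma k * A) $$ (i, j) = (- 1) ^ (k - Suc i) * (A $$ (k - Suc i, j) + (if i = 0 then 0 else A $$ (k - i, j)))"
proof -
  have "(gamma k * A) $$ (i, j) =
      (\<Sum>l<k. (if l = k - Suc i then (- 1) ^ (k - Suc i) * A $$ (l, j) else 0) +
        (if l = k - i then (if i = 0 then 0 else (- 1) ^ (k - Suc i) * A $$ (l, j)) else 0))"
    using assms by (auto simp: gamma_def scalar_prod_def atLeast0LessThan intro!: sum.cong)
  then show ?thesis using assms by (simp add: sum.distrib algebra_simps)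
qed

text \<open>Signs of \<open>gamma\<close> are constant along rows, so in the transpose the two
  entries of a row have opposite signs. This is what cancels one antidiagonal in the pencil.\<close>

lemma transpose_gamma_mult_index:
  fixes A :: "'a :: comm_ring_1 mat"
  assumes "A \<in> carrier_mat k c" "i < k" "j < c"
  shows "(transpose_mat (gamma k) * A) $$ (i, j) = (- 1) ^ i * (A $$ (k - Suc i, j) - (if i = 0 then 0 else A $$ (k - i, j)))"
proof -
  have sgn: "(- 1 :: 'a) ^ i = - ((- 1) ^ (i - 1))" if "i \<noteq> 0" using that by (cases i) auto
  have "(transpose_mat (gamma k) * A) $$ (i, j) =
      (\<Sum>l<k. (if l = k - Suc i then (- 1) ^ i * A $$ (l, j) else 0) +
        (if l = k - i then (if i = 0 then 0 else (- 1) ^ (i - 1) * A $$ (l, j)) else 0))"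
    using assms by (auto simp: gamma_def scalar_prod_def atLeast0LessThan intro!: sum.cong)
  then show ?thesis using assms sgn by (simp add: sum.distrib algebra_simps)
qed

text \<open>The columns of \<open>chain_mat\<close> form a Jordan chain of \<open>\<Gamma>\<^sub>k - \<mu> \<Gamma>\<^sub>k\<^sup>T\<close>, whose only nonzero entries
  are \<open>\<plusminus>2\<close> on the second antidiagonal.\<close>

lemma gamma_chain:
  fixes \<zeta> \<eta> :: "'a :: field_char_0" and k :: nat
  assumes nz: "\<zeta> \<noteq> 0" "\<eta> \<noteq> 0"
  defines "\<mu> \<equiv> (- 1) ^ (k + 1)"
  defines "S \<equiv> chain_mat k (\<eta> / \<zeta> * \<mu> / 2) (- (\<eta> / \<zeta> * \<mu> / 2))"
  shows "(\<zeta> \<cdot>\<^sub>m gamma k) * S = (\<eta> \<cdot>\<^sub>m transpose_mat (gamma k)) * (S * jordan_block k (\<mu> * \<zeta> / \<eta>))"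
proof (rule eq_matI)
  let ?J = "jordan_block k (\<mu> * \<zeta> / \<eta>)"
  fix i n assume "i < dim_row ((\<eta> \<cdot>\<^sub>m transpose_mat (gamma k)) * (S * ?J))" "n < dim_col ((\<eta> \<cdot>\<^sub>m transpose_mat (gamma k)) * (S * ?J))"
  then have i: "i < k" "n < k" by auto
  have Sc: "S \<in> carrier_mat k k" by (simp add: S_def)
  then have SJ: "S * ?J \<in> carrier_mat k k" by (rule mult_carrier_mat) simp
  define s where "s = chain (\<eta> / \<zeta> * \<mu> / 2) (- (\<eta> / \<zeta> * \<mu> / 2))"
  define t where "t = (\<lambda>q. \<mu> * \<zeta> / \<eta> * s n q + (if n = 0 then 0 else s (n - 1) q))"
  have t: "(S * ?J) $$ (q, n) = t q" if "q < k" for q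
    using i that by (subst mult_jordan_block_index[of _ k]) (auto simp: S_def chain_mat_def s_def t_def)
  \<comment> \<open>Index k lies outside the matrix; its chain values vanish because n < k, so row i
    = 0, where k - i = k, obeys the general formula.\<close>
  have tk: "t k = 0" "s n k = 0" using i by (auto simp: t_def s_def chain_eq_0)
  have "\<mu> * \<mu> = 1" by (simp add: \<mu>_def flip: power_add)
  then have \<mu>\<mu>: "\<mu> * (\<mu> * x) = x" for x by (simp flip: mult.assoc)
  have sgn: "(- 1) ^ (k - Suc i) = \<mu> * (- 1) ^ i"
  proof -
    have "k + 1 = (k - Suc i) + (i + 2)" using i by simp
    then have "\<mu> = (- 1) ^ (k - Suc i) * (- 1) ^ (i + 2)" unfolding \<mu>_def by (metis power_add)
    then have "\<mu> * (- 1) ^ i = (- 1) ^ (k - Suc i) * ((- 1) ^ i * (- 1) ^ i)"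
      by (simp add: mult.assoc)
    also have "(- 1 :: 'a) ^ i * (- 1) ^ i = 1" by (simp flip: power_add)
    finally show ?thesis by simp
  qed
  let ?q = "k - Suc i"
  have q: "Suc ?q = k - i" using i by simp
  have rec: "s n (Suc p) = (if n = 0 then 0 else \<eta> / \<zeta> * \<mu> / 2 * (s (n - 1) p - s (n - 1) (Suc p)))" for p
    by (cases n) (auto simp: s_def algebra_simps)
  have "((\<zeta> \<cdot>\<^sub>m gamma k) * S) $$ (i, n) = \<zeta> * (gamma k * S) $$ (i, n)"
    using i Sc mult_smult_assoc_mat[OF gamma_carrier Sc, of \<zeta>] by simp
  also have "\<dots> = \<zeta> * (\<mu> * (- 1) ^ i * (s n ?q + s n (Suc ?q)))"
    using i tk by (simp add: gamma_mult_index[OF Sc] sgn q) (auto simp: S_def chain_mat_def s_def)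
  \<comment> \<open>After cancelling s_n(q) this says 2 \<zeta> \<mu> s_n(q + 1) = \<eta>
    (s_(n-1)(q) - s_(n-1)(q + 1)). As \<mu> is its own inverse, this is the chain recursion with the
    chosen parameters.\<close>
  also have "\<zeta> * (\<mu> * (s n ?q + s n (Suc ?q))) = \<eta> * (t ?q - t (Suc ?q))"
    using nz unfolding t_def rec by (auto simp: field_simps \<mu>\<mu>)
  then have "\<zeta> * (\<mu> * (- 1) ^ i * (s n ?q + s n (Suc ?q))) = \<eta> * ((- 1) ^ i * (t ?q - t (Suc ?q)))"
    by (simp add: mult.assoc mult.left_commute)
  also have "\<dots> = \<eta> * (transpose_mat (gamma k) * (S * ?J)) $$ (i, n)"
  proof -
    have "(if i = 0 then 0 else (S * ?J) $$ (k - i, n)) = t (Suc ?q)"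
      using i tk t[of "k - i"] by (simp only: q) (cases "i = 0"; simp)
    then show ?thesis unfolding transpose_gamma_mult_index[OF SJ i] using t[of ?q] i by simp
  qed
  also have "\<dots> = ((\<eta> \<cdot>\<^sub>m transpose_mat (gamma k)) * (S * ?J)) $$ (i, n)"
    using i mult_smult_assoc_mat[of "transpose_mat (gamma k)" k k "S * ?J" k \<eta>] SJ by simp
  finally show "((\<zeta> \<cdot>\<^sub>m gamma k) * S) $$ (i, n) = ((\<eta> \<cdot>\<^sub>m transpose_mat (gamma k)) * (S * ?J)) $$ (i, n)" .
qed (auto simp: S_def)

text \<open>Reversing the rows gives an upper triangular matrix with diagonal entries 1 and
  -1.\<close>

lemma det_gamma: "det (gamma k :: 'a :: field mat) \<noteq> 0"
proof -
  let ?\<rho> = "\<lambda>i. k - Suc i"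
  let ?E = "select_mat k k ?\<rho> :: 'a mat"
  have \<rho>: "inj_on ?\<rho> {..<k}" "\<And>i. i < k \<Longrightarrow> ?\<rho> i < k" by (auto simp: inj_on_def)
  have eq: "?E * gamma k = mat k k (\<lambda>(i, j). gamma k $$ (?\<rho> i, j))"
    by (rule select_mat_mult) (auto simp: \<rho>)
  have "upper_triangular (?E * gamma k)" "0 \<notin> set (diag_mat (?E * gamma k))"
    unfolding eq by (auto simp: upper_triangular_def gamma_def diag_mat_def)
  moreover have "?E * gamma k \<in> carrier_mat k k" by (rule mult_carrier_mat[of _ k k]) simp_all
  ultimately have "det (?E * gamma k) \<noteq> 0" using upper_triangular_imp_det_eq_0_iff by blast
  then show ?thesis using det_mult[of ?E k "gamma k"] by auto
qed

section \<open>Equivalence of square pairs and its transfer from complex to real matrices\<close>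

definition matrix_equiv :: "nat \<Rightarrow> 'a :: field mat \<Rightarrow> 'a mat \<Rightarrow> 'a mat \<Rightarrow> 'a mat \<Rightarrow> bool" where
  "matrix_equiv n P Q P' Q' \<longleftrightarrow>
    P \<in> carrier_mat n n \<and> Q \<in> carrier_mat n n \<and> P' \<in> carrier_mat n n \<and> Q' \<in> carrier_mat n n \<and>
    (\<exists>R \<in> carrier_mat n n. \<exists>T \<in> carrier_mat n n. det R \<noteq> 0 \<and> det T \<noteq> 0 \<and> R * P = P' * T \<and> R * Q = Q' * T)"

lemma pencil_iso_of_matrix_equiv:
  assumes "matrix_equiv n P Q P' Q'"
  shows "pencil_iso (P, Q) (P', Q')"
proof -
  obtain R T where "R \<in> carrier_mat n n" "T \<in> carrier_mat n n" "det R \<noteq> 0" "det T \<noteq> 0"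
    "R * P = P' * T" "R * Q = Q' * T"
    using assms unfolding matrix_equiv_def by blast
  then have "(R, T) \<in> phom (P, Q) (P', Q')" "hinv (R, T)"
    using assms by (auto intro!: phomI simp: matrix_equiv_def hinv_def)
  then show ?thesis using assms by (intro pencil_isoI) (auto simp: matrix_equiv_def pencil_def)
qed

text \<open>Two independent scalars because \<eta> multiplies the transpose: for real scalars they
  coincide, for \<open>C_mat a b\<close> they are complex conjugates.\<close>

lemma gamma_equiv:
  fixes \<zeta> \<eta> :: "'a :: field_char_0"
  assumes nz: "\<zeta> \<noteq> 0" "\<eta> \<noteq> 0"
  shows "matrix_equiv k (1\<^sub>m k) (jordan_block k ((- 1) ^ (k + 1) * \<zeta> / \<eta>))
    (\<eta> \<cdot>\<^sub>m transpose_mat (gamma k)) (\<zeta> \<cdot>\<^sub>m gamma k)"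
proof -
  define \<mu> :: 'a where "\<mu> = (- 1) ^ (k + 1)"
  let ?S = "chain_mat k (\<eta> / \<zeta> * \<mu> / 2) (- (\<eta> / \<zeta> * \<mu> / 2))"
  let ?G = "\<eta> \<cdot>\<^sub>m transpose_mat (gamma k)"
  have "\<mu> \<noteq> 0" by (simp add: \<mu>_def)
  then have S: "det ?S \<noteq> 0" using nz by (intro det_chain_mat) simp
  have "det ?G \<noteq> 0" using nz det_gamma[where 'a = 'a] det_transpose[OF gamma_carrier, where 'a = 'a] by simp
  then have "det (?G * ?S) \<noteq> 0" using S det_mult[of ?G k ?S] by simp
  moreover have "(?G * ?S) * jordan_block k (\<mu> * \<zeta> / \<eta>) = (\<zeta> \<cdot>\<^sub>m gamma k) * ?S"
    unfolding \<mu>_def gamma_chain[OF nz] by (rule mat_assoc) simp_all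
  moreover have "?G * ?S \<in> carrier_mat k k" by (rule mult_carrier_mat[of _ k k]) simp_all
  ultimately show ?thesis unfolding matrix_equiv_def using S
    by (intro conjI bexI[of _ "?G * ?S"] bexI[of _ ?S]) (simp_all add: \<mu>_def)
qed

lemma jordan_inverse_equiv:
  fixes a :: "'a :: field"
  assumes a: "a \<noteq> 0"
  shows "matrix_equiv k (1\<^sub>m k) (jordan_block k (1 / a)) (jordan_block k a) (1\<^sub>m k)"
proof -
  let ?S = "chain_mat k (- a\<^sup>2) (- a)"
  let ?J = "jordan_block k a"
  have S: "det ?S \<noteq> 0" using a by (intro det_chain_mat) simp
  have "det ?J = a ^ k" by (subst det_upper_triangular[of _ k]) (auto simp: prod_list_diag_prod)
  then have "det (?J * ?S) \<noteq> 0" using S a det_mult[of ?J k ?S] by simp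
  moreover have "?J * ?S * jordan_block k (1 / a) = ?S"
    using chain_mat_jordan_inverse[OF a, of k] assoc_mult_mat[of ?J k k ?S k "jordan_block k (1 / a)" k] by simp
  moreover have "?J * ?S \<in> carrier_mat k k" by (rule mult_carrier_mat[of _ k k]) simp_all
  ultimately show ?thesis unfolding matrix_equiv_def using S
    by (intro conjI bexI[of _ "?J * ?S"] bexI[of _ ?S]) simp_all
qed

text \<open>Reversing the order of the basis transposes a Jordan block.\<close>

lemma jordan_transpose_equiv:
  fixes a :: "'a :: field"
  shows "matrix_equiv k (transpose_mat (jordan_block k a)) (1\<^sub>m k) (jordan_block k a) (1\<^sub>m k)"
proof -
  let ?\<rho> = "\<lambda>i. k - Suc i"
  let ?E = "select_mat k k ?\<rho> :: 'a mat"
  let ?J = "jordan_block k a"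
  have \<rho>: "inj_on ?\<rho> {..<k}" "\<And>i. i < k \<Longrightarrow> ?\<rho> i < k" by (auto simp: inj_on_def)
  have sym: "transpose_mat ?E = ?E" by (intro eq_matI) (auto simp: select_mat_def)
  have l: "?E * transpose_mat ?J = mat k k (\<lambda>(i, j). transpose_mat ?J $$ (?\<rho> i, j))"
    by (rule select_mat_mult) (auto simp: \<rho>)
  have "?J * transpose_mat ?E = mat k k (\<lambda>(i, j). ?J $$ (i, ?\<rho> j))"
    by (rule mult_transpose_select_mat) (auto simp: \<rho>)
  then have "?E * transpose_mat ?J = ?J * ?E"
    unfolding sym l by (auto intro!: eq_matI)
  then show ?thesis unfolding matrix_equiv_def using select_mat_bij(3)[OF \<rho>, where 'a = 'a]
    by (intro conjI bexI[of _ ?E] bexI[of _ ?E]) simp_all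
qed

text \<open>Multiplicative because \<open>a + bi \<mapsto> C_mat a b\<close> is a ring homomorphism; it turns complex Jordan blocks
  into the blocks \<open>C_block_mat\<close>.\<close>

definition realify :: "complex mat \<Rightarrow> real mat" where
  "realify A = mat (2 * dim_row A) (2 * dim_col A) (\<lambda>(i, j).
     C_mat (Re (A $$ (i div 2, j div 2))) (Im (A $$ (i div 2, j div 2))) $$ (i mod 2, j mod 2))"

lemma realify_carrier [simp]: "A \<in> carrier_mat m n \<Longrightarrow> realify A \<in> carrier_mat (2 * m) (2 * n)"
  by (auto simp: realify_def)

lemma C_mat_mult_entry:
  assumes "r < 2" "s < 2"
  shows "C_mat (Re (x * y)) (Im (x * y)) $$ (r, s) =
    C_mat (Re x) (Im x) $$ (r, 0) * C_mat (Re y) (Im y) $$ (0, s) +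
    C_mat (Re x) (Im x) $$ (r, Suc 0) * C_mat (Re y) (Im y) $$ (Suc 0, s)"
  using assms by (auto simp: less_2_cases_iff C_mat_index algebra_simps)

lemma C_mat_sum_entry:
  assumes "r < 2" "s < 2"
  shows "C_mat (Re (sum f I)) (Im (sum f I)) $$ (r, s) = (\<Sum>l\<in>I. C_mat (Re (f l)) (Im (f l)) $$ (r, s))"
  using assms by (auto simp: less_2_cases_iff C_mat_index sum_negf)

lemma sum_lessThan_double: "(\<Sum>l<2 * n. g l) = (\<Sum>l<n. g (2 * l) + g (Suc (2 * l)) :: real)"
  by (induction n) auto

lemma realify_mult:
  assumes A: "A \<in> carrier_mat m n" and B: "B \<in> carrier_mat n c"
  shows "realify (A * B) = realify A * realify B"
proof (rule eq_matI)
  fix i j assume "i < dim_row (realify A * realify B)" "j < dim_col (realify A * realify B)"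
  then have ij: "i < 2 * m" "j < 2 * c" using A B by (auto simp: realify_def)
  then have d: "i div 2 < m" "j div 2 < c" "i mod 2 < 2" "j mod 2 < 2" by auto
  have AB: "(A * B) $$ (i div 2, j div 2) = (\<Sum>l<n. A $$ (i div 2, l) * B $$ (l, j div 2))"
    using d A B by (simp add: scalar_prod_def atLeast0LessThan)
  have "realify (A * B) $$ (i, j) = C_mat (Re ((A * B) $$ (i div 2, j div 2))) (Im ((A * B) $$ (i div 2, j div 2))) $$ (i mod 2, j mod 2)"
    using ij A B by (simp add: realify_def)
  also have "\<dots> = (\<Sum>l<n. C_mat (Re (A $$ (i div 2, l) * B $$ (l, j div 2))) (Im (A $$ (i div 2, l) * B $$ (l, j div 2))) $$ (i mod 2, j mod 2))"
    unfolding AB by (rule C_mat_sum_entry) (use d in auto)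
  also have "\<dots> = (\<Sum>l<n. realify A $$ (i, 2 * l) * realify B $$ (2 * l, j) + realify A $$ (i, Suc (2 * l)) * realify B $$ (Suc (2 * l), j))"
    unfolding C_mat_mult_entry[OF d(3,4)] using ij A B by (intro sum.cong) (auto simp: realify_def)
  also have "\<dots> = (\<Sum>l<2 * n. realify A $$ (i, l) * realify B $$ (l, j))"
    by (simp add: sum_lessThan_double)
  also have "\<dots> = (realify A * realify B) $$ (i, j)"
    using ij realify_carrier[OF A] realify_carrier[OF B] by (simp add: scalar_prod_def atLeast0LessThan)
  finally show "realify (A * B) $$ (i, j) = (realify A * realify B) $$ (i, j)" .
qed (use A B in \<open>auto simp: realify_def\<close>)

lemma realify_jordan_block: "realify (jordan_block k \<nu>) = C_block_mat k (Re \<nu>) (Im \<nu>)"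
proof (rule eq_matI)
  fix i j assume "i < dim_row (C_block_mat k (Re \<nu>) (Im \<nu>))" "j < dim_col (C_block_mat k (Re \<nu>) (Im \<nu>))"
  then have ij: "i < 2 * k" "j < 2 * k" by auto
  have "i mod 2 < 2" "j mod 2 < 2" by auto
  then show "realify (jordan_block k \<nu>) $$ (i, j) = C_block_mat k (Re \<nu>) (Im \<nu>) $$ (i, j)"
    using ij by (auto simp: realify_def C_block_mat_def less_2_cases_iff C_mat_index)
qed (auto simp: realify_def)

lemma realify_one [simp]: "realify (1\<^sub>m k) = 1\<^sub>m (2 * k)"
proof (rule eq_matI)
  fix i j assume "i < dim_row (1\<^sub>m (2 * k) :: real mat)" "j < dim_col (1\<^sub>m (2 * k) :: real mat)"
  then have ij: "i < 2 * k" "j < 2 * k" by auto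
  have m: "i mod 2 < 2" "j mod 2 < 2" by auto
  have "(i = j) = (i div 2 = j div 2 \<and> i mod 2 = j mod 2)" by (metis div_mult_mod_eq)
  then show "realify (1\<^sub>m k) $$ (i, j) = 1\<^sub>m (2 * k) $$ (i, j)"
    using ij m by (auto simp: realify_def less_2_cases_iff C_mat_index)
qed (auto simp: realify_def)

text \<open>Transposing \<open>C_mat a b\<close> negates b, that is, conjugates the complex entry it
  stands for.\<close>

lemma realify_adjoint: "realify (map_mat cnj (transpose_mat A)) = transpose_mat (realify A)"
proof (rule eq_matI)
  fix i j assume "i < dim_row (transpose_mat (realify A))" "j < dim_col (transpose_mat (realify A))"
  moreover have m: "i mod 2 < 2" "j mod 2 < 2" by auto
  ultimately show "realify (map_mat cnj (transpose_mat A)) $$ (i, j) = transpose_mat (realify A) $$ (i, j)"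
    by (auto simp: realify_def less_2_cases_iff C_mat_index less_mult_imp_div_less mult.commute)
qed (auto simp: realify_def)

text \<open>The inverse is realified as well, which avoids computing the real determinant.\<close>

lemma det_realify:
  assumes A: "A \<in> carrier_mat n n" and "det A \<noteq> 0"
  shows "det (realify A) \<noteq> 0"
proof -
  obtain B where B: "B \<in> carrier_mat n n" "A * B = 1\<^sub>m n" using mat_inverse_exists[OF assms] by metis
  then have "realify A * realify B = 1\<^sub>m (2 * n)" using realify_mult[OF A B(1)] by simp
  then show ?thesis using det_nonzero_of_right_inverse realify_carrier[OF A] realify_carrier[OF B(1)] by blast
qed

lemma matrix_equiv_realify:
  assumes "matrix_equiv n P Q P' Q'"
  shows "matrix_equiv (2 * n) (realify P) (realify Q) (realify P') (realify Q')"
proof -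
  have c: "P \<in> carrier_mat n n" "Q \<in> carrier_mat n n" "P' \<in> carrier_mat n n" "Q' \<in> carrier_mat n n"
    using assms by (auto simp: matrix_equiv_def)
  obtain R T where RT: "R \<in> carrier_mat n n" "T \<in> carrier_mat n n" "det R \<noteq> 0" "det T \<noteq> 0"
    and eq: "R * P = P' * T" "R * Q = Q' * T"
    using assms unfolding matrix_equiv_def by blast
  have "realify R * realify P = realify P' * realify T" "realify R * realify Q = realify Q' * realify T"
    using arg_cong[OF eq(1), of realify] arg_cong[OF eq(2), of realify] c RT by (simp_all add: realify_mult)
  then show ?thesis unfolding matrix_equiv_def using c RT det_realify[OF RT(1,3)] det_realify[OF RT(2,4)]
    by (intro conjI bexI[of _ "realify R"] bexI[of _ "realify T"]) simp_all
qed

text \<open>Conjugation by diag(1, -1, 1, -1, ...), the real form of complex conjugation; it allows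
  the second parameter to be made positive.\<close>

lemma C_block_conj_equiv:
  "matrix_equiv (2 * k) (1\<^sub>m (2 * k)) (C_block_mat k a b) (1\<^sub>m (2 * k)) (C_block_mat k a (- b))"
proof -
  let ?n = "2 * k"
  define D :: "real mat" where "D = mat ?n ?n (\<lambda>(i, j). if i = j then if even i then 1 else - 1 else 0)"
  have D: "D \<in> carrier_mat ?n ?n" by (simp add: D_def)
  have "upper_triangular D" "0 \<notin> set (diag_mat D)" by (auto simp: D_def upper_triangular_def diag_mat_def)
  then have det: "det D \<noteq> 0" using upper_triangular_imp_det_eq_0_iff[OF D] by simp
  have "D * C_block_mat k a b = C_block_mat k a (- b) * D"
  proof (rule eq_matI)
    fix i j assume "i < dim_row (C_block_mat k a (- b) * D)" "j < dim_col (C_block_mat k a (- b) * D)"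
    then have ij: "i < ?n" "j < ?n" by (simp_all add: D_def)
    have "(D * C_block_mat k a b) $$ (i, j) = (\<Sum>l<?n. D $$ (i, l) * C_block_mat k a b $$ (l, j))"
      using ij D by (simp add: scalar_prod_def atLeast0LessThan)
    also have "\<dots> = (\<Sum>l<?n. if l = i then (if even i then 1 else - 1) * C_block_mat k a b $$ (l, j) else 0)"
      using ij by (intro sum.cong) (auto simp: D_def)
    also have "\<dots> = (if even i then 1 else - 1) * C_block_mat k a b $$ (i, j)" using ij by simp
    also have "\<dots> = C_block_mat k a (- b) $$ (i, j) * (if even j then 1 else - 1)"
    proof -
      have "i \<noteq> 0" "even (i - Suc 0)" if "odd i" using that by (auto elim!: oddE)
      then show ?thesis using ij by (auto simp: C_block_mat_index)
    qed
    also have "\<dots> = (\<Sum>l<?n. if l = j then C_block_mat k a (- b) $$ (i, l) * (if even j then 1 else - 1) else 0)" using ij by simp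
    also have "\<dots> = (\<Sum>l<?n. C_block_mat k a (- b) $$ (i, l) * D $$ (l, j))"
      using ij by (intro sum.cong) (auto simp: D_def)
    also have "\<dots> = (C_block_mat k a (- b) * D) $$ (i, j)"
      using ij D by (simp add: scalar_prod_def atLeast0LessThan)
    finally show "(D * C_block_mat k a b) $$ (i, j) = (C_block_mat k a (- b) * D) $$ (i, j)" .
  qed (auto simp: D_def)
  then show ?thesis unfolding matrix_equiv_def using D det
    by (intro conjI bexI[of _ D] bexI[of _ D]) simp_all
qed

text \<open>For b = 0 the 2 x 2 blocks are scalar, so even and odd indices decouple into two Jordan
  blocks. This is the case of \<open>C_mat 0 1\<close>.\<close>

lemma C_block_real_iso:
  "pencil_iso (1\<^sub>m (2 * k), C_block_mat k x 0) (dsum (1\<^sub>m k, jordan_block k x) (1\<^sub>m k, jordan_block k x))"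
proof -
  let ?\<rho> = "\<lambda>i. if i < k then 2 * i else 2 * (i - k) + 1"
  have \<rho>: "inj_on ?\<rho> {..<2 * k}" "\<And>i. i < 2 * k \<Longrightarrow> ?\<rho> i < 2 * k"
    by (rule inj_onI, simp split: if_splits; presburger) auto
  let ?Y = "dsum (1\<^sub>m k, jordan_block k x) (1\<^sub>m k, jordan_block k x)"
  have entry: "1\<^sub>m (2 * k) $$ (?\<rho> i, ?\<rho> j) = (if ?\<rho> i = ?\<rho> j then 1 else 0 :: real)"
    "C_block_mat k x 0 $$ (?\<rho> i, ?\<rho> j) = (if ?\<rho> j = ?\<rho> i then x else 0) + (if ?\<rho> j = Suc (Suc (?\<rho> i)) then 1 else 0)"
    if "i < 2 * k" "j < 2 * k" for i j
    using \<rho>(2)[OF that(1)] \<rho>(2)[OF that(2)] by (simp_all only: C_block_mat_index index_one_mat) simp_all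
  have "fst ?Y $$ (i, j) = (if ?\<rho> i = ?\<rho> j then 1 else 0 :: real) \<and>
    snd ?Y $$ (i, j) = (if ?\<rho> j = ?\<rho> i then x else 0) + (if ?\<rho> j = Suc (Suc (?\<rho> i)) then 1 else 0)"
    if "i < 2 * k" "j < 2 * k" for i j
    using that by (cases "i < k"; cases "j < k"; (auto simp: dsum_def; presburger))
  then have "fst ?Y = mat (2 * k) (2 * k) (\<lambda>(i, j). fst (1\<^sub>m (2 * k), C_block_mat k x 0) $$ (?\<rho> i, ?\<rho> j))"
    "snd ?Y = mat (2 * k) (2 * k) (\<lambda>(i, j). snd (1\<^sub>m (2 * k), C_block_mat k x 0) $$ (?\<rho> i, ?\<rho> j))"
    using entry by (intro eq_matI; simp add: dsum_def)+
  then show ?thesis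
    by (intro pencil_iso_select[OF _ _ _ \<rho> \<rho>]) (auto simp: pencil_def)
qed

section \<open>The Kronecker form of a canonical form for congruence\<close>

text \<open>A relation on matrices, so that parameters need not be reconstructed from a block; that
  a block determines its codes up to order comes from uniqueness of the Kronecker form
  (\<open>kcf_unique\<close>).\<close>

inductive kcf :: "real mat \<Rightarrow> kcode list \<Rightarrow> bool" where
  odd: "kcf (jordan_block (2 * l + 1) 0) [KF l, KFT l]"
| even: "l \<ge> 1 \<Longrightarrow> kcf (jordan_block (2 * l) 0) [KInf l, KJ l 0]"
| ii_real: "k \<ge> 1 \<Longrightarrow> \<epsilon> \<in> {1, - 1} \<Longrightarrow>
    kcf (kronecker_product (Gamma_mat k) (scalar_mat \<epsilon>)) [KJ k ((- 1) ^ (k + 1))]"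
| ii_imaginary: "k \<ge> 1 \<Longrightarrow>
    kcf (kronecker_product (Gamma_mat k) (C_mat 0 1)) [KJ k ((- 1) ^ k), KJ k ((- 1) ^ k)]"
| ii_C: "k \<ge> 1 \<Longrightarrow> a\<^sup>2 + b\<^sup>2 = 1 \<Longrightarrow> b > 0 \<Longrightarrow> a \<noteq> 0 \<Longrightarrow>
    kcf (kronecker_product (Gamma_mat k) (C_mat a b)) [KC k ((- 1) ^ (k + 1) * (a\<^sup>2 - b\<^sup>2)) (2 * \<bar>a * b\<bar>)]"
| iii: "k \<ge> 1 \<Longrightarrow> 0 < \<bar>a\<bar> \<Longrightarrow> \<bar>a\<bar> < 1 \<Longrightarrow> kcf (H_mat k a) [KJ k a, KJ k (1 / a)]"
| iv: "k \<ge> 1 \<Longrightarrow> a\<^sup>2 + b\<^sup>2 < 1 \<Longrightarrow> b > 0 \<Longrightarrow>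
    kcf (H_hat_mat k a b) [KC k a b, KC k (a / (a\<^sup>2 + b\<^sup>2)) (b / (a\<^sup>2 + b\<^sup>2))]"

lemma kcf_exists:
  assumes "congruence_block B"
  shows "\<exists>cs. kcf B cs"
  using assms
proof cases
  case (type_i k)
  then show ?thesis using kcf.odd[of "k div 2"] kcf.even[of "k div 2"]
    by (cases "even k") (auto elim!: evenE oddE)
next
  case (type_ii_C k a b)
  show ?thesis
  proof (cases "a = 0")
    case True
    then have "b = 1" using type_ii_C by (simp add: power2_eq_1_iff)
    then show ?thesis using True type_ii_C kcf.ii_imaginary by auto
  next
    case False
    then show ?thesis unfolding type_ii_C(1) using kcf.ii_C[OF type_ii_C(2-4)] by blast
  qed
next
  case (type_ii_real k \<epsilon>)
  then show ?thesis using kcf.ii_real[of k \<epsilon>] by blast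
next
  case (type_iii k a)
  then show ?thesis using kcf.iii[of k a] by blast
next
  case (type_iv k a b)
  then show ?thesis using kcf.iv[of k a b] by blast
qed

lemma kcf_valid: "kcf B cs \<Longrightarrow> c \<in> set cs \<Longrightarrow> valid_code c"
  by (induction rule: kcf.induct) (auto simp: add_nonneg_pos add_pos_nonneg)

lemma kcf_nonempty: "kcf B cs \<Longrightarrow> cs \<noteq> []"
  by (induction rule: kcf.induct) auto

lemma pair_direct_sum_single: "pair_direct_sum [P] = P"
  by (simp add: pair_direct_sum_def del: diag_block_mat.simps)

lemma pair_direct_sum_two: "pencil P \<Longrightarrow> pencil Q \<Longrightarrow> pair_direct_sum [P, Q] = dsum P Q"
  by (subst pair_direct_sum_Cons) (auto simp: pair_direct_sum_single)

lemma kronecker_scalar: "kronecker_product (Gamma_mat k) (scalar_mat \<epsilon>) = \<epsilon> \<cdot>\<^sub>m gamma k"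
  by (intro eq_matI) (auto simp: kronecker_product_def scalar_mat_def Gamma_mat_eq)

lemma gamma_complex_entry:
  "i < k \<Longrightarrow> j < k \<Longrightarrow> gamma k $$ (i, j) = complex_of_real (gamma k $$ (i, j))"
  by (simp add: gamma_def)

lemma C_mat_scale: "i < 2 \<Longrightarrow> j < 2 \<Longrightarrow> C_mat (r * a) (r * b) $$ (i, j) = r * C_mat a b $$ (i, j)"
  by (auto simp: less_2_cases_iff C_mat_index)

lemma kronecker_C: "kronecker_product (Gamma_mat k) (C_mat a b) = realify (Complex a b \<cdot>\<^sub>m gamma k)"
proof (rule eq_matI)
  have C: "dim_row (C_mat a b) = 2" "dim_col (C_mat a b) = 2" using C_mat_index(1)[of a b] by auto
  fix i j assume "i < dim_row (realify (Complex a b \<cdot>\<^sub>m gamma k))" "j < dim_col (realify (Complex a b \<cdot>\<^sub>m gamma k))"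
  then have ij: "i < 2 * k" "j < 2 * k" by (auto simp: realify_def)
  then have d: "i div 2 < k" "j div 2 < k" "i < k * 2" "j < k * 2" by auto
  then show "kronecker_product (Gamma_mat k) (C_mat a b) $$ (i, j) = realify (Complex a b \<cdot>\<^sub>m gamma k) $$ (i, j)"
    using ij by (simp add: kronecker_product_def realify_def C Gamma_mat_eq gamma_complex_entry[OF d(1,2)] C_mat_scale mult.commute[of _ "gamma k $$ _"])
qed (use C_mat_index(1)[of a b] in \<open>auto simp: kronecker_product_def realify_def Gamma_mat_eq\<close>)

lemma transpose_kronecker_C:
  "transpose_mat (kronecker_product (Gamma_mat k) (C_mat a b)) =
    realify (cnj (Complex a b) \<cdot>\<^sub>m transpose_mat (gamma k))"
proof -
  have "map_mat cnj (transpose_mat (Complex a b \<cdot>\<^sub>m gamma k)) = cnj (Complex a b) \<cdot>\<^sub>m transpose_mat (gamma k)"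
    by (intro eq_matI) (auto simp: gamma_def)
  then show ?thesis unfolding kronecker_C by (simp flip: realify_adjoint)
qed

text \<open>As |z| = 1, z / conj z = z^2 with real part a^2 - b^2 and imaginary part 2ab. The second
  parameter may still be zero or negative; \<open>kcf_iso\<close> handles this.\<close>

lemma kronecker_C_iso:
  assumes ab: "a\<^sup>2 + b\<^sup>2 = 1"
  shows "pencil_iso
    (transpose_mat (kronecker_product (Gamma_mat k) (C_mat a b)), kronecker_product (Gamma_mat k) (C_mat a b))
    (1\<^sub>m (2 * k), C_block_mat k ((- 1) ^ (k + 1) * (a\<^sup>2 - b\<^sup>2)) ((- 1) ^ (k + 1) * (2 * a * b)))"
proof -
  define z where "z = Complex a b"
  have zz: "z * cnj z = 1" using ab by (simp add: z_def complex_eq_iff power2_eq_square)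
  then have nz: "z \<noteq> 0" "cnj z \<noteq> 0" by auto
  have zd: "z / cnj z = z * z" using zz nz by (simp add: field_simps)
  have sgn: "(- 1) ^ (k + 1) = complex_of_real ((- 1) ^ (k + 1))" by simp
  have "(- 1) ^ (k + 1) * z / cnj z = complex_of_real ((- 1) ^ (k + 1)) * (z * z)"
    unfolding sgn zd[symmetric] by simp
  then have "Re ((- 1) ^ (k + 1) * z / cnj z) = (- 1) ^ (k + 1) * (a\<^sup>2 - b\<^sup>2)"
    "Im ((- 1) ^ (k + 1) * z / cnj z) = (- 1) ^ (k + 1) * (2 * a * b)"
    by (simp_all only: Re_complex_of_real Im_complex_of_real times_complex.sel)
      (simp_all add: z_def power2_eq_square)
  moreover have "pencil_iso (1\<^sub>m (2 * k), realify (jordan_block k ((- 1) ^ (k + 1) * z / cnj z)))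
      (realify (cnj z \<cdot>\<^sub>m transpose_mat (gamma k)), realify (z \<cdot>\<^sub>m gamma k))"
    using pencil_iso_of_matrix_equiv[OF matrix_equiv_realify[OF gamma_equiv[OF nz, of k]]] by simp
  ultimately show ?thesis
    unfolding transpose_kronecker_C unfolding kronecker_C realify_jordan_block z_def[symmetric]
    using pencil_iso_sym by simp
qed

text \<open>Exchanging the two block rows makes \<open>B\<close> and its transpose block diagonal
  simultaneously.\<close>

lemma H_iso:
  fixes M :: "real mat"
  assumes M: "M \<in> carrier_mat n n"
  defines "B \<equiv> four_block_mat (0\<^sub>m n n) (1\<^sub>m n) M (0\<^sub>m n n)"
  shows "pencil_iso (transpose_mat B, B) (dsum (1\<^sub>m n, M) (transpose_mat M, 1\<^sub>m n))"
proof -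
  let ?R = "four_block_mat (0\<^sub>m n n) (1\<^sub>m n) (1\<^sub>m n) (0\<^sub>m n n) :: real mat"
  have R: "?R \<in> carrier_mat (n + n) (n + n)" by simp
  have Bt: "transpose_mat B = four_block_mat (0\<^sub>m n n) (transpose_mat M) (1\<^sub>m n) (0\<^sub>m n n)"
    unfolding B_def using M by (subst transpose_four_block_mat) auto
  have RR: "?R * ?R = 1\<^sub>m (n + n)" by (subst mult_four_block_mat) auto
  have "?R * transpose_mat B = four_block_mat (1\<^sub>m n) (0\<^sub>m n n) (0\<^sub>m n n) (transpose_mat M)"
    unfolding Bt using M by (subst mult_four_block_mat[of _ n n _ n _ n _ _ n _ n]) auto
  moreover have "?R * B = four_block_mat M (0\<^sub>m n n) (0\<^sub>m n n) (1\<^sub>m n)"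
    unfolding B_def using M by (subst mult_four_block_mat[of _ n n _ n _ n _ _ n _ n]) auto
  moreover have "B \<in> carrier_mat (n + n) (n + n)" unfolding B_def using M by simp
  ultimately have "matrix_equiv (n + n) (transpose_mat B) B (four_block_mat (1\<^sub>m n) (0\<^sub>m n n) (0\<^sub>m n n) (transpose_mat M))
      (four_block_mat M (0\<^sub>m n n) (0\<^sub>m n n) (1\<^sub>m n))"
    unfolding matrix_equiv_def using R M det_nonzero_of_right_inverse[OF R R RR]
    by (intro conjI bexI[of _ ?R] bexI[of _ "1\<^sub>m (n + n)"]) simp_all
  from pencil_iso_of_matrix_equiv[OF this] show ?thesis using M by (simp add: dsum_def)
qed

lemma jordan_transpose_inverse_iso:
  "a \<noteq> 0 \<Longrightarrow> pencil_iso (transpose_mat (jordan_block k a), 1\<^sub>m k) (1\<^sub>m k, jordan_block k (1 / a))"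
  using pencil_iso_trans[OF pencil_iso_of_matrix_equiv[OF jordan_transpose_equiv]
    pencil_iso_sym[OF pencil_iso_of_matrix_equiv[OF jordan_inverse_equiv]]]
  by (simp add: pencil_def)

text \<open>Transposition gives the conjugate eigenvalue, and passing from (M, 1) to (1, M) inverts
  it. With w = a + ib the result is 1 / conj w = w / |w|^2, again in the upper half plane.\<close>

lemma C_block_transpose_inverse_iso:
  assumes "b > 0"
  shows "pencil_iso (transpose_mat (C_block_mat k a b), 1\<^sub>m (2 * k))
    (1\<^sub>m (2 * k), C_block_mat k (a / (a\<^sup>2 + b\<^sup>2)) (b / (a\<^sup>2 + b\<^sup>2)))"
proof -
  define z where "z = cnj (Complex a b)"
  have nz: "z \<noteq> 0" using assms by (auto simp: z_def complex_eq_iff)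
  have "transpose_mat (C_block_mat k a b) = realify (map_mat cnj (transpose_mat (jordan_block k (Complex a b))))"
    by (simp add: realify_adjoint realify_jordan_block)
  also have "map_mat cnj (transpose_mat (jordan_block k (Complex a b))) = transpose_mat (jordan_block k z)"
    by (intro eq_matI) (auto simp: z_def)
  finally have 1: "transpose_mat (C_block_mat k a b) = realify (transpose_mat (jordan_block k z))" .
  have "Re (1 / z) = a / (a\<^sup>2 + b\<^sup>2)" "Im (1 / z) = b / (a\<^sup>2 + b\<^sup>2)"
    by (simp_all add: z_def Re_divide Im_divide)
  then have 2: "realify (jordan_block k (1 / z)) = C_block_mat k (a / (a\<^sup>2 + b\<^sup>2)) (b / (a\<^sup>2 + b\<^sup>2))"
    by (simp add: realify_jordan_block)
  have "pencil_iso (realify (transpose_mat (jordan_block k z)), 1\<^sub>m (2 * k)) (realify (jordan_block k z), 1\<^sub>m (2 * k))"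
    using pencil_iso_of_matrix_equiv[OF matrix_equiv_realify[OF jordan_transpose_equiv[of k z]]] by simp
  moreover have "pencil_iso (realify (jordan_block k z), 1\<^sub>m (2 * k)) (1\<^sub>m (2 * k), realify (jordan_block k (1 / z)))"
    using pencil_iso_sym[OF pencil_iso_of_matrix_equiv[OF matrix_equiv_realify[OF jordan_inverse_equiv[OF nz, of k]]]] by simp
  ultimately show ?thesis unfolding 1 2[symmetric]
    by (rule pencil_iso_trans) (auto simp: pencil_def realify_def)
qed

lemma H_mat_iso:
  assumes "a \<noteq> 0"
  shows "pencil_iso (transpose_mat (H_mat k a), H_mat k a) (dsum (1\<^sub>m k, jordan_block k a) (1\<^sub>m k, jordan_block k (1 / a)))"
  unfolding H_mat_def
  by (rule pencil_iso_trans[OF H_iso[OF jordan_block_carrier] pencil_iso_dsum[OF pencil_iso_refl jordan_transpose_inverse_iso[OF assms]]])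
    (auto simp: pencil_def dsum_def)

lemma H_hat_mat_iso:
  assumes "b > 0"
  shows "pencil_iso (transpose_mat (H_hat_mat k a b), H_hat_mat k a b)
    (dsum (1\<^sub>m (2 * k), C_block_mat k a b) (1\<^sub>m (2 * k), C_block_mat k (a / (a\<^sup>2 + b\<^sup>2)) (b / (a\<^sup>2 + b\<^sup>2))))"
  unfolding H_hat_mat_def
  by (rule pencil_iso_trans[OF H_iso[OF C_block_mat_carrier] pencil_iso_dsum[OF pencil_iso_refl C_block_transpose_inverse_iso[OF assms]]])
    (auto simp: pencil_def dsum_def)

lemma congruence_block_square: "congruence_block B \<Longrightarrow> B \<in> carrier_mat (dim_row B) (dim_row B)"
  by (induction rule: congruence_block.induct)
    (auto simp: kronecker_product_def scalar_mat_def Gamma_mat_def C_mat_def mat_of_rows_list_def H_mat_def H_hat_mat_def)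

lemma kcf_congruence_block: "kcf B cs \<Longrightarrow> congruence_block B"
proof (induction rule: kcf.induct)
  case (ii_imaginary k)
  then show ?case using congruence_block.type_ii_C[of k 0 1] by simp
qed (auto intro: congruence_block.intros)

lemma pencil_transpose_self: "B \<in> carrier_mat m m \<Longrightarrow> pencil (transpose_mat B, B)"
  by (auto simp: pencil_def)

lemma kcf_iso:
  assumes "kcf B cs"
  shows "pencil_iso (transpose_mat B, B) (pair_direct_sum (map kblock cs))"
proof -
  have sq: "pencil (transpose_mat B, B)"
    using congruence_block_square[OF kcf_congruence_block[OF assms]] by (rule pencil_transpose_self)
  have two: "pair_direct_sum (map kblock [c, d]) = dsum (kblock c) (kblock d)" for c d
    using pair_direct_sum_two by simp
  have one: "pair_direct_sum (map kblock [c]) = kblock c" for c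
    using pair_direct_sum_single by simp
  from assms show ?thesis
  proof cases
    case (odd l)
    show ?thesis unfolding odd two using jordan_odd_iso[of l] by simp
  next
    case (even l)
    show ?thesis unfolding even two using jordan_even_iso[of l] by simp
  next
    case (ii_real k \<epsilon>)
    then have nz: "\<epsilon> \<noteq> 0" by auto
    have "transpose_mat (\<epsilon> \<cdot>\<^sub>m gamma k) = \<epsilon> \<cdot>\<^sub>m transpose_mat (gamma k)" by auto
    then show ?thesis unfolding ii_real(1,2) one kronecker_scalar
      using pencil_iso_sym[OF pencil_iso_of_matrix_equiv[OF gamma_equiv[OF nz nz, of k]]] nz by simp
  next
    case (ii_imaginary k)
    have "pencil_iso (transpose_mat B, B) (1\<^sub>m (2 * k), C_block_mat k ((- 1) ^ k) 0)"
      using kronecker_C_iso[of 0 1 k] unfolding ii_imaginary by simp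
    from pencil_iso_trans[OF this C_block_real_iso sq] show ?thesis
      unfolding ii_imaginary two by (simp add: pencil_def dsum_def)
  next
    case (ii_C k a b)
    let ?x = "(- 1) ^ (k + 1) * (a\<^sup>2 - b\<^sup>2)" and ?y = "(- 1) ^ (k + 1) * (2 * a * b)"
    have iso: "pencil_iso (transpose_mat B, B) (1\<^sub>m (2 * k), C_block_mat k ?x ?y)"
      using kronecker_C_iso[OF ii_C(4), of k] unfolding ii_C by simp
    \<comment> \<open>The signs of ab and of (-1)^(k+1) decide whether a conjugation is needed to
      reach the positive parameter.\<close>
    have "2 * \<bar>a * b\<bar> = ?y \<or> 2 * \<bar>a * b\<bar> = - ?y"
      by (cases "even k") (auto simp: abs_if)
    then show ?thesis
    proof
      assume y: "2 * \<bar>a * b\<bar> = ?y"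
      show ?thesis unfolding ii_C(2) one kblock.simps y by (rule iso)
    next
      assume y: "2 * \<bar>a * b\<bar> = - ?y"
      from pencil_iso_trans[OF iso pencil_iso_of_matrix_equiv[OF C_block_conj_equiv] sq]
      have "pencil_iso (transpose_mat B, B) (1\<^sub>m (2 * k), C_block_mat k ?x (- ?y))" by (simp add: pencil_def)
      then show ?thesis unfolding ii_C(2) one kblock.simps y .
    qed
  next
    case (iii k a)
    then show ?thesis unfolding iii two using H_mat_iso[of a k] by simp
  next
    case (iv k a b)
    then show ?thesis unfolding iv two using H_hat_mat_iso[of b k a] by simp
  qed
qed

text \<open>Equal blocks are isomorphic, so \<open>pencil_iso_kblock_eq\<close> makes
  \<open>kblock\<close> injective on valid codes and its inverse can be mapped over both
  multisets.\<close>

lemma kblock_mset_eq: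
  assumes eq: "mset (map kblock cs) = mset (map kblock ds)"
    and valid: "\<forall>c \<in> set cs \<union> set ds. valid_code c"
  shows "mset cs = mset ds"
proof -
  have inj: "inj_on kblock {c. valid_code c}"
    using pencil_iso_kblock_eq pencil_iso_refl[OF pencil_kblock] by (intro inj_onI) (metis mem_Collect_eq)
  have *: "mset xs = image_mset (inv_into {c. valid_code c} kblock) (mset (map kblock xs))"
    if "\<forall>c \<in> set xs. valid_code c" for xs
    using that by (induction xs) (simp_all add: inv_into_f_f[OF inj])
  show ?thesis using *[of cs] *[of ds] valid eq by simp
qed

lemma kronecker_blocks_unique:
  assumes "pencil_iso (pair_direct_sum Ps) (pair_direct_sum Qs)"
    and "\<forall>P \<in> set Ps \<union> set Qs. kronecker_block P"
  shows "mset Ps = mset Qs"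
proof (rule krull_schmidt[OF assms(1)])
  show "\<forall>P \<in> set Ps \<union> set Qs. pencil P \<and> klocal P \<and> 0 < nrows P + ncols P"
  proof
    fix P assume "P \<in> set Ps \<union> set Qs"
    then obtain c where "valid_code c" "P = kblock c" using assms(2) kronecker_block_iff by metis
    then show "pencil P \<and> klocal P \<and> 0 < nrows P + ncols P"
      using klocal_kblock kblock_nonzero pencil_kblock by metis
  qed
  show "\<forall>P \<in> set Ps. \<forall>Q \<in> set Qs. pencil_iso P Q \<longrightarrow> P = Q"
  proof (intro ballI impI)
    fix P Q assume "P \<in> set Ps" "Q \<in> set Qs" "pencil_iso P Q"
    moreover from this obtain c d where "valid_code c" "P = kblock c" "valid_code d" "Q = kblock d"
      using assms(2) kronecker_block_iff by (metis UnCI)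
    ultimately show "P = Q" using pencil_iso_kblock_eq by metis
  qed
qed

lemma kblock_codes_unique:
  assumes "pencil_iso (pair_direct_sum (map kblock cs)) (pair_direct_sum (map kblock ds))"
    and "\<forall>c \<in> set cs \<union> set ds. valid_code c"
  shows "mset cs = mset ds"
  using assms kronecker_blocks_unique[OF assms(1)]
  by (intro kblock_mset_eq) (auto simp: kronecker_block_iff)

lemma kcf_unique:
  assumes "kcf B cs" "kcf B ds"
  shows "mset cs = mset ds"
proof (rule kblock_codes_unique)
  have [simp]: "pencil (transpose_mat B, B)"
    using congruence_block_square[OF kcf_congruence_block[OF assms(1)]] by (rule pencil_transpose_self)
  show "pencil_iso (pair_direct_sum (map kblock cs)) (pair_direct_sum (map kblock ds))"
    by (rule pencil_iso_trans[OF pencil_iso_sym[OF kcf_iso[OF assms(1)]] kcf_iso[OF assms(2)]]) simp_all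
qed (use assms kcf_valid in blast)

section \<open>Recovering a congruence block from its codes\<close>

lemma negate_kronecker_scalar:
  "- kronecker_product (Gamma_mat k) (scalar_mat \<epsilon>) = kronecker_product (Gamma_mat k) (scalar_mat (- \<epsilon>))"
  unfolding kronecker_scalar by (intro eq_matI) auto

lemma kcf_sign_change:
  assumes "sign_change B B'" "kcf B cs" "kcf B' ds"
  shows "mset cs = mset ds"
  using assms(1)
proof cases
  case unchanged
  then show ?thesis using kcf_unique assms by blast
next
  case (negate_summand k \<epsilon>)
  then have "kcf B [KJ k ((- 1) ^ (k + 1))]" "kcf B' [KJ k ((- 1) ^ (k + 1))]"
    unfolding negate_summand(1,2) negate_kronecker_scalar by (intro kcf.ii_real; auto)+
  then show ?thesis using kcf_unique assms by metis
next
  case (negate_a k a b)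
  show ?thesis
  proof (cases "a = 0")
    case True
    then have "B' = B" using negate_a by simp
    then show ?thesis using kcf_unique[OF assms(2)] assms(3) by blast
  next
    case False
    have "kcf B' [KC k ((- 1) ^ (k + 1) * ((- a)\<^sup>2 - b\<^sup>2)) (2 * \<bar>- a * b\<bar>)]"
      unfolding negate_a by (rule kcf.ii_C) (use negate_a False in auto)
    moreover have "kcf B [KC k ((- 1) ^ (k + 1) * (a\<^sup>2 - b\<^sup>2)) (2 * \<bar>a * b\<bar>)]"
      unfolding negate_a by (rule kcf.ii_C) (use negate_a False in auto)
    ultimately have "mset cs = {#KC k ((- 1) ^ (k + 1) * (a\<^sup>2 - b\<^sup>2)) (2 * \<bar>a * b\<bar>)#}"
      "mset ds = {#KC k ((- 1) ^ (k + 1) * ((- a)\<^sup>2 - b\<^sup>2)) (2 * \<bar>- a * b\<bar>)#}"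
      using kcf_unique[OF assms(2)] kcf_unique[OF assms(3)] by fastforce+
    then show ?thesis by simp
  qed
qed

text \<open>Maps every code occurring in the Kronecker form of a congruence block to the first one listed by \<open>kcf\<close>.\<close>

fun leader :: "kcode \<Rightarrow> kcode" where
  "leader (KF l) = KF l"
| "leader (KFT l) = KF l"
| "leader (KInf l) = KInf l"
| "leader (KJ k \<mu>) = (if \<mu> = 0 then KInf k else if \<bar>\<mu>\<bar> \<le> 1 then KJ k \<mu> else KJ k (1 / \<mu>))"
| "leader (KC k a b) = (if a\<^sup>2 + b\<^sup>2 \<le> 1 then KC k a b else KC k (a / (a\<^sup>2 + b\<^sup>2)) (b / (a\<^sup>2 + b\<^sup>2)))"

lemma inversion_norm:
  fixes a b :: real
  assumes "d = a\<^sup>2 + b\<^sup>2" "d \<noteq> 0"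
  shows "(a / d)\<^sup>2 + (b / d)\<^sup>2 = 1 / d"
proof -
  have "(a / d)\<^sup>2 + (b / d)\<^sup>2 = (a\<^sup>2 + b\<^sup>2) / d\<^sup>2" by (simp add: power_divide add_divide_distrib)
  then show ?thesis using assms by (simp add: power2_eq_square)
qed

text \<open>In coordinates: |z^2| = 1 for |z| = 1. It keeps type (ii) apart from type (iv), whose
  first code has modulus below 1.\<close>

lemma double_angle_norm:
  fixes a b :: real
  assumes "a\<^sup>2 + b\<^sup>2 = 1"
  shows "((- 1) ^ n * (a\<^sup>2 - b\<^sup>2))\<^sup>2 + (2 * \<bar>a * b\<bar>)\<^sup>2 = 1"
proof -
  have "((- 1 :: real) ^ n)\<^sup>2 = 1" by (simp flip: power_mult)
  then have "((- 1) ^ n * (a\<^sup>2 - b\<^sup>2))\<^sup>2 + (2 * \<bar>a * b\<bar>)\<^sup>2 = (a\<^sup>2 - b\<^sup>2)\<^sup>2 + 4 * a\<^sup>2 * b\<^sup>2"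
    by (simp add: power_mult_distrib)
  also have "\<dots> = (a\<^sup>2 + b\<^sup>2)\<^sup>2" by (simp add: power2_eq_square algebra_simps)
  finally show ?thesis using assms by simp
qed

text \<open>In types (iii) and (iv) the parameter inside the unit disc is listed first and the outer
  one is its inverse or its reflection in the unit circle. The non-strict bounds in
  \<open>leader\<close> make codes of modulus 1, those of type (ii), their own leaders.\<close>

lemma kcf_leader:
  assumes "kcf B cs" "c \<in> set cs"
  shows "leader c = hd cs"
  using assms(1)
proof cases
  case (iii k a)
  then show ?thesis using assms(2) by (auto simp: field_simps abs_if split: if_splits)
next
  case (iv k a b)
  define d where "d = a\<^sup>2 + b\<^sup>2"
  have d: "0 < d" "d < 1" using iv by (auto simp: d_def add_nonneg_pos)
  have "(a / d)\<^sup>2 + (b / d)\<^sup>2 = 1 / d" using inversion_norm[OF d_def] d by simp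
  then have "leader (KC k (a / d) (b / d)) = KC k a b" using d by simp
  then show ?thesis using assms(2) iv d by (auto simp flip: d_def)
next
  case (ii_C k a b)
  then show ?thesis using assms(2) double_angle_norm[OF ii_C(4), of "k + 1"] by simp
qed (use assms(2) in auto)

text \<open>Heads of different types never coincide: \<open>KF\<close> and \<open>KInf\<close> occur
  only for type (i), modulus 1 only for type (ii), and (-1)^(k+1) differs from (-1)^k.\<close>

lemma kcf_hd_sign_change:
  assumes "kcf B cs" "kcf B' ds" "hd cs = hd ds"
  shows "sign_change B B'"
  using assms(1)
proof cases
  case (odd l)
  with assms(2,3) show ?thesis by cases (auto intro: sign_change.unchanged)
next
  case (even l)
  with assms(2,3) show ?thesis by cases (auto intro: sign_change.unchanged)
next
  case (ii_real k \<epsilon>)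
  note B = ii_real
  from assms(2) show ?thesis
  proof cases
    case (ii_real k' \<epsilon>')
    then have "k' = k" using B assms(3) by simp
    have "\<epsilon>' = \<epsilon> \<or> \<epsilon>' = - \<epsilon>" using B ii_real by auto
    then show ?thesis
      using sign_change.unchanged[of B] sign_change.negate_summand[OF B(3,4)] unfolding B(1) ii_real(1) \<open>k' = k\<close> negate_kronecker_scalar
      by auto
  next
    case (iii k' a)
    then have "\<bar>a\<bar> = 1" using B assms(3) by (auto simp: power_abs)
    then show ?thesis using iii by simp
  qed (use B assms(3) in auto)
next
  case (ii_imaginary k)
  note B = ii_imaginary
  from assms(2) show ?thesis
  proof cases
    case (iii k' a)
    then have "\<bar>a\<bar> = 1" using B assms(3) by (auto simp: power_abs)
    then show ?thesis using iii by simp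
  qed (use B assms(3) in \<open>auto intro: sign_change.unchanged\<close>)
next
  case (ii_C k a b)
  note B = ii_C
  from assms(2) show ?thesis
  proof cases
    case (ii_C k' a' b')
    then have k: "k' = k" and "(- 1) ^ (k + 1) * (a\<^sup>2 - b\<^sup>2) = (- 1) ^ (k + 1) * (a'\<^sup>2 - b'\<^sup>2)" using B assms(3) by auto
    then have "a\<^sup>2 - b\<^sup>2 = a'\<^sup>2 - b'\<^sup>2" by simp
    \<comment> \<open>Sum and difference of the squares are both known, because the sum is
      1.\<close>
    then have sq: "a\<^sup>2 = a'\<^sup>2" "b\<^sup>2 = b'\<^sup>2" using B(4) ii_C(4) by linarith+
    have "a' = a \<or> a' = - a" using sq(1) by (auto simp: power2_eq_iff)
    moreover have "b' = b" using sq(2) B(5) ii_C(5) by (simp add: power2_eq_iff_nonneg)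
    ultimately have "a' = a \<or> a' = - a" "b' = b" by auto
    then show ?thesis
      using sign_change.unchanged[of B] sign_change.negate_a[OF B(3,4,5)] unfolding B(1) ii_C(1) k by auto
  next
    case (iv k' a' b')
    then show ?thesis using B assms(3) double_angle_norm[OF B(4), of "k + 1"] by auto
  qed (use B assms(3) in auto)
next
  case (iii k a)
  note B = iii
  from assms(2) show ?thesis
  proof cases
    case (ii_real k' \<epsilon>')
    then have "\<bar>a\<bar> = 1" using B assms(3) by (auto simp: power_abs)
    then show ?thesis using iii by simp
  next
    case (ii_imaginary k')
    then have "\<bar>a\<bar> = 1" using B assms(3) by (auto simp: power_abs)
    then show ?thesis using iii by simp
  qed (use B assms(3) in \<open>auto intro: sign_change.unchanged\<close>)
next
  case (iv k a b)
  note B = iv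
  from assms(2) show ?thesis
  proof cases
    case (ii_C k' a' b')
    then show ?thesis using B assms(3) double_angle_norm[OF ii_C(4), of "k' + 1"] by auto
  qed (use B assms(3) in \<open>auto intro: sign_change.unchanged\<close>)
qed

lemma kcf_shared_sign_change:
  assumes "kcf B cs" "kcf B' ds" "c \<in> set cs" "c \<in> set ds"
  shows "sign_change B B'"
  using kcf_hd_sign_change[OF assms(1,2)] kcf_leader assms by metis

section \<open>From single blocks to whole canonical forms\<close>

text \<open>By \<open>kcf_unique\<close> every choice has the same multiset, and only the multiset
  matters below.\<close>

definition codes_of :: "real mat \<Rightarrow> kcode list" where
  "codes_of B = (SOME cs. kcf B cs)"

lemma kcf_codes_of: "congruence_block B \<Longrightarrow> kcf B (codes_of B)"
  unfolding codes_of_def using kcf_exists by (rule someI_ex)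

lemma dsum_empty: "pencil Y \<Longrightarrow> dsum (0\<^sub>m 0 0, 0\<^sub>m 0 0) Y = Y"
  unfolding dsum_def by (intro prod_eqI; intro eq_matI) auto

lemma pair_direct_sum_append:
  assumes "\<forall>P \<in> set Ps \<union> set Qs. pencil P"
  shows "pair_direct_sum (Ps @ Qs) = dsum (pair_direct_sum Ps) (pair_direct_sum Qs)"
  using assms
proof (induction Ps)
  case Nil
  then show ?case by (simp add: pair_direct_sum_Nil dsum_empty)
next
  case (Cons P Ps)
  then show ?case by (simp add: pair_direct_sum_Cons dsum_assoc)
qed

text \<open>Transposition and block diagonal sums commute, so the codes concatenate. Squareness is
  carried along because the induction step needs the transposed tail to have the shape of the
  tail.\<close>

lemma diag_block_mat_iso:
  assumes "\<forall>B \<in> set Bs. congruence_block B"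
  shows "diag_block_mat Bs \<in> carrier_mat (dim_row (diag_block_mat Bs)) (dim_row (diag_block_mat Bs)) \<and>
    pencil_iso (transpose_mat (diag_block_mat Bs), diag_block_mat Bs)
      (pair_direct_sum (map kblock (concat (map codes_of Bs))))"
  using assms
proof (induction Bs)
  case Nil
  then show ?case by (simp add: pair_direct_sum_Nil pencil_iso_refl pencil_def)
next
  case (Cons B Bs)
  let ?D = "diag_block_mat Bs"
  let ?ds = "concat (map codes_of Bs)"
  have D: "?D \<in> carrier_mat (dim_row ?D) (dim_row ?D)" and
    iso: "pencil_iso (transpose_mat ?D, ?D) (pair_direct_sum (map kblock ?ds))"
    using Cons by auto
  obtain m where B: "B \<in> carrier_mat m m" using Cons.prems congruence_block_square by auto
  obtain d where D: "?D \<in> carrier_mat d d" using D by blast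
  have eq: "diag_block_mat (B # Bs) = four_block_mat B (0\<^sub>m m d) (0\<^sub>m d m) ?D"
    using carrier_matD[OF B] carrier_matD[OF D] by (simp only: diag_block_mat.simps Let_def)
  have tr: "transpose_mat (diag_block_mat (B # Bs)) = four_block_mat (transpose_mat B) (0\<^sub>m m d) (0\<^sub>m d m) (transpose_mat ?D)"
    unfolding eq using B D by (subst transpose_four_block_mat[of _ m m _ d _ d]) simp_all
  have "(transpose_mat (diag_block_mat (B # Bs)), diag_block_mat (B # Bs)) = dsum (transpose_mat B, B) (transpose_mat ?D, ?D)"
    unfolding tr unfolding eq dsum_def using carrier_matD[OF B] carrier_matD[OF D] by simp
  moreover have "pencil_iso (dsum (transpose_mat B, B) (transpose_mat ?D, ?D))
      (dsum (pair_direct_sum (map kblock (codes_of B))) (pair_direct_sum (map kblock ?ds)))"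
    using kcf_iso[OF kcf_codes_of] Cons.prems iso pencil_transpose_self[OF B] pencil_transpose_self[OF D]
    by (intro pencil_iso_dsum) auto
  moreover have "pair_direct_sum (map kblock (concat (map codes_of (B # Bs)))) =
      dsum (pair_direct_sum (map kblock (codes_of B))) (pair_direct_sum (map kblock ?ds))"
    by (simp, rule pair_direct_sum_append, auto)
  moreover have "diag_block_mat (B # Bs) \<in> carrier_mat (m + d) (m + d)"
    unfolding eq using B D by (rule four_block_carrier_mat)
  ultimately show ?case by (metis carrier_matD(1))
qed

lemma is_real_KCF_iff:
  "is_real_KCF m n X Ps \<longleftrightarrow> (\<forall>Q \<in> set Ps. kronecker_block Q) \<and>
    fst X \<in> carrier_mat m n \<and> snd X \<in> carrier_mat m n \<and> pencil_iso X (pair_direct_sum Ps)"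
proof -
  have "pencil (pair_direct_sum Ps)" if "\<forall>Q \<in> set Ps. kronecker_block Q"
    using that by (intro pencil_pair_direct_sum) (auto simp: kronecker_block_iff)
  then show ?thesis unfolding is_real_KCF_def strictly_real_equivalent_iff by blast
qed

text \<open>Transposing S A S^T = D gives S A^T S^T = D^T, so the same pair (S, S^T) transforms both
  matrices.\<close>

lemma real_congruent_iso:
  assumes "real_congruent n A D"
  shows "strictly_real_equivalent n n (transpose_mat A, A) (transpose_mat D, D)"
proof -
  obtain S where c: "A \<in> carrier_mat n n" "D \<in> carrier_mat n n" "S \<in> carrier_mat n n" "invertible_mat S"
    and eq: "S * A * transpose_mat S = D"
    using assms unfolding real_congruent_def by blast
  have "transpose_mat D = transpose_mat (transpose_mat S) * transpose_mat (S * A)"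
    unfolding eq[symmetric] using c by (intro transpose_mult[of _ n n _ n]) auto
  also have "\<dots> = S * transpose_mat A * transpose_mat S"
    using c by (simp add: transpose_mult[of S n n A n] mat_assoc)
  finally have "S * transpose_mat A * transpose_mat S = transpose_mat D" ..
  moreover have "invertible_mat (transpose_mat S)"
    using c invertible_mat_iff_det[of S n] invertible_mat_iff_det[of "transpose_mat S" n] by (simp add: det_transpose)
  ultimately show ?thesis unfolding strictly_real_equivalent_def
    using c eq by (intro conjI bexI[of _ S] bexI[of _ "transpose_mat S"]) simp_all
qed

lemma canonical_form_KCF:
  assumes "is_first_canonical_form n A Bs"
  shows "is_real_KCF n n (transpose_mat A, A) (map kblock (concat (map codes_of Bs)))"
proof -
  let ?D = "diag_block_mat Bs"
  have Bs: "\<forall>B \<in> set Bs. congruence_block B" and cong: "real_congruent n A ?D"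
    using assms by (auto simp: is_first_canonical_form_def)
  have A: "A \<in> carrier_mat n n" and D: "?D \<in> carrier_mat n n" using cong by (auto simp: real_congruent_def)
  have "pencil_iso (transpose_mat A, A) (transpose_mat ?D, ?D)"
    using real_congruent_iso[OF cong] unfolding strictly_real_equivalent_iff by simp
  from pencil_iso_trans[OF this conjunct2[OF diag_block_mat_iso[OF Bs]]]
  have "pencil_iso (transpose_mat A, A) (pair_direct_sum (map kblock (concat (map codes_of Bs))))"
    using pencil_transpose_self[OF A] pencil_transpose_self[OF D] by simp
  moreover have "\<forall>Q \<in> set (map kblock (concat (map codes_of Bs))). kronecker_block Q"
    using kcf_valid[OF kcf_codes_of] Bs by (auto simp: kronecker_block_iff)
  ultimately show ?thesis unfolding is_real_KCF_iff using A by simp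
qed

lemma is_real_KCF_unique:
  assumes "is_real_KCF m n X Ps" "is_real_KCF m n X Qs"
  shows "mset Ps = mset Qs"
proof (rule kronecker_blocks_unique)
  have "pencil (pair_direct_sum Rs)" if "is_real_KCF m n X Rs" for Rs
    using that unfolding is_real_KCF_def by (intro pencil_pair_direct_sum) (auto simp: kronecker_block_iff)
  moreover have "pencil X" using assms(1) unfolding is_real_KCF_iff pencil_def by auto
  moreover note assms
  ultimately have "pencil (pair_direct_sum Ps)" "pencil (pair_direct_sum Qs)" "pencil X" by blast+
  then show "pencil_iso (pair_direct_sum Ps) (pair_direct_sum Qs)"
    using pencil_iso_trans[OF pencil_iso_sym, of X "pair_direct_sum Ps" "pair_direct_sum Qs"] assms
    unfolding is_real_KCF_iff by simp
  show "\<forall>P \<in> set Ps \<union> set Qs. kronecker_block P"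
    using assms unfolding is_real_KCF_iff by blast
qed

definition code_mset :: "real mat list \<Rightarrow> kcode multiset" where
  "code_mset Bs = mset (concat (map codes_of Bs))"

lemma code_mset_simps [simp]:
  "code_mset [] = {#}" "code_mset (B # Bs) = mset (codes_of B) + code_mset Bs"
  by (simp_all add: code_mset_def)

lemma code_mset_cong: "mset Bs = mset Cs \<Longrightarrow> code_mset Bs = code_mset Cs"
proof -
  have "code_mset Bs = (\<Sum>B\<in>#mset Bs. mset (codes_of B))" for Bs
    by (induction Bs) simp_all
  then show "mset Bs = mset Cs \<Longrightarrow> code_mset Bs = code_mset Cs" by simp
qed

text \<open>Both directions of the theorem become statements about \<open>code_mset\<close>: an
  invariant of the list of congruence blocks on one side, of the Kronecker form on the
  other.\<close>

lemma KCF_eq_iff_codes: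
  assumes Bs: "is_first_canonical_form n A Bs" and Bs': "is_first_canonical_form n A' Bs'"
    and Ps: "is_real_KCF n n (transpose_mat A, A) Ps" and Ps': "is_real_KCF n n (transpose_mat A', A') Ps'"
  shows "mset Ps = mset Ps' \<longleftrightarrow> code_mset Bs = code_mset Bs'"
proof -
  let ?P = "map kblock (concat (map codes_of Bs))" and ?P' = "map kblock (concat (map codes_of Bs'))"
  have P: "mset Ps = mset ?P" "mset Ps' = mset ?P'"
    using is_real_KCF_unique[OF Ps canonical_form_KCF[OF Bs]] is_real_KCF_unique[OF Ps' canonical_form_KCF[OF Bs']] by auto
  show ?thesis
  proof
    assume "code_mset Bs = code_mset Bs'"
    then show "mset Ps = mset Ps'" unfolding P code_mset_def mset_map by simp
  next
    assume eq: "mset Ps = mset Ps'"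
    have valid: "\<forall>c \<in> set (concat (map codes_of Bs)) \<union> set (concat (map codes_of Bs')). valid_code c"
      using Bs Bs' kcf_valid[OF kcf_codes_of] by (auto simp: is_first_canonical_form_def)
    show "code_mset Bs = code_mset Bs'"
      unfolding code_mset_def using eq valid unfolding P by (rule kblock_mset_eq)
  qed
qed

text \<open>If the code multisets agree, one code of the first block B occurs in some B'. A single
  shared code already makes B and B' equal up to sign, hence all their codes agree and can be
  cancelled. As no block has an empty code list, nothing is left over when \<open>Bs\<close> is
  exhausted.\<close>

lemma equal_up_to_signs_iff:
  assumes "\<forall>B \<in> set Bs. congruence_block B" "\<forall>B \<in> set Bs'. congruence_block B"
  shows "code_mset Bs = code_mset Bs' \<longleftrightarrow> equal_up_to_permutation_and_signs Bs Bs'"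
proof
  assume "code_mset Bs = code_mset Bs'"
  then show "equal_up_to_permutation_and_signs Bs Bs'"
    using assms
  proof (induction Bs arbitrary: Bs')
    case Nil
    have "Bs' = []"
    proof (cases Bs')
      case (Cons B Cs)
      then have "codes_of B = []" using Nil.prems(1) by simp
      then show ?thesis using kcf_nonempty[OF kcf_codes_of] Nil.prems(3) Cons by auto
    qed
    then show ?case by (simp add: equal_up_to_permutation_and_signs_def)
  next
    case (Cons B Bs)
    have B: "kcf B (codes_of B)" using Cons.prems kcf_codes_of by simp
    define c where "c = hd (codes_of B)"
    have c: "c \<in> set (codes_of B)" using kcf_nonempty[OF B] by (simp add: c_def)
    then have "c \<in># code_mset Bs'" using Cons.prems(1) by (metis code_mset_simps(2) set_mset_mset union_iff)
    then obtain B' where B': "B' \<in> set Bs'" "c \<in> set (codes_of B')" by (auto simp: code_mset_def)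
    then have kB': "kcf B' (codes_of B')" using Cons.prems kcf_codes_of by simp
    have sign: "sign_change B B'" by (rule kcf_shared_sign_change[OF B kB' c B'(2)])
    have perm: "mset (B' # remove1 B' Bs') = mset Bs'" using B'(1) by simp
    have "mset (codes_of B) + code_mset Bs = mset (codes_of B') + code_mset (remove1 B' Bs')"
      using Cons.prems(1) code_mset_cong[OF perm] by simp
    then have "code_mset Bs = code_mset (remove1 B' Bs')" using kcf_sign_change[OF sign B kB'] by simp
    then have "equal_up_to_permutation_and_signs Bs (remove1 B' Bs')"
      using Cons.prems by (intro Cons.IH) (auto dest: notin_set_remove1[THEN contrapos_np])
    then obtain Cs where "mset Cs = mset (remove1 B' Bs')" "list_all2 sign_change Bs Cs"
      unfolding equal_up_to_permutation_and_signs_def by blast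
    then have "mset (B' # Cs) = mset Bs'" "list_all2 sign_change (B # Bs) (B' # Cs)" using sign perm by auto
    then show ?case unfolding equal_up_to_permutation_and_signs_def by blast
  qed
next
  assume "equal_up_to_permutation_and_signs Bs Bs'"
  then obtain Cs where Cs: "mset Cs = mset Bs'" "list_all2 sign_change Bs Cs"
    unfolding equal_up_to_permutation_and_signs_def by blast
  have "\<forall>B \<in> set Cs. congruence_block B" using Cs(1) assms(2) by (metis set_mset_mset)
  with Cs(2) assms(1) have "code_mset Bs = code_mset Cs"
    by (induction rule: list_all2_induct) (auto intro!: kcf_sign_change kcf_codes_of)
  then show "code_mset Bs = code_mset Bs'" using code_mset_cong[OF Cs(1)] by simp
qed

lemma kcf_is_real_KCF:
  assumes "kcf B cs" "dim_row B = m"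
  shows "is_real_KCF m m (transpose_mat B, B) (map kblock cs)"
proof -
  have "B \<in> carrier_mat m m"
    using congruence_block_square[OF kcf_congruence_block[OF assms(1)]] assms(2) by simp
  moreover have "\<forall>Q \<in> set (map kblock cs). kronecker_block Q"
    using kcf_valid[OF assms(1)] by (auto simp: kronecker_block_iff)
  ultimately show ?thesis using kcf_iso[OF assms(1)] unfolding is_real_KCF_iff by simp
qed

theorem theorem4p2:
  shows
    "(\<forall>n A Bs. is_first_canonical_form n A Bs \<longrightarrow>
        (\<exists>Ps. is_real_KCF n n (transpose_mat A, A) Ps) \<and>
        (\<forall>A' Bs' Ps Ps'. is_first_canonical_form n A' Bs' \<and> mset Bs' = mset Bs \<and>
           is_real_KCF n n (transpose_mat A, A) Ps \<and>
           is_real_KCF n n (transpose_mat A', A') Ps' \<longrightarrow> mset Ps' = mset Ps)) \<and>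
     (\<forall>n A A' Bs Bs' Ps Ps'.
        is_first_canonical_form n A Bs \<and> is_first_canonical_form n A' Bs' \<and>
        is_real_KCF n n (transpose_mat A, A) Ps \<and>
        is_real_KCF n n (transpose_mat A', A') Ps' \<longrightarrow>
        (mset Ps = mset Ps' \<longleftrightarrow> equal_up_to_permutation_and_signs Bs Bs')) \<and>
     (\<forall>k l B. k \<ge> 1 \<and> B = jordan_block k 0 \<longrightarrow>
        (k = 2 * l + 1 \<longrightarrow>
           is_real_KCF k k (transpose_mat B, B)
             [(F_mat l, G_mat l), (transpose_mat (F_mat l), transpose_mat (G_mat l))]) \<and>
        (k = 2 * l \<longrightarrow>
           is_real_KCF k k (transpose_mat B, B)
             [(jordan_block l 0, 1\<^sub>m l), (1\<^sub>m l, jordan_block l 0)])) \<and>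
     (\<forall>k \<epsilon> B. k \<ge> 1 \<and> \<epsilon> \<in> {1, - 1} \<and>
        B = kronecker_product (Gamma_mat k) (scalar_mat \<epsilon>) \<longrightarrow>
        is_real_KCF k k (transpose_mat B, B) [(1\<^sub>m k, jordan_block k ((- 1) ^ (k + 1)))]) \<and>
     (\<forall>k a b B. k \<ge> 1 \<and> a\<^sup>2 + b\<^sup>2 = 1 \<and> b > 0 \<and>
        B = kronecker_product (Gamma_mat k) (C_mat a b) \<longrightarrow>
        (a = 0 \<and> b = 1 \<longrightarrow>
           is_real_KCF (2 * k) (2 * k) (transpose_mat B, B)
             [(1\<^sub>m k, jordan_block k ((- 1) ^ k)), (1\<^sub>m k, jordan_block k ((- 1) ^ k))]) \<and>
        (a \<noteq> 0 \<longrightarrow>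
           is_real_KCF (2 * k) (2 * k) (transpose_mat B, B)
             [(1\<^sub>m (2 * k), C_block_mat k ((- 1) ^ (k + 1) * (a\<^sup>2 - b\<^sup>2)) (2 * \<bar>a * b\<bar>))])) \<and>
     (\<forall>k a B. k \<ge> 1 \<and> 0 < \<bar>a\<bar> \<and> \<bar>a\<bar> < 1 \<and> B = H_mat k a \<longrightarrow>
        is_real_KCF (2 * k) (2 * k) (transpose_mat B, B)
          [(1\<^sub>m k, jordan_block k a), (1\<^sub>m k, jordan_block k (1 / a))]) \<and>
     (\<forall>k a b B. k \<ge> 1 \<and> a\<^sup>2 + b\<^sup>2 < 1 \<and> b > 0 \<and> B = H_hat_mat k a b \<longrightarrow>
        is_real_KCF (4 * k) (4 * k) (transpose_mat B, B)
          [(1\<^sub>m (2 * k), C_block_mat k a b),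
           (1\<^sub>m (2 * k), C_block_mat k (a / (a\<^sup>2 + b\<^sup>2)) (b / (a\<^sup>2 + b\<^sup>2)))])"
proof (intro conjI, goal_cases)
  case 1
  show ?case
  proof (intro allI impI conjI)
    fix n A Bs assume "is_first_canonical_form n A Bs"
    then show "\<exists>Ps. is_real_KCF n n (transpose_mat A, A) Ps" using canonical_form_KCF by blast
  next
    fix n A Bs A' Bs' Ps Ps'
    assume "is_first_canonical_form n A Bs" and "is_first_canonical_form n A' Bs' \<and> mset Bs' = mset Bs \<and>
      is_real_KCF n n (transpose_mat A, A) Ps \<and> is_real_KCF n n (transpose_mat A', A') Ps'"
    then show "mset Ps' = mset Ps"
      using KCF_eq_iff_codes[of n A' Bs' A Bs Ps' Ps] code_mset_cong[of Bs' Bs] by simp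
  qed
next
  case 2
  show ?case
  proof (intro allI impI)
    fix n A A' Bs Bs' Ps Ps'
    assume *: "is_first_canonical_form n A Bs \<and> is_first_canonical_form n A' Bs' \<and>
      is_real_KCF n n (transpose_mat A, A) Ps \<and> is_real_KCF n n (transpose_mat A', A') Ps'"
    then have "\<forall>B \<in> set Bs. congruence_block B" "\<forall>B \<in> set Bs'. congruence_block B"
      by (simp_all add: is_first_canonical_form_def)
    then show "mset Ps = mset Ps' \<longleftrightarrow> equal_up_to_permutation_and_signs Bs Bs'"
      using KCF_eq_iff_codes[of n A Bs A' Bs' Ps Ps'] * equal_up_to_signs_iff[of Bs Bs'] by simp
  qed
next
  case 3
  show ?case
  proof (intro allI impI conjI; elim conjE)
    fix k l B assume "B = jordan_block k (0 :: real)" "k = 2 * l + 1"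
    then show "is_real_KCF k k (transpose_mat B, B)
        [(F_mat l, G_mat l), (transpose_mat (F_mat l), transpose_mat (G_mat l))]"
      using kcf_is_real_KCF[OF kcf.odd[of l], of k] by simp
  next
    fix k l B assume "1 \<le> k" "B = jordan_block k (0 :: real)" "k = 2 * l"
    then show "is_real_KCF k k (transpose_mat B, B) [(jordan_block l 0, 1\<^sub>m l), (1\<^sub>m l, jordan_block l 0)]"
      using kcf_is_real_KCF[OF kcf.even[of l], of k] by simp
  qed
next
  case 4
  show ?case
  proof (intro allI impI; elim conjE)
    fix k B and \<epsilon> :: real
    assume "1 \<le> k" "\<epsilon> \<in> {1, - 1}" and B: "B = kronecker_product (Gamma_mat k) (scalar_mat \<epsilon>)"
    from kcf_is_real_KCF[OF kcf.ii_real[OF this(1,2)], of k]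
    show "is_real_KCF k k (transpose_mat B, B) [(1\<^sub>m k, jordan_block k ((- 1) ^ (k + 1)))]"
      unfolding B by (simp add: kronecker_scalar)
  qed
next
  case 5
  show ?case
  proof (intro allI impI conjI; elim conjE)
    fix k a b B assume "1 \<le> k" "B = kronecker_product (Gamma_mat k) (C_mat a b)" "a = 0" "b = 1"
    then show "is_real_KCF (2 * k) (2 * k) (transpose_mat B, B)
        [(1\<^sub>m k, jordan_block k ((- 1) ^ k)), (1\<^sub>m k, jordan_block k ((- 1) ^ k))]"
      using kcf_is_real_KCF[OF kcf.ii_imaginary[of k], of "2 * k"] C_mat_index(1)[of 0 1]
      by (simp add: kronecker_product_def Gamma_mat_eq)
  next
    fix k a b B
    assume "1 \<le> k" "a\<^sup>2 + b\<^sup>2 = 1" "0 < b" "a \<noteq> 0" and B: "B = kronecker_product (Gamma_mat k) (C_mat a b)"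
    from kcf_is_real_KCF[OF kcf.ii_C[OF this(1-4)], of "2 * k"]
    show "is_real_KCF (2 * k) (2 * k) (transpose_mat B, B)
        [(1\<^sub>m (2 * k), C_block_mat k ((- 1) ^ (k + 1) * (a\<^sup>2 - b\<^sup>2)) (2 * \<bar>a * b\<bar>))]"
      using C_mat_index(1)[of a b] unfolding B by (simp add: kronecker_product_def Gamma_mat_eq)
  qed
next
  case 6
  show ?case
  proof (intro allI impI; elim conjE)
    fix k a B assume "1 \<le> k" "0 < \<bar>a\<bar>" "\<bar>a\<bar> < 1" and B: "B = H_mat k a"
    from kcf_is_real_KCF[OF kcf.iii[OF this(1-3)], of "2 * k"]
    show "is_real_KCF (2 * k) (2 * k) (transpose_mat B, B) [(1\<^sub>m k, jordan_block k a), (1\<^sub>m k, jordan_block k (1 / a))]"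
      unfolding B by (simp add: H_mat_def)
  qed
next
  case 7
  show ?case
  proof (intro allI impI; elim conjE)
    fix k a b B assume "1 \<le> k" "a\<^sup>2 + b\<^sup>2 < 1" "0 < b" and B: "B = H_hat_mat k a b"
    from kcf_is_real_KCF[OF kcf.iv[OF this(1-3)], of "4 * k"]
    show "is_real_KCF (4 * k) (4 * k) (transpose_mat B, B)
        [(1\<^sub>m (2 * k), C_block_mat k a b), (1\<^sub>m (2 * k), C_block_mat k (a / (a\<^sup>2 + b\<^sup>2)) (b / (a\<^sup>2 + b\<^sup>2)))]"
      unfolding B by (simp add: H_hat_mat_def)
  qed
qed

end
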